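(* Let $w\in\mathbb{C}$ and let $z\in\mathbb{C}$ with $-1<\mathrm{Re}(z)<1$. If $\alpha$ and $\beta$ are positive numbers satisfying $\alpha\beta=1$, then $$\frac{16}{\pi}\int_{0}^{\infty}\Xi\left(\frac{t+iz}{2}\right)\Xi\left(\frac{t-iz}{2}\right)\frac{\nabla_{2}\left(\alpha,\frac{z}{2},w,\frac{1+it}{2}\right)}{\left(t^2+(z+1)^2\right)\left(t^2+(z-1)^2\right)}\,dt$$ $$=e^{-\frac{w^2}{4}}\sqrt{\alpha}\,\bigg\{4\sum_{n=1}^{\infty}\sigma_{-z}(n)n^{\frac{z}{2}}e^{-\frac{w^2}{4}}K_{\frac{z}{2},iw}(2n\pi\alpha)-\Gamma\left(\frac{z}{2}\right)\zeta(z)\pi^{-\frac{z}{2}}\alpha^{\frac{z}{2}-1}\,{}_1F_1\left(\frac{1-z}{2};\frac12;\frac{w^2}{4}\right)$$ $$\qquad\qquad-\Gamma\left(-\frac{z}{2}\right)\zeta(-z)\pi^{\frac{z}{2}}\alpha^{-\frac{z}{2}-1}\,{}_1F_1\left(\frac{1+z}{2};\frac12;\frac{w^2}{4}\right)\bigg\}.$$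
   Context: The generalized modified Bessel function is defined, for $z,w\in\mathbb{C}$, by $$K_{z,w}(x):=\frac{1}{2\pi i}\int_{c-i\infty}^{c+i\infty}\Gamma\left(\tfrac{s-z}{2}\right)\Gamma\left(\tfrac{s+z}{2}\right)\,{}_1F_1\left(\tfrac{s-z}{2};\tfrac12;-\tfrac{w^2}{4}\right){}_1F_1\left(\tfrac{s+z}{2};\tfrac12;-\tfrac{w^2}{4}\right)2^{s-2}x^{-s}\,ds,$$ where $c=\mathrm{Re}(s)>|\mathrm{Re}(z)|$. Here ${}_1F_1(a;c;u)=\sum_{n\ge0}\frac{(a)_n u^n}{(c)_n n!}$ with $(a)_n=a(a+1)\cdots(a+n-1)$. $\nabla_2(x,z,w,s):=\rho(x,z,w,s)+\rho(x,z,w,1-s)$, where $$\rho(x,z,w,s):=x^{\frac12-s}\,{}_1F_1\left(\tfrac{1-s-z}{2};\tfrac12;-\tfrac{w^2}{4}\right){}_1F_1\left(\tfrac{1-s+z}{2};\tfrac12;-\tfrac{w^2}{4}\right).$$ $\Xi(t):=\xi(\frac12+it)$ with $\xi(s):=\frac12 s(s-1)\pi^{-s/2}\Gamma(\frac s2)\zeta(s)$ and $\zeta$ the Riemann zeta function; $\sigma_{-z}(n)=\sum_{d\mid n}d^{-z}$. At $z=0$ the right-hand side is understood as its limit as $z\to0$ (removable singularity). *)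

theory Defs
  imports "HOL-Complex_Analysis.Complex_Analysis"
begin

text \<open>Confluent hypergeometric function \<open>\<^sub>1F\<^sub>1(a; c; u)\<close>.\<close>

definition hyp1F1 :: "complex \<Rightarrow> complex \<Rightarrow> complex \<Rightarrow> complex" where
  "hyp1F1 a c u = (\<Sum>n. pochhammer a n * u ^ n / (pochhammer c n * fact n))"

text \<open>
  The Riemann zeta function is the analytic continuation of its Dirichlet series to the plane
  without the point 1. Its value at the pole is set to 0 so that the description is unique.
\<close>

definition riemann_zeta :: "complex \<Rightarrow> complex" where
  "riemann_zeta = (THE f. f holomorphic_on (- {1}) \<and>
     (\<forall>s. Re s > 1 \<longrightarrow> (\<lambda>n. of_nat (Suc n) powr (- s)) sums f s) \<and> f 1 = 0)"

text \<open>
  \<^const>\<open>remove_sings\<close> supplies the values of the entire function \<open>\<xi>\<close> at the removable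
  singularities of the product (the pole of \<open>\<zeta>\<close> and the poles of the Gamma factor).
\<close>

definition riemann_xi :: "complex \<Rightarrow> complex" where
  "riemann_xi = remove_sings
     (\<lambda>s. 1/2 * s * (s - 1) * of_real pi powr (- s / 2) * Gamma (s / 2) * riemann_zeta s)"

definition riemann_Xi :: "complex \<Rightarrow> complex" where
  "riemann_Xi t = riemann_xi (1/2 + \<i> * t)"

definition divisor_sigma :: "complex \<Rightarrow> nat \<Rightarrow> complex" where
  "divisor_sigma a n = (\<Sum>d | d dvd n. of_nat d powr a)"

text \<open>
  Integral over the upward vertical line \<open>Re s = c\<close>, parametrised by \<open>s = c + it\<close>,
  \<open>ds = i dt\<close>.
\<close>

definition has_vertical_integral :: "(complex \<Rightarrow> complex) \<Rightarrow> complex \<Rightarrow> real \<Rightarrow> bool" where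
  "has_vertical_integral f I c \<longleftrightarrow> ((\<lambda>t. f (Complex c t) * \<i>) has_integral I) UNIV"

definition gen_bessel_K_integrand :: "complex \<Rightarrow> complex \<Rightarrow> real \<Rightarrow> complex \<Rightarrow> complex" where
  "gen_bessel_K_integrand z w x s =
     Gamma ((s - z) / 2) * Gamma ((s + z) / 2) *
     hyp1F1 ((s - z) / 2) (1/2) (- w\<^sup>2 / 4) * hyp1F1 ((s + z) / 2) (1/2) (- w\<^sup>2 / 4) *
     2 powr (s - 2) * of_real x powr (- s)"

text \<open>
  Generalized modified Bessel function \<open>K\<^bsub>z,w\<^esub>(x)\<close> for \<open>x > 0\<close>: the common value,
  for all admissible abscissae \<open>c\<close>, of the inverse Mellin integral.
\<close>

definition gen_bessel_K :: "complex \<Rightarrow> complex \<Rightarrow> real \<Rightarrow> complex" where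
  "gen_bessel_K z w x = (THE K. \<forall>c. c > \<bar>Re z\<bar> \<longrightarrow>
     has_vertical_integral (gen_bessel_K_integrand z w x) (2 * of_real pi * \<i> * K) c)"

definition rho :: "real \<Rightarrow> complex \<Rightarrow> complex \<Rightarrow> complex \<Rightarrow> complex" where
  "rho x z w s = of_real x powr (1/2 - s) *
     hyp1F1 ((1 - s - z) / 2) (1/2) (- w\<^sup>2 / 4) * hyp1F1 ((1 - s + z) / 2) (1/2) (- w\<^sup>2 / 4)"

definition nabla2 :: "real \<Rightarrow> complex \<Rightarrow> complex \<Rightarrow> complex \<Rightarrow> complex" where
  "nabla2 x z w s = rho x z w s + rho x z w (1 - s)"

definition Xi_integrand :: "real \<Rightarrow> complex \<Rightarrow> complex \<Rightarrow> real \<Rightarrow> complex" where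
  "Xi_integrand \<alpha> z w t =
     riemann_Xi ((of_real t + \<i> * z) / 2) * riemann_Xi ((of_real t - \<i> * z) / 2) *
     nabla2 \<alpha> (z / 2) w ((1 + \<i> * of_real t) / 2) /
     (((of_real t)\<^sup>2 + (z + 1)\<^sup>2) * ((of_real t)\<^sup>2 + (z - 1)\<^sup>2))"

definition bessel_term :: "real \<Rightarrow> complex \<Rightarrow> complex \<Rightarrow> nat \<Rightarrow> complex" where
  "bessel_term \<alpha> z w n = divisor_sigma (- z) n * of_nat n powr (z / 2) * exp (- w\<^sup>2 / 4) *
     gen_bessel_K (z / 2) (\<i> * w) (2 * of_nat n * pi * \<alpha>)"

text \<open>
  The series runs over \<open>n \<ge> 1\<close>. At \<open>z = 0\<close> the two Gamma factors have poles, and only the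
  limit for \<open>z \<rightarrow> 0\<close> of this expression is meaningful.
\<close>

definition bessel_side :: "real \<Rightarrow> complex \<Rightarrow> complex \<Rightarrow> complex" where
  "bessel_side \<alpha> z w = exp (- w\<^sup>2 / 4) * of_real (sqrt \<alpha>) *
     (4 * (\<Sum>n. bessel_term \<alpha> z w (Suc n))
      - Gamma (z / 2) * riemann_zeta z * of_real pi powr (- z / 2) *
        of_real \<alpha> powr (z / 2 - 1) * hyp1F1 ((1 - z) / 2) (1/2) (w\<^sup>2 / 4)
      - Gamma (- z / 2) * riemann_zeta (- z) * of_real pi powr (z / 2) *
        of_real \<alpha> powr (- z / 2 - 1) * hyp1F1 ((1 + z) / 2) (1/2) (w\<^sup>2 / 4))"

end

theory Submission
  imports Defs "HOL-Probability.Distributions"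
begin

text \<open>
  Write \<open>\<Lambda>(s) = \<pi>\<^bsup>-s/2\<^esup> \<Gamma>(s/2) \<zeta>(s)\<close> for the completed zeta function, \<open>F(a) = \<^sub>1F\<^sub>1(a; 1/2; w\<^sup>2/4)\<close> and
  \<open>y = z/2\<close>. Both sides of the identity are, up to elementary factors, integrals of the same function
  \<open>J(s) = D(s - y) D(s + y) \<alpha>\<^bsup>-s\<^esup>\<close> with \<open>D(s) = \<Lambda>(s) F(s/2)\<close>, but over different vertical lines.

  On the left, put \<open>s = (1 + it)/2\<close>. The polynomial factors of the two values of \<open>\<Xi>\<close> cancel the
  denominator and leave \<open>\<Lambda>(s - y) \<Lambda>(s + y)\<close>. Kummer's transformation
  \<open>\<^sub>1F\<^sub>1(a; 1/2; -v) = e\<^bsup>-v\<^esup> \<^sub>1F\<^sub>1(1/2 - a; 1/2; v)\<close> turns the product of hypergeometric functions in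
  \<open>\<rho>(s)\<close> into that of \<open>J(s)\<close>. By the functional equation the second summand of \<open>\<nabla>\<^sub>2\<close> is
  the value of the first one at \<open>-t\<close>, so the integral over the half-line is an integral of \<open>J\<close> over
  the whole critical line (\<open>Xi_integrand_has_integral\<close>).

  On the right, expand \<open>\<zeta>(s - y) \<zeta>(s + y) = \<Sum> \<sigma>\<^bsub>-z\<^esub>(n) n\<^bsup>y\<^esup> n\<^bsup>-s\<^esup>\<close> on the line \<open>Re s = 2\<close>. The inverse Mellin
  integral that defines the generalised Bessel function is the integral of one term, so the Bessel
  series is the integral of \<open>J\<close> over that line (\<open>bessel_series\<close>).

  Between the two lines \<open>J\<close> has only the poles \<open>1 + y\<close> and \<open>1 - y\<close> of the two zeta factors. For
  \<open>z \<noteq> 0\<close> they are simple, and since \<open>F(1/2)\<close> is an exponential, their residues are the two explicit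
  terms on the right (\<open>residue_paired_dressed_zeta\<close>). At \<open>z = 0\<close> the poles collide, but the integral
  over the critical line is continuous in \<open>z\<close> there (\<open>critical_line_integral_continuous\<close>), so the
  right-hand side has this integral as its limit.

  The analysis rests on the exponential decay of \<open>J\<close> in vertical strips: the Gamma factors decay
  exponentially, the hypergeometric factors grow more slowly than any exponential, and \<open>\<zeta>\<close> grows
  at most linearly. The zeta function itself is built from an Euler-Maclaurin series in the right
  half-plane. Its functional equation comes from that of the theta function, and the continuation
  to the whole plane from the functional equation.
\<close>

section \<open>Moving a vertical line of integration\<close>

lemma integrable_exp_neg_abs:
  fixes \<theta> :: real
  assumes "\<theta> > 0"
  shows "integrable lborel (\<lambda>t. exp (- \<theta> * \<bar>t\<bar>))"
proof -
  define h where "h = (\<lambda>t::real. indicator {0..} t * exp (- \<theta> * t))"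
  have "(\<lambda>x. exp (- \<theta> * x)) absolutely_integrable_on {0..}"
    by (rule nonnegative_absolutely_integrable_1)
       (use integrable_on_exp_minus_to_infinity[OF assms, of 0] in auto)
  then have "integrable lborel h"
    unfolding h_def set_integrable_def
    by (subst (asm) integrable_completion) (auto simp: mult.commute)
  moreover from lborel_integrable_real_affine[OF this, of "-1" 0]
  have "integrable lborel (\<lambda>t. h (- t))" by simp
  ultimately have "integrable lborel (\<lambda>t. h t + h (- t))" by (rule Bochner_Integration.integrable_add)
  then show ?thesis
    by (rule Bochner_Integration.integrable_bound)
       (auto simp: h_def indicator_def abs_if intro!: AE_I2)
qed

text \<open>
  Continuity controls the bounded part of the line, where the exponential bound is not assumed.
\<close>

lemma integrable_of_exp_decay:
  fixes g :: "real \<Rightarrow> complex"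
  assumes cont: "continuous_on UNIV g" and "\<theta> > 0"
    and bound: "\<And>t. T \<le> \<bar>t\<bar> \<Longrightarrow> norm (g t) \<le> C * exp (- \<theta> * \<bar>t\<bar>)"
  shows "integrable lborel g"
proof -
  have "bounded (g ` {-\<bar>T\<bar>..\<bar>T\<bar>})"
    by (intro compact_imp_bounded compact_continuous_image continuous_on_subset[OF cont]) auto
  then obtain B where B: "\<And>t. t \<in> {-\<bar>T\<bar>..\<bar>T\<bar>} \<Longrightarrow> norm (g t) \<le> B" and "B > 0"
    unfolding bounded_pos by (auto simp del: atLeastAtMost_iff)
  have "norm (g t) \<le> (\<bar>C\<bar> + B * exp (\<theta> * \<bar>T\<bar>)) * exp (- \<theta> * \<bar>t\<bar>)" for t
  proof (cases "T \<le> \<bar>t\<bar>")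
    case True
    have "norm (g t) \<le> C * exp (- \<theta> * \<bar>t\<bar>)" using bound True by blast
    also have "\<dots> \<le> (\<bar>C\<bar> + B * exp (\<theta> * \<bar>T\<bar>)) * exp (- \<theta> * \<bar>t\<bar>)"
      using \<open>B > 0\<close> mult_pos_pos[OF \<open>B > 0\<close>, of "exp (\<theta> * \<bar>T\<bar>)"]
      by (intro mult_right_mono add_increasing2) auto
    finally show ?thesis .
  next
    case False
    then have "t \<in> {-\<bar>T\<bar>..\<bar>T\<bar>}" by auto
    then have "norm (g t) \<le> B * 1" using B by (metis mult.right_neutral)
    also have "\<dots> \<le> B * (exp (\<theta> * \<bar>T\<bar>) * exp (- \<theta> * \<bar>t\<bar>))"
      using False \<open>B > 0\<close> assms(2) by (intro mult_left_mono) (auto simp flip: exp_add)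
    also have "\<dots> \<le> (\<bar>C\<bar> + B * exp (\<theta> * \<bar>T\<bar>)) * exp (- \<theta> * \<bar>t\<bar>)"
      by (simp add: algebra_simps)
    finally show ?thesis .
  qed
  then have le: "norm (g t) \<le> norm ((\<bar>C\<bar> + B * exp (\<theta> * \<bar>T\<bar>)) * exp (- \<theta> * \<bar>t\<bar>))" for t
    unfolding real_norm_def by (rule order_trans[OF _ abs_ge_self])
  have "g \<in> borel_measurable lborel"
    using borel_measurable_continuous_onI[OF cont] by simp
  from Bochner_Integration.integrable_bound[OF integrable_mult_right[OF integrable_exp_neg_abs[OF assms(2)]] this]
  show ?thesis using le by blast
qed

lemma truncated_integral_tendsto:
  fixes g :: "real \<Rightarrow> complex"
  assumes g: "integrable lborel g" and T: "filterlim T at_top sequentially"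
  shows "(\<lambda>n. integral {-T n..T n} g) \<longlonglongrightarrow> (\<integral>t. g t \<partial>lborel)"
proof -
  have [measurable]: "g \<in> borel_measurable borel" using g by (simp add: borel_measurable_integrable)
  have "(\<lambda>n. \<integral>t. indicator {-T n..T n} t *\<^sub>R g t \<partial>lborel) \<longlonglongrightarrow> (\<integral>t. g t \<partial>lborel)"
  proof (rule integral_dominated_convergence[where w = "\<lambda>t. norm (g t)"])
    show "AE t in lborel. (\<lambda>n. indicator {-T n..T n} t *\<^sub>R g t) \<longlonglongrightarrow> g t"
    proof (rule AE_I2, rule tendsto_eventually)
      fix t
      have "\<forall>\<^sub>F n in sequentially. T n \<ge> \<bar>t\<bar>" using T by (simp add: filterlim_at_top)
      then show "\<forall>\<^sub>F n in sequentially. indicat_real {-T n..T n} t *\<^sub>R g t = g t"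
        by eventually_elim (auto simp: indicator_def)
    qed
  qed (use g in \<open>auto simp: indicator_def intro!: AE_I2\<close>)
  moreover have "(\<integral>t. indicator {-T n..T n} t *\<^sub>R g t \<partial>lborel) = integral {-T n..T n} g" for n
  proof -
    have "set_integrable lborel {-T n..T n} g"
      unfolding set_integrable_def using g by (intro integrable_mult_indicator) auto
    from set_borel_integral_eq_integral(2)[OF this] show ?thesis
      by (simp add: set_lebesgue_integral_def)
  qed
  ultimately show ?thesis by simp
qed

text \<open>
  The residue theorem for the rectangle with vertices \<open>a \<plusminus> iT\<close> and \<open>b \<plusminus> iT\<close>. The two horizontal
  sides contribute the error, so the right-hand side tends to 0 when \<open>f\<close> decays vertically.
\<close>

lemma rectangle_residue_bound:
  fixes f :: "complex \<Rightarrow> complex"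
  assumes "open S" "convex S" "finite P" and holo: "f holomorphic_on (S - P)"
    and ab: "a < b" and T: "0 < T"
    and S: "\<And>s. a \<le> Re s \<Longrightarrow> Re s \<le> b \<Longrightarrow> \<bar>Im s\<bar> \<le> T \<Longrightarrow> s \<in> S"
    and P: "\<And>p. p \<in> P \<Longrightarrow> a < Re p \<and> Re p < b \<and> \<bar>Im p\<bar> < T"
    and B: "\<And>s. a \<le> Re s \<Longrightarrow> Re s \<le> b \<Longrightarrow> \<bar>Im s\<bar> = T \<Longrightarrow> norm (f s) \<le> B"
  shows "norm (integral {-T..T} (\<lambda>t. f (Complex b t)) - integral {-T..T} (\<lambda>t. f (Complex a t))
           - 2 * of_real pi * (\<Sum>p\<in>P. residue f p)) \<le> 2 * B * (b - a)"
proof -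
  define a1 a2 a3 a4 where "a1 = Complex a (-T)" and "a2 = Complex b (-T)"
    and "a3 = Complex b T" and "a4 = Complex a T"
  note defs = a1_def a2_def a3_def a4_def
  let ?R = "rectpath a1 a3"
  have R: "?R = linepath a1 a2 +++ linepath a2 a3 +++ linepath a3 a4 +++ linepath a4 a1"
    by (simp add: rectpath_def Let_def defs)
  have "0 \<le> B" using B[of "Complex a T"] ab T by (force intro: order_trans[OF norm_ge_zero])
  have img: "path_image ?R = cbox a1 a3 - box a1 a3"
    using ab T by (intro path_image_rectpath_cbox_minus_box) (auto simp: defs)
  have sub: "path_image ?R \<subseteq> S - P"
    using S P unfolding img by (force simp: in_cbox_complex_iff in_box_complex_iff defs)
  have cont: "f contour_integrable_on linepath u v" if "closed_segment u v \<subseteq> path_image ?R" for u v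
    using that sub by (intro contour_integrable_continuous_linepath
        continuous_on_subset[OF holomorphic_on_imp_continuous_on[OF holo]]) auto
  have seg: "closed_segment a1 a2 \<subseteq> path_image ?R" "closed_segment a2 a3 \<subseteq> path_image ?R"
    "closed_segment a3 a4 \<subseteq> path_image ?R" "closed_segment a4 a1 \<subseteq> path_image ?R"
    unfolding R by (auto simp: path_image_join)
  note ci = cont[OF seg(1)] cont[OF seg(2)] cont[OF seg(3)] cont[OF seg(4)]
  have "contour_integral ?R f = 2 * pi * \<i> * (\<Sum>p\<in>P. winding_number ?R p * residue f p)"
  proof (rule Residue_theorem[OF assms(1) convex_connected[OF assms(2)] assms(3) holo])
    show "\<forall>z. z \<notin> S \<longrightarrow> winding_number ?R z = 0"
      using ab T S by (intro allI impI winding_number_rectpath_outside)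
        (force simp: defs in_cbox_complex_iff)+
  qed (use sub in auto)
  also have "(\<Sum>p\<in>P. winding_number ?R p * residue f p) = (\<Sum>p\<in>P. residue f p)"
  proof (intro sum.cong refl)
    fix p assume "p \<in> P"
    then have "winding_number ?R p = 1"
      using P[of p] by (intro winding_number_rectpath) (auto simp: in_box_complex_iff defs)
    then show "winding_number ?R p * residue f p = residue f p" by simp
  qed
  finally have 1: "contour_integral ?R f = 2 * pi * \<i> * (\<Sum>p\<in>P. residue f p)" .
  have 2: "contour_integral ?R f = contour_integral (linepath a1 a2) f + contour_integral (linepath a2 a3) f
      + contour_integral (linepath a3 a4) f + contour_integral (linepath a4 a1) f"
    unfolding R using ci by (simp add: contour_integrable_joinI add.assoc)
  have 3: "contour_integral (linepath a2 a3) f = \<i> * integral {-T..T} (\<lambda>t. f (Complex b t))"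
    by (rule contour_integral_linepath_same_Re) (use T in \<open>auto simp: defs\<close>)
  have 4: "contour_integral (linepath a4 a1) f = - (\<i> * integral {-T..T} (\<lambda>t. f (Complex a t)))"
  proof -
    have "contour_integral (linepath a4 a1) f = - contour_integral (linepath a1 a4) f"
      using contour_integral_reverse_linepath[of a4 a1 f] seg(4)
        continuous_on_subset[OF holomorphic_on_imp_continuous_on[OF holo]] sub
      by (metis contour_integral_reversepath reversepath_linepath valid_path_linepath)
    also have "contour_integral (linepath a1 a4) f = \<i> * integral {-T..T} (\<lambda>t. f (Complex a t))"
      by (rule contour_integral_linepath_same_Re) (use T in \<open>auto simp: defs\<close>)
    finally show ?thesis .
  qed
  have hor: "norm (contour_integral (linepath u v) f) \<le> B * (b - a)"
    if "f contour_integrable_on linepath u v" "norm (v - u) = b - a"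
      "\<And>s. s \<in> closed_segment u v \<Longrightarrow> a \<le> Re s \<and> Re s \<le> b \<and> \<bar>Im s\<bar> = T" for u v
    using contour_integral_bound_linepath[OF that(1) \<open>0 \<le> B\<close>] that(2,3) B by auto
  have 5: "norm (contour_integral (linepath a1 a2) f) \<le> B * (b - a)"
    using ab T ci(1) by (intro hor) (auto simp: defs closed_segment_same_Im closed_segment_eq_real_ivl cmod_def)
  have 6: "norm (contour_integral (linepath a3 a4) f) \<le> B * (b - a)"
    using ab T ci(3) by (intro hor) (auto simp: defs closed_segment_same_Im closed_segment_eq_real_ivl cmod_def)
  let ?D = "integral {-T..T} (\<lambda>t. f (Complex b t)) - integral {-T..T} (\<lambda>t. f (Complex a t))
           - 2 * of_real pi * (\<Sum>p\<in>P. residue f p)"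
  have "\<i> * ?D = - (contour_integral (linepath a1 a2) f + contour_integral (linepath a3 a4) f)"
    using 1 2 3 4 by (simp add: algebra_simps)
  then have "norm ?D = norm (contour_integral (linepath a1 a2) f + contour_integral (linepath a3 a4) f)"
    by (metis norm_minus_cancel norm_mult norm_ii mult_1)
  also have "\<dots> \<le> B * (b - a) + B * (b - a)" by (rule norm_triangle_mono[OF 5 6])
  finally show ?thesis by (simp add: algebra_simps)
qed

text \<open>
  Exponential decay in the strip kills the horizontal sides of the rectangles and makes both line
  integrals converge absolutely. The bound is required only for large imaginary parts, since \<open>f\<close>
  has poles.
\<close>

lemma vertical_line_shift:
  fixes f :: "complex \<Rightarrow> complex"
  assumes "open S" "convex S" "finite P" and holo: "f holomorphic_on (S - P)"
    and ab: "a < b" and "\<theta> > 0"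
    and S: "\<And>s. a \<le> Re s \<Longrightarrow> Re s \<le> b \<Longrightarrow> s \<in> S"
    and P: "\<And>p. p \<in> P \<Longrightarrow> a < Re p \<and> Re p < b"
    and bound: "\<And>s. a \<le> Re s \<Longrightarrow> Re s \<le> b \<Longrightarrow> T \<le> \<bar>Im s\<bar> \<Longrightarrow> norm (f s) \<le> C * exp (- \<theta> * \<bar>Im s\<bar>)"
  shows "integrable lborel (\<lambda>t. f (Complex a t))" (is ?A)
    and "integrable lborel (\<lambda>t. f (Complex b t))" (is ?B)
    and "(\<integral>t. f (Complex b t) \<partial>lborel) =
           (\<integral>t. f (Complex a t) \<partial>lborel) + 2 * of_real pi * (\<Sum>p\<in>P. residue f p)"
proof -
  have cont: "continuous_on UNIV (\<lambda>t. f (Complex x t))" if "x = a \<or> x = b" for x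
    by (rule continuous_on_compose2[OF holomorphic_on_imp_continuous_on[OF holo]])
       (use that S P ab in \<open>auto simp: Complex_eq intro!: continuous_intros, (force simp flip: Complex_eq)+\<close>)
  show A: ?A using bound[of "Complex a _"] ab by (intro integrable_of_exp_decay[OF cont \<open>\<theta> > 0\<close>, of a T C]) simp_all
  show B: ?B using bound[of "Complex b _"] ab by (intro integrable_of_exp_decay[OF cont \<open>\<theta> > 0\<close>, of b T C]) simp_all
  obtain M where M: "\<And>p. p \<in> P \<Longrightarrow> \<bar>Im p\<bar> \<le> M"
    using finite_imp_bounded[OF finite_imageI[OF \<open>finite P\<close>, of Im]] by (auto simp: bounded_iff)
  define t where "t = (\<lambda>n. real n + \<bar>T\<bar> + \<bar>M\<bar> + 1)"
  have t: "filterlim t at_top sequentially"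
    unfolding t_def by (intro filterlim_at_top_mono[OF filterlim_real_sequentially]) auto
  let ?D = "\<lambda>n. integral {-t n..t n} (\<lambda>t. f (Complex b t)) - integral {-t n..t n} (\<lambda>t. f (Complex a t))
           - 2 * of_real pi * (\<Sum>p\<in>P. residue f p)"
  have le: "norm (?D n) \<le> 2 * (C * exp (- \<theta> * t n)) * (b - a)" for n
  proof (rule rectangle_residue_bound[OF assms(1-3) holo ab])
    fix s assume "a \<le> Re s" "Re s \<le> b" "\<bar>Im s\<bar> = t n"
    then show "norm (f s) \<le> C * exp (- \<theta> * t n)" using bound[of s] by (auto simp: t_def)
  next
    fix p assume "p \<in> P" then show "a < Re p \<and> Re p < b \<and> \<bar>Im p\<bar> < t n"
      using P M[of p] by (auto simp: t_def)
  qed (use S in \<open>auto simp: t_def\<close>)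
  have "filterlim (\<lambda>n. - \<theta> * t n) at_bot sequentially"
    using t \<open>\<theta> > 0\<close> by (intro filterlim_tendsto_neg_mult_at_bot[OF tendsto_const]) auto
  then have "(\<lambda>n. 2 * (C * exp (- \<theta> * t n)) * (b - a)) \<longlonglongrightarrow> 2 * (C * 0) * (b - a)"
    by (intro tendsto_intros filterlim_compose[OF exp_at_bot])
  then have lim0: "(\<lambda>n. 2 * (C * exp (- \<theta> * t n)) * (b - a)) \<longlonglongrightarrow> 0" by simp
  have "\<forall>\<^sub>F n in sequentially. norm (?D n) \<le> 2 * (C * exp (- \<theta> * t n)) * (b - a)"
    by (rule always_eventually) (use le in blast)
  from Lim_null_comparison[OF this lim0] have "?D \<longlonglongrightarrow> 0" .
  moreover have "?D \<longlonglongrightarrow> (\<integral>t. f (Complex b t) \<partial>lborel) - (\<integral>t. f (Complex a t) \<partial>lborel)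
       - 2 * of_real pi * (\<Sum>p\<in>P. residue f p)"
    by (intro tendsto_intros truncated_integral_tendsto A B t)
  ultimately have "(\<integral>t. f (Complex b t) \<partial>lborel) - (\<integral>t. f (Complex a t) \<partial>lborel)
       - 2 * of_real pi * (\<Sum>p\<in>P. residue f p) = 0" by (rule LIMSEQ_unique[rotated])
  then show "(\<integral>t. f (Complex b t) \<partial>lborel) =
           (\<integral>t. f (Complex a t) \<partial>lborel) + 2 * of_real pi * (\<Sum>p\<in>P. residue f p)"
    by (simp add: algebra_simps)
qed

section \<open>The theta function equation\<close>

lemma norm_gaussian: "norm (exp (of_real (pi * \<tau>) * s\<^sup>2)) = exp (pi * \<tau> * ((Re s)\<^sup>2 - (Im s)\<^sup>2))"
  by (simp add: Re_power2 flip: of_real_mult)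

text \<open>
  On the imaginary axis this is the normalisation of the normal density with variance
  \<open>1/(2\<pi>\<tau>)\<close>. The integrand is entire, so every vertical line gives the same value.
\<close>

lemma gaussian_line_integral:
  fixes \<tau> c :: real
  assumes "\<tau> > 0"
  shows "integrable lborel (\<lambda>t. exp (of_real (pi * \<tau>) * (Complex c t)\<^sup>2))"
    and "(\<integral>t. exp (of_real (pi * \<tau>) * (Complex c t)\<^sup>2) \<partial>lborel) = of_real (1 / sqrt \<tau>)"
proof -
  let ?f = "\<lambda>s. exp (of_real (pi * \<tau>) * s\<^sup>2)"
  define \<sigma> where "\<sigma> = 1 / sqrt (2 * pi * \<tau>)"
  have \<sigma>: "\<sigma> > 0" "\<sigma>\<^sup>2 = 1 / (2 * pi * \<tau>)" using assms by (simp_all add: \<sigma>_def power_divide)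
  have eq: "?f (Complex 0 t) = of_real (1 / sqrt \<tau> * normal_density 0 \<sigma> t)" for t
  proof -
    have "?f (Complex 0 t) = of_real (exp (- (pi * \<tau> * t\<^sup>2)))"
      by (simp add: Complex_eq power_mult_distrib exp_of_real flip: of_real_power of_real_mult of_real_minus)
    also have "exp (- (pi * \<tau> * t\<^sup>2)) = 1 / sqrt \<tau> * normal_density 0 \<sigma> t"
      using assms by (simp add: normal_density_def \<sigma> real_sqrt_divide field_simps)
    finally show ?thesis .
  qed
  have 0: "integrable lborel (\<lambda>t. ?f (Complex 0 t))"
    "(\<integral>t. ?f (Complex 0 t) \<partial>lborel) = of_real (1 / sqrt \<tau>)"
    unfolding eq using integrable_normal_density[OF \<sigma>(1), of 0] integral_normal_density[OF \<sigma>(1), of 0]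
    by (auto simp del: of_real_mult of_real_divide simp: integral_complex_of_real)
  have shift: "integrable lborel (\<lambda>t. ?f (Complex a t)) \<and> integrable lborel (\<lambda>t. ?f (Complex b t)) \<and>
     (\<integral>t. ?f (Complex b t) \<partial>lborel) = (\<integral>t. ?f (Complex a t) \<partial>lborel)" if "a < b" for a b :: real
  proof -
    have bnd: "norm (?f s) \<le> exp (pi * \<tau> * (a\<^sup>2 + b\<^sup>2)) * exp (- (pi * \<tau>) * \<bar>Im s\<bar>)"
      if "a \<le> Re s" "Re s \<le> b" "1 \<le> \<bar>Im s\<bar>" for s
    proof -
      have "(Re s)\<^sup>2 \<le> a\<^sup>2 + b\<^sup>2"
      proof (cases "Re s \<ge> 0")
        case True then have "(Re s)\<^sup>2 \<le> b\<^sup>2" using that by (intro power_mono)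
        then show ?thesis by (simp add: add_increasing)
      next
        case False then have "(- Re s)\<^sup>2 \<le> (- a)\<^sup>2" using that by (intro power_mono) auto
        then show ?thesis by (simp add: add_increasing2)
      qed
      moreover have "\<bar>Im s\<bar> \<le> (Im s)\<^sup>2"
        using that(3) mult_left_mono[of 1 "\<bar>Im s\<bar>" "\<bar>Im s\<bar>"] by (simp add: power2_eq_square)
      ultimately have "pi * \<tau> * ((Re s)\<^sup>2 - (Im s)\<^sup>2) \<le> pi * \<tau> * (a\<^sup>2 + b\<^sup>2 - \<bar>Im s\<bar>)"
        using assms by (intro mult_left_mono) auto
      then show ?thesis unfolding norm_gaussian by (simp add: algebra_simps flip: exp_add)
    qed
    have "?f holomorphic_on (UNIV - {})" by (intro holomorphic_intros)
    from vertical_line_shift[OF open_UNIV convex_UNIV finite.emptyI this \<open>a < b\<close> _ _ _ bnd] assms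
    show ?thesis by auto
  qed
  have "integrable lborel (\<lambda>t. ?f (Complex c t)) \<and> (\<integral>t. ?f (Complex c t) \<partial>lborel) = of_real (1 / sqrt \<tau>)"
    using shift[of 0 c] shift[of c 0] 0 by (cases "c = 0"; cases "c > 0") (auto simp: not_less)
  then show "integrable lborel (\<lambda>t. ?f (Complex c t))"
    "(\<integral>t. ?f (Complex c t) \<partial>lborel) = of_real (1 / sqrt \<tau>)" by auto
qed

text \<open>
  Completing the square moves the line by \<open>\<kappa>/\<tau>\<close>, which the Gaussian integral does not see.
\<close>

lemma gaussian_exp_line_integral:
  fixes \<tau> c \<kappa> :: real
  assumes "\<tau> > 0"
  shows "integrable lborel (\<lambda>t. exp (of_real (pi * \<tau>) * (Complex c t)\<^sup>2) * exp (- 2 * of_real (pi * \<kappa>) * Complex c t))"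
    and "(\<integral>t. exp (of_real (pi * \<tau>) * (Complex c t)\<^sup>2) * exp (- 2 * of_real (pi * \<kappa>) * Complex c t) \<partial>lborel) =
           of_real (exp (- (pi * \<kappa>\<^sup>2 / \<tau>)) / sqrt \<tau>)"
proof -
  have eq: "exp (of_real (pi * \<tau>) * (Complex c t)\<^sup>2) * exp (- 2 * of_real (pi * \<kappa>) * Complex c t) =
    of_real (exp (- (pi * \<kappa>\<^sup>2 / \<tau>))) * exp (of_real (pi * \<tau>) * (Complex (c - \<kappa> / \<tau>) t)\<^sup>2)" for t
  proof -
    have "of_real (pi * \<tau>) * (Complex c t)\<^sup>2 + (- 2 * of_real (pi * \<kappa>) * Complex c t) =
      of_real (- (pi * \<kappa>\<^sup>2 / \<tau>)) + of_real (pi * \<tau>) * (Complex (c - \<kappa> / \<tau>) t)\<^sup>2"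
      using assms by (simp add: Complex_eq field_simps power2_eq_square)
    then show ?thesis by (metis exp_add exp_of_real)
  qed
  show "integrable lborel (\<lambda>t. exp (of_real (pi * \<tau>) * (Complex c t)\<^sup>2) * exp (- 2 * of_real (pi * \<kappa>) * Complex c t))"
    unfolding eq using gaussian_line_integral(1)[OF assms] by auto
  show "(\<integral>t. exp (of_real (pi * \<tau>) * (Complex c t)\<^sup>2) * exp (- 2 * of_real (pi * \<kappa>) * Complex c t) \<partial>lborel) =
           of_real (exp (- (pi * \<kappa>\<^sup>2 / \<tau>)) / sqrt \<tau>)"
    unfolding eq using gaussian_line_integral[OF assms] by simp
qed

text \<open>
  The lower bound on \<open>\<kappa> n * c\<close> lets a geometric series dominate on the line \<open>Re s = c\<close>, uniformly in
  the imaginary part, so that it may be integrated term by term against the Gaussian.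
\<close>

lemma gaussian_series_line_integral:
  fixes \<tau> c :: real and \<kappa> :: "nat \<Rightarrow> real" and h :: "complex \<Rightarrow> complex"
  assumes "\<tau> > 0" and \<kappa>: "\<And>n. real n \<le> \<kappa> n * c"
    and h: "\<And>s. Re s = c \<Longrightarrow> (\<lambda>n. exp (- 2 * of_real (pi * \<kappa> n) * s)) sums h s"
  shows "integrable lborel (\<lambda>t. exp (of_real (pi * \<tau>) * (Complex c t)\<^sup>2) * h (Complex c t))"
    and "(\<lambda>n. of_real (exp (- (pi * (\<kappa> n)\<^sup>2 / \<tau>)) / sqrt \<tau>)) sums
           (\<integral>t. exp (of_real (pi * \<tau>) * (Complex c t)\<^sup>2) * h (Complex c t) \<partial>lborel)"
proof -
  let ?g = "\<lambda>t. exp (of_real (pi * \<tau>) * (Complex c t)\<^sup>2)"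
  let ?f = "\<lambda>n t. ?g t * exp (- 2 * of_real (pi * \<kappa> n) * Complex c t)"
  have sumsf: "(\<lambda>n. ?f n t) sums (?g t * h (Complex c t))" for t
    by (intro sums_mult h) simp
  have int: "integrable lborel (?f n)" for n using gaussian_exp_line_integral(1)[OF assms(1)] .
  have geo: "summable (\<lambda>n. exp (- 2 * pi) ^ n)" by (intro summable_geometric) auto
  have nrm: "norm (?f n t) \<le> norm (?g t) * exp (- 2 * pi) ^ n" for n t
  proof -
    have "norm (exp (- 2 * of_real (pi * \<kappa> n) * Complex c t)) = exp (- (2 * pi) * (\<kappa> n * c))"
      by (simp add: Complex_eq)
    also have "\<dots> \<le> exp (- (2 * pi) * real n)" using \<kappa>[of n] by simp
    also have "\<dots> = exp (- 2 * pi) ^ n" by (simp flip: exp_of_nat_mult add: mult.commute)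
    finally show ?thesis unfolding norm_mult by (intro mult_left_mono) auto
  qed
  have gint: "integrable lborel (\<lambda>t. norm (?g t))"
    using gaussian_line_integral(1)[OF assms(1)] by (intro integrable_norm)
  have summ: "AE t in lborel. summable (\<lambda>n. norm (?f n t))"
    using nrm geo by (intro AE_I2 summable_comparison_test'[OF summable_mult[OF geo]]) auto
  have summi: "summable (\<lambda>n. \<integral>t. norm (?f n t) \<partial>lborel)"
  proof (rule summable_comparison_test'[OF summable_mult[OF geo]])
    fix n
    have "(\<integral>t. norm (?f n t) \<partial>lborel) \<le> (\<integral>t. norm (?g t) * exp (- 2 * pi) ^ n \<partial>lborel)"
      using nrm gint int by (intro integral_mono) auto
    also have "\<dots> = (\<integral>t. norm (?g t) \<partial>lborel) * exp (- 2 * pi) ^ n" by simp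
    finally show "norm (\<integral>t. norm (?f n t) \<partial>lborel) \<le> (\<integral>t. norm (?g t) \<partial>lborel) * exp (- 2 * pi) ^ n"
      by simp
  qed
  have sumeq: "(\<lambda>t. \<Sum>n. ?f n t) = (\<lambda>t. ?g t * h (Complex c t))"
    using sumsf by (intro ext) (metis sums_unique)
  show "integrable lborel (\<lambda>t. ?g t * h (Complex c t))"
    using integrable_suminf[OF int summ summi] unfolding sumeq .
  show "(\<lambda>n. of_real (exp (- (pi * (\<kappa> n)\<^sup>2 / \<tau>)) / sqrt \<tau>)) sums (\<integral>t. ?g t * h (Complex c t) \<partial>lborel)"
    using sums_integral[OF int summ summi] unfolding sumeq gaussian_exp_line_integral(2)[OF assms(1)] .
qed

text \<open>
  The Jacobi theta series over all integers is \<open>1 + 2 * half_theta x\<close>.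
\<close>

definition half_theta :: "real \<Rightarrow> real" where
  "half_theta x = (\<Sum>n. exp (- (pi * (real (Suc n))\<^sup>2 * x)))"

lemma exp_neg_square_summable:
  fixes x :: real
  assumes "x > 0"
  shows "summable (\<lambda>n. exp (- (pi * (real (Suc n))\<^sup>2 * x)))"
proof (rule summable_comparison_test'[of "\<lambda>n. exp (- (pi * x)) ^ n"])
  fix n
  have "real n \<le> (real (Suc n))\<^sup>2" by (simp add: power2_eq_square algebra_simps)
  then have "pi * x * real n \<le> pi * x * (real (Suc n))\<^sup>2"
    using assms by (intro mult_left_mono) auto
  then show "norm (exp (- (pi * (real (Suc n))\<^sup>2 * x))) \<le> exp (- (pi * x)) ^ n"
    by (simp flip: exp_of_nat_mult add: mult_ac)
qed (use assms in simp)

text \<open>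
  The function \<open>e\<^bsup>\<pi>\<tau>s\<^sup>2\<^esup> / (e\<^bsup>2\<pi>s\<^esup> - 1)\<close> has simple poles at the points \<open>in\<close>, with residues
  \<open>e\<^bsup>-\<pi>n\<^sup>2\<tau>\<^esup> / (2\<pi>)\<close>. The theta series at \<open>\<tau>\<close> is therefore the difference of its integrals over
  \<open>Re s = 1\<close> and \<open>Re s = -1\<close>. On these lines the denominator expands in a geometric series of
  exponentials, and integrating the Gaussian term by term gives the theta series at \<open>1/\<tau>\<close>.
\<close>

theorem theta_functional_equation:
  fixes \<tau> :: real
  assumes "\<tau> > 0"
  shows "1 + 2 * half_theta \<tau> = (1 + 2 * half_theta (1 / \<tau>)) / sqrt \<tau>"
proof -
  define q where "q = (\<lambda>s::complex. exp (of_real (pi * \<tau>) * s\<^sup>2) / (exp (2 * of_real pi * s) - 1))"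
  define a where "a = (\<lambda>n::int. exp (- (pi * (real_of_int n)\<^sup>2 * \<tau>)))"
  define T where "T = (\<lambda>N::nat. real N + 1/2)"
  have T: "filterlim T at_top sequentially"
    unfolding T_def by (intro filterlim_at_top_mono[OF filterlim_real_sequentially]) auto
  have zeros: "exp (2 * of_real pi * s) = 1 \<longleftrightarrow> (\<exists>n::int. s = \<i> * of_int n)" for s :: complex
    unfolding exp_eq_1 by (auto simp: complex_eq_iff)
  have res: "residue q (\<i> * of_int n) = of_real (a n / (2 * pi))" for n
  proof -
    have "residue q (\<i> * of_int n) = exp (of_real (pi * \<tau>) * (\<i> * of_int n)\<^sup>2) / (2 * of_real pi)"
      unfolding q_def
    proof (rule residue_simple_pole_deriv[where s = UNIV])
      show "exp (2 * of_real pi * (\<i> * of_int n)) - (1::complex) = 0" by (simp add: zeros)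
      show "((\<lambda>s. exp (2 * of_real pi * s) - 1) has_field_derivative (2 * of_real pi)) (at (\<i> * of_int n))"
        using zeros[of "\<i> * of_int n"] by (auto intro!: derivative_eq_intros)
    qed (auto intro!: holomorphic_intros)
    also have "of_real (pi * \<tau>) * (\<i> * of_int n)\<^sup>2 = complex_of_real (- (pi * (real_of_int n)\<^sup>2 * \<tau>))"
      by (simp add: power_mult_distrib)
    finally have "residue q (\<i> * of_int n) = of_real (a n) / (2 * of_real pi)"
      unfolding a_def exp_of_real .
    then show ?thesis by simp
  qed
  have le: "norm (integral {-T N..T N} (\<lambda>t. q (Complex 1 t)) - integral {-T N..T N} (\<lambda>t. q (Complex (-1) t))
      - 2 * of_real pi * (\<Sum>p\<in>(\<lambda>n. \<i> * of_int n) ` {- int N..int N}. residue q p))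
      \<le> 2 * exp (pi * \<tau> * (5/4 - T N)) * (1 - (-1))" for N
  proof (rule rectangle_residue_bound[where S = "{s. Im s < real N + 3/4} \<inter> {s. Im s > - (real N + 3/4)}"])
    let ?S = "{s. Im s < real N + 3/4} \<inter> {s. Im s > - (real N + 3/4)}"
    show "open ?S" by (intro open_Int open_halfspace_Im_lt open_halfspace_Im_gt)
    show "convex ?S" by (intro convex_Int convex_halfspace_Im_lt convex_halfspace_Im_gt)
    show "q holomorphic_on (?S - (\<lambda>n. \<i> * of_int n) ` {- int N..int N})"
      unfolding q_def
    proof (intro holomorphic_intros)
      fix s assume s: "s \<in> ?S - (\<lambda>n. \<i> * of_int n) ` {- int N..int N}"
      have False if "s = \<i> * of_int n" for n
      proof -
        have "n \<le> int N" "- int N \<le> n" using s that by auto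
        then show False using s that by auto
      qed
      then show "exp (2 * of_real pi * s) - 1 \<noteq> 0" using zeros[of s] by auto
    qed
    show "norm (q s) \<le> exp (pi * \<tau> * (5/4 - T N))" if "-1 \<le> Re s" "Re s \<le> 1" "\<bar>Im s\<bar> = T N" for s
    proof -
      \<comment> \<open>At half-integer height \<open>e\<^bsup>2\<pi>s\<^esup>\<close> is negative, so the denominator has absolute value at least 1.\<close>
      have "cos (2 * pi * Im s) = cos (2 * pi * T N)" using that(3) by (smt (verit) cos_minus mult_minus_right)
      also have "\<dots> = cos (2 * real N * pi + pi)" by (simp add: T_def algebra_simps)
      also have "\<dots> = -1" by (simp only: cos_periodic_pi cos_2npi)
      finally have "Re (exp (2 * of_real pi * s)) = - exp (2 * pi * Re s)" by (simp add: Re_exp)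
      then have "Re (exp (2 * of_real pi * s) - 1) \<le> -1" by simp
      then have 1: "norm (exp (2 * of_real pi * s) - 1) \<ge> 1"
        using abs_Re_le_cmod[of "exp (2 * of_real pi * s) - 1"] by linarith
      have "(Re s)\<^sup>2 \<le> 1" using that by (simp add: power_le_one_iff abs_square_le_1)
      moreover have "T N - 1/4 \<le> (Im s)\<^sup>2"
      proof -
        have "0 \<le> (\<bar>Im s\<bar> - 1/2)\<^sup>2" by simp
        also have "\<dots> = (Im s)\<^sup>2 - \<bar>Im s\<bar> + 1/4" unfolding power2_diff by (simp add: power2_eq_square)
        finally show ?thesis using that(3) by simp
      qed
      ultimately have "pi * \<tau> * ((Re s)\<^sup>2 - (Im s)\<^sup>2) \<le> pi * \<tau> * (5/4 - T N)"
        using assms by (intro mult_left_mono) auto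
      then have "norm (exp (of_real (pi * \<tau>) * s\<^sup>2)) \<le> exp (pi * \<tau> * (5/4 - T N))"
        unfolding norm_gaussian by simp
      then have "norm (exp (of_real (pi * \<tau>) * s\<^sup>2)) / norm (exp (2 * of_real pi * s) - 1) \<le>
         exp (pi * \<tau> * (5/4 - T N)) / 1" using 1 by (intro frac_le) auto
      then show ?thesis by (simp add: q_def norm_divide)
    qed
  qed (auto simp: T_def)
  have sum_eq: "2 * of_real pi * (\<Sum>p\<in>(\<lambda>n. \<i> * of_int n) ` {- int N..int N}. residue q p) =
      of_real (1 + 2 * (\<Sum>n<N. exp (- (pi * (real (Suc n))\<^sup>2 * \<tau>))))" for N
  proof -
    have "(\<Sum>p\<in>(\<lambda>n. \<i> * of_int n) ` {- int N..int N}. residue q p) = (\<Sum>n\<in>{- int N..int N}. of_real (a n / (2 * pi)))"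
      by (subst sum.reindex) (auto simp: inj_on_def res)
    also have "\<dots> = of_real ((\<Sum>n\<in>{- int N..int N}. a n) / (2 * pi))" by (simp add: sum_divide_distrib)
    also have "(\<Sum>n\<in>{- int N..int N}. a n) = 1 + 2 * (\<Sum>n<N. exp (- (pi * (real (Suc n))\<^sup>2 * \<tau>)))"
    proof (induction N)
      case (Suc N)
      have "{- int (Suc N)..int (Suc N)} = insert (int (Suc N)) (insert (- int (Suc N)) {- int N..int N})" by auto
      moreover have "(- 1 - real N)\<^sup>2 = (1 + real N)\<^sup>2" by (simp add: power2_eq_square algebra_simps)
      ultimately show ?case using Suc by (simp add: a_def)
    qed (simp add: a_def)
    finally show ?thesis by simp
  qed
  have right: "(\<lambda>n. exp (- 2 * of_real (pi * real (Suc n)) * s)) sums (1 / (exp (2 * of_real pi * s) - 1))"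
    if "Re s = 1" for s :: complex
  proof -
    have "norm (exp (- 2 * of_real pi * s)) < 1" using that by simp
    from sums_mult[OF geometric_sums[OF this], of "exp (- 2 * of_real pi * s)"]
    have "(\<lambda>n. exp (- 2 * of_real pi * s) ^ Suc n) sums (exp (- 2 * of_real pi * s) / (1 - exp (- 2 * of_real pi * s)))"
      by simp
    also have "(\<lambda>n. exp (- 2 * of_real pi * s) ^ Suc n) = (\<lambda>n. exp (- 2 * of_real (pi * real (Suc n)) * s))"
      by (simp only: exp_of_nat_mult[symmetric]) (simp add: algebra_simps)
    also have "exp (- 2 * of_real pi * s) / (1 - exp (- 2 * of_real pi * s)) = 1 / (exp (2 * of_real pi * s) - 1)"
    proof -
      define W where "W = exp (2 * of_real pi * s)"
      have "W \<noteq> 0" by (simp add: W_def)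
      then have "1 - 1 / W = (W - 1) / W" by (simp add: field_simps)
      moreover have "exp (- 2 * of_real pi * s) = 1 / W" by (simp add: W_def exp_minus divide_inverse)
      ultimately show ?thesis using \<open>W \<noteq> 0\<close> unfolding W_def[symmetric] by simp
    qed
    finally show ?thesis .
  qed
  have left: "(\<lambda>n. exp (- 2 * of_real (pi * (- real n)) * s)) sums (- 1 / (exp (2 * of_real pi * s) - 1))"
    if "Re s = -1" for s :: complex
  proof -
    have "norm (exp (2 * of_real pi * s)) < 1" using that by simp
    from geometric_sums[OF this]
    have "(\<lambda>n. exp (2 * of_real pi * s) ^ n) sums (1 / (1 - exp (2 * of_real pi * s)))" .
    also have "(\<lambda>n. exp (2 * of_real pi * s) ^ n) = (\<lambda>n. exp (- 2 * of_real (pi * (- real n)) * s))"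
      by (simp only: exp_of_nat_mult[symmetric]) (simp add: algebra_simps)
    also have "1 / (1 - exp (2 * of_real pi * s)) = - 1 / (exp (2 * of_real pi * s) - 1)"
      by (metis minus_diff_eq minus_divide_left minus_divide_right)
    finally show ?thesis .
  qed
  have R: "integrable lborel (\<lambda>t. q (Complex 1 t))"
    "(\<lambda>n. of_real (exp (- (pi * (real (Suc n))\<^sup>2 / \<tau>)) / sqrt \<tau>)) sums (\<integral>t. q (Complex 1 t) \<partial>lborel)"
    using gaussian_series_line_integral[OF assms, of "\<lambda>n. real (Suc n)" 1, OF _ right] by (simp_all add: q_def)
  have L: "integrable lborel (\<lambda>t. q (Complex (-1) t))"
    "(\<lambda>n. of_real (exp (- (pi * (real n)\<^sup>2 / \<tau>)) / sqrt \<tau>)) sums (- (\<integral>t. q (Complex (-1) t) \<partial>lborel))"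
    using gaussian_series_line_integral[OF assms, of "\<lambda>n. - real n" "-1", OF _ left] by (simp_all add: q_def)
  let ?c = "\<lambda>n. exp (- (pi * (real (Suc n))\<^sup>2 / \<tau>)) / sqrt \<tau>"
  have c: "?c sums (half_theta (1 / \<tau>) / sqrt \<tau>)"
    using sums_divide[OF summable_sums[OF exp_neg_square_summable[of "1 / \<tau>"]], of "sqrt \<tau>"] assms
    by (simp add: half_theta_def)
  have r: "(\<integral>t. q (Complex 1 t) \<partial>lborel) = of_real (half_theta (1 / \<tau>) / sqrt \<tau>)"
    using R(2) sums_of_real[OF c] by (rule sums_unique2)
  have l: "- (\<integral>t. q (Complex (-1) t) \<partial>lborel) = of_real (half_theta (1 / \<tau>) / sqrt \<tau> + 1 / sqrt \<tau>)"
  proof -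
    have "(\<lambda>n. of_real (exp (- (pi * (real n)\<^sup>2 / \<tau>)) / sqrt \<tau>) :: complex) sums
        of_real (half_theta (1 / \<tau>) / sqrt \<tau> + 1 / sqrt \<tau>)"
      using c by (intro sums_of_real) (subst (asm) sums_Suc_iff, simp)
    with L(2) show ?thesis by (rule sums_unique2)
  qed
  have "filterlim (\<lambda>N. - (pi * \<tau>) * T N) at_bot sequentially"
    using assms by (intro filterlim_tendsto_neg_mult_at_bot[OF tendsto_const _ T]) auto
  then have "(\<lambda>N. 2 * (exp (pi * \<tau> * (5/4)) * exp (- (pi * \<tau>) * T N)) * (1 - (-1))) \<longlonglongrightarrow> 2 * (exp (pi * \<tau> * (5/4)) * 0) * (1 - (-1))"
    by (intro tendsto_intros filterlim_compose[OF exp_at_bot])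
  then have lim0: "(\<lambda>N. 2 * exp (pi * \<tau> * (5/4 - T N)) * (1 - (-1))) \<longlonglongrightarrow> 0"
    by (simp add: algebra_simps flip: exp_add)
  let ?D = "\<lambda>N. integral {-T N..T N} (\<lambda>t. q (Complex 1 t)) - integral {-T N..T N} (\<lambda>t. q (Complex (-1) t))
      - of_real (1 + 2 * (\<Sum>n<N. exp (- (pi * (real (Suc n))\<^sup>2 * \<tau>))))"
  have "\<forall>\<^sub>F N in sequentially. norm (?D N) \<le> 2 * exp (pi * \<tau> * (5/4 - T N)) * (1 - (-1))"
    by (rule always_eventually) (use le in \<open>simp only: sum_eq, blast\<close>)
  from Lim_null_comparison[OF this lim0] have "?D \<longlonglongrightarrow> 0" .
  moreover have "?D \<longlonglongrightarrow> (\<integral>t. q (Complex 1 t) \<partial>lborel) - (\<integral>t. q (Complex (-1) t) \<partial>lborel)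
      - of_real (1 + 2 * half_theta \<tau>)"
    unfolding half_theta_def using summable_LIMSEQ[OF exp_neg_square_summable[OF assms]]
    by (intro tendsto_intros truncated_integral_tendsto R L T)
  ultimately have "(\<integral>t. q (Complex 1 t) \<partial>lborel) + - (\<integral>t. q (Complex (-1) t) \<partial>lborel)
      - of_real (1 + 2 * half_theta \<tau>) = 0"
    using LIMSEQ_unique by fastforce
  then have "complex_of_real (1 + 2 * half_theta \<tau>) =
      of_real (half_theta (1 / \<tau>) / sqrt \<tau> + (half_theta (1 / \<tau>) / sqrt \<tau> + 1 / sqrt \<tau>))"
    unfolding l r by (simp add: algebra_simps)
  then have "1 + 2 * half_theta \<tau> = half_theta (1 / \<tau>) / sqrt \<tau> + (half_theta (1 / \<tau>) / sqrt \<tau> + 1 / sqrt \<tau>)"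
    by (simp only: of_real_eq_iff)
  then show ?thesis by (simp add: add_divide_distrib)
qed

section \<open>The zeta function in the right half-plane\<close>

text \<open>
  For \<open>s \<noteq> 1\<close> this is \<open>s - 1\<close> times the difference between \<open>(n+1)\<^bsup>-s\<^esup>\<close> and the integral of \<open>x\<^bsup>-s\<^esup>\<close> over
  \<open>[n+1, n+2]\<close>. The factor \<open>s - 1\<close> makes every term entire.
\<close>

definition zeta_term :: "nat \<Rightarrow> complex \<Rightarrow> complex" where
  "zeta_term n s = (s - 1) * of_nat (Suc n) powr (- s)
     + of_nat (Suc (Suc n)) powr (1 - s) - of_nat (Suc n) powr (1 - s)"

text \<open>
  In the half-plane \<open>Re s > 0\<close> this is \<open>(s - 1) \<zeta>(s)\<close>.
\<close>

definition pole_free_zeta :: "complex \<Rightarrow> complex" where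
  "pole_free_zeta s = 1 + (\<Sum>n. zeta_term n s)"

text \<open>
  The term is the increment over a unit interval of a function whose derivative vanishes at the
  left end point. Two applications of the mean value inequality gain two factors from the second
  derivative, which is of size \<open>\<bar>s - 1\<bar> \<bar>s\<bar> x\<^bsup>-Re s - 1\<^esup>\<close>.
\<close>

lemma norm_zeta_term_le:
  assumes "Re s > -1"
  shows "norm (zeta_term n s) \<le> norm (s - 1) * norm s * real (Suc n) powr (- Re s - 1)"
proof -
  define a b :: complex where "a = of_nat (Suc n)" and "b = of_nat (Suc (Suc n))"
  define S where "S = closed_segment a b"
  define B where "B = norm s * real (Suc n) powr (- Re s - 1)"
  have S: "x = of_real (Re x) \<and> real (Suc n) \<le> Re x \<and> Re x \<le> real (Suc (Suc n))" if "x \<in> S" for x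
    using that unfolding S_def a_def b_def by (auto simp: closed_segment_same_Im closed_segment_eq_real_ivl complex_eq_iff)
  have ab: "a \<in> S" "b \<in> S" "norm (b - a) = 1" by (auto simp: S_def a_def b_def)
  have S': "x \<notin> \<real>\<^sub>\<le>\<^sub>0" "x \<noteq> 0" if "x \<in> S" for x
    using S[OF that] by (auto simp: complex_nonpos_Reals_iff complex_eq_iff)
  have conv: "convex S" by (simp add: S_def)
  have dist: "norm (x - a) \<le> 1" if "x \<in> S" for x
  proof -
    have "x - a = of_real (Re x - real (Suc n))" using S[OF that] by (simp add: a_def complex_eq_iff)
    then show ?thesis using S[OF that] by (simp del: of_real_diff)
  qed
  have 1: "norm (a powr (- s) - x powr (- s)) \<le> B" if x: "x \<in> S" for x
  proof -
    have "norm (x powr (- s) - a powr (- s)) \<le> B * norm (x - a)"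
    proof (rule field_differentiable_bound[OF conv])
      fix y assume y: "y \<in> S"
      show "((\<lambda>x. x powr (- s)) has_field_derivative (- s * y powr (- s - 1))) (at y within S)"
        by (rule has_field_derivative_at_within[OF has_field_derivative_powr[OF S'(1)[OF y]]])
      have "norm (y powr (- s - 1)) = Re y powr (- Re s - 1)"
        using S[OF y] norm_powr_real_powr[of y "- s - 1"] by (auto simp: complex_is_Real_iff complex_eq_iff)
      also have "\<dots> \<le> real (Suc n) powr (- Re s - 1)"
        using S[OF y] assms by (intro powr_mono2') auto
      finally show "norm (- s * y powr (- s - 1)) \<le> B"
        by (simp add: norm_mult B_def mult_left_mono)
    qed (use x ab in auto)
    also have "\<dots> \<le> B * 1" using dist[OF x] by (intro mult_left_mono) (auto simp: B_def)
    finally show ?thesis by (simp add: norm_minus_commute)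
  qed
  define \<phi> where "\<phi> = (\<lambda>x. (s - 1) * a powr (- s) * x + x powr (1 - s))"
  \<comment> \<open>The increment of \<open>\<phi>\<close> over the interval is the term, and the bound on \<open>a\<^bsup>-s\<^esup> - x\<^bsup>-s\<^esup>\<close> bounds its derivative up to the factor \<open>s - 1\<close>.\<close>
  have "norm (\<phi> b - \<phi> a) \<le> norm (s - 1) * B * norm (b - a)"
  proof (rule field_differentiable_bound[OF conv])
    fix y assume y: "y \<in> S"
    have "(\<phi> has_field_derivative ((s - 1) * a powr (- s) + (1 - s) * y powr (1 - s - 1))) (at y within S)"
      unfolding \<phi>_def
      by (intro DERIV_add DERIV_cmult_Id has_field_derivative_at_within[OF has_field_derivative_powr[OF S'(1)[OF y]]])
    then show "(\<phi> has_field_derivative ((s - 1) * (a powr (- s) - y powr (- s)))) (at y within S)"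
      by (simp add: algebra_simps)
    show "norm ((s - 1) * (a powr (- s) - y powr (- s))) \<le> norm (s - 1) * B"
      using 1[OF y] by (simp add: norm_mult mult_left_mono)
  qed (use ab in auto)
  also have "\<phi> b - \<phi> a = zeta_term n s"
  proof -
    have "b = a + 1" by (simp add: a_def b_def)
    then show ?thesis unfolding zeta_term_def \<phi>_def a_def[symmetric] b_def[symmetric] by (simp add: algebra_simps)
  qed
  finally show ?thesis using ab(3) by (simp add: B_def mult.assoc)
qed

lemma zeta_term_summable:
  assumes "Re s > 0"
  shows "summable (\<lambda>n. zeta_term n s)"
proof (rule summable_comparison_test')
  have "summable (\<lambda>n. real n powr (- Re s - 1))" using assms by (simp add: summable_real_powr_iff)
  then show "summable (\<lambda>n. norm (s - 1) * norm s * real (Suc n) powr (- Re s - 1))"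
    by (intro summable_mult) (subst summable_Suc_iff)
  show "norm (zeta_term n s) \<le> norm (s - 1) * norm s * real (Suc n) powr (- Re s - 1)" for n
    by (rule norm_zeta_term_le) (use assms in simp)
qed

lemma pole_free_zeta_bound:
  assumes "a > 0"
  obtains K where "K > 0" "\<And>s. a \<le> Re s \<Longrightarrow> norm (pole_free_zeta s - 1) \<le> K * norm (s - 1) * norm s"
proof -
  have "summable (\<lambda>n. real n powr (- a - 1))" using assms by (simp add: summable_real_powr_iff)
  then have sm: "summable (\<lambda>n. real (Suc n) powr (- a - 1))" by (subst summable_Suc_iff)
  let ?K = "\<Sum>n. real (Suc n) powr (- a - 1)"
  have "?K > 0" by (rule suminf_pos[OF sm]) simp
  moreover have "norm (pole_free_zeta s - 1) \<le> ?K * norm (s - 1) * norm s" if "a \<le> Re s" for s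
  proof -
    have "norm (zeta_term n s) \<le> norm (s - 1) * norm s * real (Suc n) powr (- a - 1)" for n
    proof -
      have "norm (zeta_term n s) \<le> norm (s - 1) * norm s * real (Suc n) powr (- Re s - 1)"
        using assms that by (intro norm_zeta_term_le) auto
      also have "\<dots> \<le> norm (s - 1) * norm s * real (Suc n) powr (- a - 1)"
        using that by (intro mult_left_mono powr_mono) auto
      finally show ?thesis .
    qed
    then have "norm (\<Sum>n. zeta_term n s) \<le> (\<Sum>n. norm (s - 1) * norm s * real (Suc n) powr (- a - 1))"
      by (intro norm_suminf_le summable_mult sm)
    also have "\<dots> = norm (s - 1) * norm s * ?K" by (rule suminf_mult[OF sm])
    finally show ?thesis by (simp add: pole_free_zeta_def mult_ac)
  qed
  ultimately show thesis by (rule that)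
qed

lemma pole_free_zeta_1 [simp]: "pole_free_zeta 1 = 1"
  by (simp add: pole_free_zeta_def zeta_term_def del: of_nat_Suc)

lemma pole_free_zeta_holomorphic: "pole_free_zeta holomorphic_on {s. Re s > 0}"
proof (rule holomorphic_uniform_sequence[OF open_halfspace_Re_gt])
  show "(\<lambda>s. 1 + (\<Sum>k<n. zeta_term k s)) holomorphic_on {s. Re s > 0}" for n
    unfolding zeta_term_def by (intro holomorphic_intros)
next
  fix x :: complex assume "x \<in> {s. Re s > 0}"
  then have x: "Re x > 0" by simp
  define d where "d = Re x / 2"
  have d: "d > 0" using x by (simp add: d_def)
  have ball: "d \<le> Re s \<and> norm s \<le> norm x + d" if "s \<in> cball x d" for s
  proof -
    have "\<bar>Re (x - s)\<bar> \<le> d" "norm (s - x) \<le> d"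
      using that abs_Re_le_cmod[of "x - s"] by (auto simp: dist_norm norm_minus_commute)
    moreover from this have "Re x - Re s \<le> d" by simp
    then have "d \<le> Re s" unfolding d_def by linarith
    ultimately show ?thesis using norm_triangle_ineq2[of s x] by linarith
  qed
  have "summable (\<lambda>n. real n powr (- d - 1))" using d by (simp add: summable_real_powr_iff)
  then have sm: "summable (\<lambda>n. (norm x + d + 1) * (norm x + d) * real (Suc n) powr (- d - 1))"
    by (intro summable_mult) (subst summable_Suc_iff)
  have "uniform_limit (cball x d) (\<lambda>n s. \<Sum>k<n. zeta_term k s) (\<lambda>s. \<Sum>k. zeta_term k s) sequentially"
  proof (rule Weierstrass_m_test[OF _ sm])
    fix n s assume "s \<in> cball x d"
    note s = ball[OF this]
    have "norm (zeta_term n s) \<le> norm (s - 1) * norm s * real (Suc n) powr (- Re s - 1)"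
      using s d by (intro norm_zeta_term_le) auto
    also have "\<dots> \<le> (norm x + d + 1) * (norm x + d) * real (Suc n) powr (- d - 1)"
      using s d norm_triangle_ineq4[of s 1] by (intro mult_mono powr_mono) auto
    finally show "norm (zeta_term n s) \<le> (norm x + d + 1) * (norm x + d) * real (Suc n) powr (- d - 1)" .
  qed
  then have "uniform_limit (cball x d) (\<lambda>n s. 1 + (\<Sum>k<n. zeta_term k s)) pole_free_zeta sequentially"
    unfolding pole_free_zeta_def by (intro uniform_limit_intros)
  moreover have "cball x d \<subseteq> {s. Re s > 0}" using ball d by force
  ultimately show "\<exists>d>0. cball x d \<subseteq> {s. Re s > 0} \<and>
      uniform_limit (cball x d) (\<lambda>n s. 1 + (\<Sum>k<n. zeta_term k s)) pole_free_zeta sequentially"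
    using d by blast
qed

lemma zeta_term_partial_sum:
  "(\<Sum>n<N. zeta_term n s) = (s - 1) * (\<Sum>n<N. of_nat (Suc n) powr (- s)) + of_nat (Suc N) powr (1 - s) - 1"
  by (induction N) (simp_all add: zeta_term_def algebra_simps)

lemma pole_free_zeta_limit:
  assumes "Re s > 0"
  shows "(\<lambda>N. (s - 1) * (\<Sum>n<N. of_nat (Suc n) powr (- s)) + of_nat (Suc N) powr (1 - s)) \<longlonglongrightarrow> pole_free_zeta s"
proof -
  have "(\<lambda>N. 1 + (\<Sum>n<N. zeta_term n s)) \<longlonglongrightarrow> pole_free_zeta s"
    unfolding pole_free_zeta_def by (intro tendsto_intros summable_LIMSEQ zeta_term_summable assms)
  then show ?thesis by (simp add: zeta_term_partial_sum)
qed

lemma of_nat_powr_tendsto_0: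
  assumes "Re s > 0"
  shows "(\<lambda>n. of_nat (Suc n) powr (- s)) \<longlonglongrightarrow> (0 :: complex)"
proof (rule tendsto_norm_zero_cancel)
  have "(\<lambda>n. real (Suc n) powr (- Re s)) \<longlonglongrightarrow> 0"
    using assms by (intro tendsto_neg_powr filterlim_compose[OF filterlim_real_sequentially filterlim_Suc]) auto
  moreover have "norm (of_nat (Suc n) powr (- s)) = real (Suc n) powr (- Re s)" for n
    using norm_powr_real_powr[of "of_nat (Suc n)" "- s"] by simp
  ultimately show "(\<lambda>n. norm (of_nat (Suc n) powr (- s) :: complex)) \<longlonglongrightarrow> 0" by simp
qed

lemma dirichlet_series_sums:
  assumes "Re s > 1"
  shows "(\<lambda>n. of_nat (Suc n) powr (- s)) sums (pole_free_zeta s / (s - 1))"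
proof -
  have s: "s \<noteq> 1" using assms by auto
  have 0: "(\<lambda>N. of_nat (Suc N) powr (1 - s)) \<longlonglongrightarrow> (0 :: complex)"
    using of_nat_powr_tendsto_0[of "s - 1"] assms by simp
  have "(\<lambda>N. ((s - 1) * (\<Sum>n<N. of_nat (Suc n) powr (- s)) + of_nat (Suc N) powr (1 - s) - of_nat (Suc N) powr (1 - s)) / (s - 1))
     \<longlonglongrightarrow> (pole_free_zeta s - 0) / (s - 1)"
    using assms s by (intro tendsto_intros pole_free_zeta_limit 0) auto
  then show ?thesis using s by (simp add: sums_def)
qed

text \<open>
  The even terms enter twice with the opposite sign, which yields the factor \<open>1 - 2\<^bsup>1-s\<^esup>\<close>. This holds
  beyond the half-plane of convergence of the Dirichlet series because the correction terms
  \<open>(N+1)\<^bsup>1-s\<^esup>\<close> of the partial sums cancel in the limit.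
\<close>

lemma alternating_zeta_limit:
  assumes "Re s > 0"
  shows "(\<lambda>N. (s - 1) * (\<Sum>k<2*N. (-1) ^ k * of_nat (Suc k) powr (- s))) \<longlonglongrightarrow> (1 - 2 powr (1 - s)) * pole_free_zeta s"
proof -
  define D where "D = (\<lambda>N. (\<Sum>n<N. of_nat (Suc n) powr (- s)))"
  define r where "r = (\<lambda>N. of_nat (Suc N) powr (1 - s))"
  have alt: "(\<Sum>k<2*N. (-1) ^ k * of_nat (Suc k) powr (- s)) = D (2 * N) - 2 powr (1 - s) * D N" for N
  proof (induction N)
    case (Suc N)
    have "of_nat (2 * Suc N) powr (- s) = 2 powr (- s) * of_nat (Suc N) powr (- s)"
      using powr_times_real[of "of_nat (Suc N)" 2 "- s"] powr_times_real[of 2 "of_nat (Suc N)" "- s"] by simp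
    moreover have "2 powr (1 - s) = 2 * 2 powr (- s)" by (simp add: powr_diff powr_minus divide_inverse)
    ultimately show ?case using Suc by (simp add: D_def algebra_simps)
  qed (simp add: D_def)
  have lim: "(\<lambda>N. (s - 1) * D N + r N) \<longlonglongrightarrow> pole_free_zeta s"
    using pole_free_zeta_limit[OF assms] by (simp add: D_def r_def)
  have lim2: "(\<lambda>N. (s - 1) * D (2 * N) + r (2 * N)) \<longlonglongrightarrow> pole_free_zeta s"
    by (rule filterlim_compose[OF lim]) (auto simp: filterlim_at_top_mono intro!: filterlim_subseq strict_monoI)
  have "(\<lambda>n. zeta_term n s - (s - 1) * of_nat (Suc n) powr (- s)) \<longlonglongrightarrow> 0 - (s - 1) * 0"
    by (intro tendsto_intros summable_LIMSEQ_zero zeta_term_summable assms of_nat_powr_tendsto_0)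
  then have "(\<lambda>n. r (Suc n) - r n) \<longlonglongrightarrow> 0" by (simp add: zeta_term_def r_def)
  then have lim3: "(\<lambda>N. r (Suc (2 * N)) - r (2 * N)) \<longlonglongrightarrow> 0"
    by (rule filterlim_compose) (auto intro!: filterlim_subseq strict_monoI)
  have r2: "r (Suc (2 * N)) = 2 powr (1 - s) * r N" for N
    using powr_times_real[of 2 "of_nat (Suc N)" "1 - s"] by (simp add: r_def algebra_simps)
  have "(\<lambda>N. ((s - 1) * D (2 * N) + r (2 * N)) - 2 powr (1 - s) * ((s - 1) * D N + r N) + (r (Suc (2 * N)) - r (2 * N)))
     \<longlonglongrightarrow> pole_free_zeta s - 2 powr (1 - s) * pole_free_zeta s + 0"
    by (intro tendsto_intros lim lim2 lim3)
  then show ?thesis unfolding alt r2 by (simp add: algebra_simps)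
qed

section \<open>The functional equation in the critical strip\<close>

lemma exp_linear_minus_exp_integrable:
  assumes "Re s > 0"
  shows "integrable lborel (\<lambda>u. exp (s * of_real u - of_real (exp u)))"
proof (rule integrable_of_exp_decay)
  show "continuous_on UNIV (\<lambda>u. exp (s * of_real u - of_real (exp u)))"
    by (intro continuous_intros)
  define \<theta> where "\<theta> = min (Re s) 1"
  show "\<theta> > 0" using assms by (simp add: \<theta>_def)
  show "norm (exp (s * of_real u - of_real (exp u))) \<le> exp ((Re s + 1)\<^sup>2 / 2) * exp (- \<theta> * \<bar>u\<bar>)" for u
  proof -
    have "Re s * u - exp u \<le> (Re s + 1)\<^sup>2 / 2 - \<theta> * \<bar>u\<bar>"
    proof (cases "u \<ge> 0")
      case True
      have "u\<^sup>2 / 2 \<le> exp u" using exp_lower_Taylor_quadratic[OF True] True by simp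
      moreover have "0 \<le> (u - (Re s + 1))\<^sup>2" by simp
      then have "2 * (u * (Re s + 1)) \<le> u\<^sup>2 + (Re s + 1)\<^sup>2" unfolding power2_diff by (simp add: algebra_simps)
      then have "u * Re s + u \<le> u\<^sup>2 / 2 + (Re s + 1)\<^sup>2 / 2" by (simp add: algebra_simps)
      moreover have "\<theta> * u \<le> 1 * u" using True by (intro mult_right_mono) (auto simp: \<theta>_def)
      ultimately show ?thesis using True by (simp add: mult.commute)
    next
      case False
      then have "Re s * u \<le> \<theta> * u" by (intro mult_right_mono_neg) (auto simp: \<theta>_def)
      moreover have "0 \<le> (Re s + 1)\<^sup>2 / 2" "0 < exp u" by simp_all
      moreover have "- (\<theta> * \<bar>u\<bar>) = \<theta> * u" using False by simp
      ultimately show ?thesis by linarith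
    qed
    then show ?thesis by (simp add: algebra_simps flip: exp_add)
  qed
qed

text \<open>
  Euler's integral after the substitution \<open>t = e\<^bsup>u\<^esup>\<close>. In the additive variable, scaling becomes
  translation and inversion becomes reflection, which keeps all later changes of variables affine.
\<close>

lemma Gamma_eq_exp_integral:
  assumes "Re s > 0"
  shows "(\<integral>u. exp (s * of_real u - of_real (exp u)) \<partial>lborel) = Gamma s"
proof -
  let ?f = "\<lambda>t. complex_of_real t powr (s - 1) / of_real (exp t)"
  have e1: "einterval 0 \<infinity> = {0<..}" by (auto simp: einterval_def)
  have e2: "einterval (-\<infinity>) \<infinity> = (UNIV :: real set)" by (auto simp: einterval_def)
  have cont: "continuous_on {0<..} ?f" by (intro continuous_intros) (auto simp: complex_nonpos_Reals_iff)
  have fint: "set_integrable lborel {0<..} ?f"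
    unfolding set_integrable_def
  proof (subst integrable_completion[symmetric])
    show "(\<lambda>x. indicat_real {0<..} x *\<^sub>R ?f x) \<in> borel_measurable lborel"
      using borel_measurable_continuous_on_indicator[OF _ cont] by simp
    show "complex_integrable lebesgue (\<lambda>x. indicat_real {0<..} x *\<^sub>R ?f x)"
      using absolutely_integrable_Gamma_integral'[OF assms] by (simp add: set_integrable_def)
  qed
  have fg: "exp x *\<^sub>R ?f (exp x) = exp (s * of_real x - of_real (exp x))" for x
  proof -
    have "complex_of_real (exp x) powr (s - 1) = exp ((s - 1) * of_real x)"
      by (simp add: powr_def Ln_of_real)
    moreover have "of_real (exp x) * exp ((s - 1) * of_real x) = exp (s * of_real x)"
      by (simp add: exp_of_real[symmetric] left_diff_distrib flip: exp_add)
    ultimately show ?thesis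
      by (simp add: scaleR_conv_of_real exp_diff exp_of_real)
  qed
  have "(LBINT x=0..\<infinity>. ?f x) = (LBINT x=-\<infinity>..\<infinity>. exp x *\<^sub>R ?f (exp x))"
  proof (rule interval_integral_substitution_integrable)
    show "((ereal \<circ> exp \<circ> real_of_ereal) \<longlongrightarrow> 0) (at_right (-\<infinity>))"
      unfolding ereal_tendsto_simps zero_ereal_def using exp_at_bot .
    show "((ereal \<circ> exp \<circ> real_of_ereal) \<longlongrightarrow> \<infinity>) (at_left \<infinity>)"
      unfolding ereal_tendsto_simps using exp_at_top .
    show "isCont ?f (exp x)" for x :: real
      using cont by (simp add: continuous_on_eq_continuous_at)
    show "set_integrable lborel (einterval (- \<infinity>) \<infinity>) (\<lambda>x. exp x *\<^sub>R ?f (exp x))"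
      unfolding fg e2 set_integrable_def using exp_linear_minus_exp_integrable[OF assms] by simp
    show "set_integrable lborel (einterval 0 \<infinity>) ?f" unfolding e1 by (rule fint)
  qed (auto intro!: derivative_eq_intros)
  then have "(LBINT x:{0<..}. ?f x) = (\<integral>u. exp (s * of_real u - of_real (exp u)) \<partial>lborel)"
    unfolding fg interval_lebesgue_integral_def e1 e2 by (simp add: set_lebesgue_integral_def)
  moreover have "(LBINT x:{0<..}. ?f x) = integral {0<..} ?f"
    by (rule set_borel_integral_eq_integral[OF fint])
  moreover have "integral {0<..} ?f = Gamma s"
    using Gamma_integral_complex'[OF assms] by (rule integral_unique)
  ultimately show ?thesis by simp
qed

lemma exp_mellin:
  fixes c :: real
  assumes "Re s > 0" "c > 0"
  shows "integrable lborel (\<lambda>u. of_real (exp (- (c * exp u))) * exp (s * of_real u))"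
    and "(\<integral>u. of_real (exp (- (c * exp u))) * exp (s * of_real u) \<partial>lborel) = Gamma s * of_real c powr (- s)"
proof -
  have eq: "of_real (exp (- (c * exp u))) * exp (s * of_real u) =
     of_real c powr (- s) * exp (s * of_real (ln c + 1 * u) - of_real (exp (ln c + 1 * u)))" for u
  proof -
    have 1: "of_real (exp (- (c * exp u))) = exp (complex_of_real (- (c * exp u)))"
      by (rule exp_of_real[symmetric])
    have 2: "of_real c powr (- s) = exp (- s * of_real (ln c))"
      using assms(2) by (simp add: powr_def Ln_of_real)
    have 3: "exp (ln c + 1 * u) = c * exp u" using assms(2) by (simp add: exp_add)
    have 4: "complex_of_real (- (c * exp u)) + s * of_real u =
        - s * of_real (ln c) + (s * of_real (ln c + 1 * u) - of_real (exp (ln c + 1 * u)))"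
      unfolding 3 by (simp add: algebra_simps)
    show ?thesis unfolding 1 2 exp_add[symmetric] 4 ..
  qed
  show "integrable lborel (\<lambda>u. of_real (exp (- (c * exp u))) * exp (s * of_real u))"
    unfolding eq
    using lborel_integrable_real_affine[OF exp_linear_minus_exp_integrable[OF assms(1)], of 1 "ln c"] by simp
  have "(\<integral>u. exp (s * of_real u - of_real (exp u)) \<partial>lborel) =
      \<bar>1\<bar> *\<^sub>R (\<integral>u. exp (s * of_real (ln c + 1 * u) - of_real (exp (ln c + 1 * u))) \<partial>lborel)"
    by (rule lborel_integral_real_affine) simp
  then show "(\<integral>u. of_real (exp (- (c * exp u))) * exp (s * of_real u) \<partial>lborel) = Gamma s * of_real c powr (- s)"
    unfolding eq by (simp add: Gamma_eq_exp_integral[OF assms(1)] mult.commute)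
qed

text \<open>
  In the variable \<open>x = e\<^bsup>u\<^esup>\<close> this is the theta series without its leading behaviour \<open>x\<^bsup>-1/2\<^esup>/2\<close> at 0.
  It remains bounded as \<open>x\<close> tends to 0 and is of order \<open>x\<^bsup>-1/2\<^esup>\<close> at infinity, so its Mellin transform
  converges exactly in the critical strip.
\<close>

definition theta_profile :: "real \<Rightarrow> real" where
  "theta_profile u = half_theta (exp u) - exp (- (u / 2)) / 2"

lemma theta_profile_reflect: "theta_profile (- u) = exp (u / 2) * theta_profile u"
proof -
  have "sqrt (exp u) = exp (u / 2)" by (rule real_sqrt_unique) (simp_all add: power2_eq_square flip: exp_add)
  moreover have "1 / exp u = exp (- u)" by (simp add: exp_minus inverse_eq_divide)
  ultimately have "1 + 2 * half_theta (exp u) = (1 + 2 * half_theta (exp (- u))) / exp (u / 2)"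
    using theta_functional_equation[of "exp u"] by simp
  then have "exp (u / 2) * (1 + 2 * half_theta (exp u)) = 1 + 2 * half_theta (exp (- u))" by (simp add: field_simps)
  moreover have "exp (u / 2) * exp (- (u / 2)) = 1" by (simp flip: exp_add)
  ultimately show ?thesis by (simp add: theta_profile_def algebra_simps)
qed

lemma theta_profile_measurable [measurable]: "theta_profile \<in> borel_measurable borel"
  unfolding theta_profile_def half_theta_def by measurable

text \<open>
  For \<open>u \<ge> 0\<close> the theta series is \<open>O(e\<^bsup>-u\<^esup>)\<close> because \<open>e\<^bsup>-t\<^esup> \<le> 1/t\<close>. The functional equation carries the bound
  over to negative \<open>u\<close>.
\<close>

lemma theta_profile_bound:
  "\<exists>K>0. (\<forall>u\<ge>0. \<bar>theta_profile u\<bar> \<le> K * exp (- (u / 2))) \<and> (\<forall>u\<le>0. \<bar>theta_profile u\<bar> \<le> K)"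
proof -
  have "summable (\<lambda>n. 1 / real n ^ 2)" by (rule inverse_power_summable[of 2, simplified inverse_eq_divide]) simp
  then have sm: "summable (\<lambda>n. 1 / (real (Suc n))\<^sup>2)" by (subst summable_Suc_iff)
  define S where "S = (\<Sum>n. 1 / (real (Suc n))\<^sup>2)"
  have S: "S > 0" unfolding S_def by (rule suminf_pos[OF sm]) simp
  have 1: "\<bar>theta_profile u\<bar> \<le> (S + 1) * exp (- (u / 2))" if u: "u \<ge> 0" for u
  proof -
    have le: "exp (- (pi * (real (Suc n))\<^sup>2 * exp u)) \<le> 1 / (real (Suc n))\<^sup>2 * exp (- u)" for n
    proof -
      define y where "y = pi * (real (Suc n))\<^sup>2 * exp u"
      have "(real (Suc n))\<^sup>2 * exp u > 0" by simp
      moreover have "1 * ((real (Suc n))\<^sup>2 * exp u) \<le> pi * ((real (Suc n))\<^sup>2 * exp u)"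
        using pi_ge_two by (intro mult_right_mono) auto
      ultimately have y: "0 < y" "(real (Suc n))\<^sup>2 * exp u \<le> y" by (auto simp: y_def mult.assoc)
      have "exp (- y) = 1 / exp y" by (simp add: exp_minus inverse_eq_divide)
      also have "\<dots> \<le> 1 / ((real (Suc n))\<^sup>2 * exp u)"
        using order_trans[OF y(2), of "exp y"] exp_ge_add_one_self[of y]
        by (intro divide_left_mono mult_pos_pos) auto
      finally show ?thesis unfolding y_def by (simp add: exp_minus inverse_eq_divide)
    qed
    have nn: "0 \<le> half_theta (exp u)" unfolding half_theta_def
      by (intro suminf_nonneg exp_neg_square_summable) auto
    have "half_theta (exp u) \<le> (\<Sum>n. 1 / (real (Suc n))\<^sup>2 * exp (- u))"
      unfolding half_theta_def by (intro suminf_le le exp_neg_square_summable summable_mult2 sm) auto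
    also have "\<dots> = S * exp (- u)" unfolding S_def by (rule suminf_mult2[OF sm, symmetric])
    also have "\<dots> \<le> S * exp (- (u / 2))" using S u by (intro mult_left_mono) auto
    finally have "half_theta (exp u) \<le> S * exp (- (u / 2))" .
    moreover have "0 < exp (- (u / 2))" "0 \<le> S * exp (- (u / 2))" using S by simp_all
    moreover have "(S + 1) * exp (- (u / 2)) = S * exp (- (u / 2)) + exp (- (u / 2))" by (simp add: distrib_right)
    ultimately show ?thesis using nn unfolding theta_profile_def by linarith
  qed
  have 2: "\<bar>theta_profile u\<bar> \<le> S + 1" if "u \<le> 0" for u
  proof -
    have "\<bar>theta_profile u\<bar> = exp (- (u / 2)) * \<bar>theta_profile (- u)\<bar>"
      using theta_profile_reflect[of "- u"] by (simp add: abs_mult)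
    also have "\<dots> \<le> exp (- (u / 2)) * ((S + 1) * exp (- (- u / 2)))"
      using 1[of "- u"] that by (intro mult_left_mono) auto
    also have "\<dots> = S + 1" by (simp add: exp_minus)
    finally show ?thesis .
  qed
  show ?thesis using 1 2 S by (intro exI[of _ "S + 1"]) auto
qed

definition theta_mellin :: "complex \<Rightarrow> complex" where
  "theta_mellin s = (\<integral>u. of_real (theta_profile u) * exp (s / 2 * of_real u) \<partial>lborel)"

lemma theta_mellin_integrable:
  assumes "0 < Re s" "Re s < 1"
  shows "integrable lborel (\<lambda>u. of_real (theta_profile u) * exp (s / 2 * of_real u))"
proof -
  obtain K where K: "K > 0" "\<And>u. u \<ge> 0 \<Longrightarrow> \<bar>theta_profile u\<bar> \<le> K * exp (- (u / 2))"
    "\<And>u. u \<le> 0 \<Longrightarrow> \<bar>theta_profile u\<bar> \<le> K" using theta_profile_bound by blast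
  define \<theta> where "\<theta> = min (Re s / 2) ((1 - Re s) / 2)"
  have "\<theta> > 0" using assms by (simp add: \<theta>_def)
  have "norm (of_real (theta_profile u) * exp (s / 2 * of_real u)) \<le> norm (K * exp (- \<theta> * \<bar>u\<bar>))" for u
  proof (cases "u \<ge> 0")
    case True
    have "\<bar>theta_profile u\<bar> * exp (Re s / 2 * u) \<le> K * exp (- (u / 2)) * exp (Re s / 2 * u)"
      using K(2)[OF True] by (intro mult_right_mono) auto
    also have "\<dots> = K * exp (- ((1 - Re s) / 2) * u)"
    proof -
      have "- (u / 2) + Re s / 2 * u = - ((1 - Re s) / 2) * u" by (simp add: field_simps)
      then show ?thesis by (simp only: mult.assoc exp_add[symmetric])
    qed
    also have "\<dots> \<le> K * exp (- \<theta> * u)"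
    proof -
      have "\<theta> * u \<le> (1 - Re s) / 2 * u" unfolding \<theta>_def using True by (intro mult_right_mono min.cobounded2)
      then show ?thesis using K(1) by simp
    qed
    finally show ?thesis using True K(1) by (simp add: norm_mult)
  next
    case False
    have "\<bar>theta_profile u\<bar> * exp (Re s / 2 * u) \<le> K * exp (Re s / 2 * u)"
      using K(3)[of u] False by (intro mult_right_mono) auto
    also have "\<dots> \<le> K * exp (\<theta> * u)"
      using False K(1) by (intro mult_left_mono) (auto simp: \<theta>_def intro!: mult_right_mono_neg)
    finally show ?thesis using False K(1) by (simp add: norm_mult)
  qed
  then show ?thesis
    by (intro Bochner_Integration.integrable_bound[OF integrable_mult_right[OF integrable_exp_neg_abs[OF \<open>\<theta> > 0\<close>], of K]] AE_I2)
      auto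
qed

text \<open>
  The functional equation of the theta function under the reflection \<open>u \<mapsto> -u\<close>.
\<close>

lemma theta_mellin_symmetric: "theta_mellin (1 - s) = theta_mellin s"
proof -
  have "theta_mellin (1 - s) = \<bar>-1\<bar> *\<^sub>R (\<integral>u. of_real (theta_profile (0 + (-1) * u)) * exp ((1 - s) / 2 * of_real (0 + (-1) * u)) \<partial>lborel)"
    unfolding theta_mellin_def by (rule lborel_integral_real_affine) simp
  also have "\<dots> = theta_mellin s"
    unfolding theta_mellin_def
  proof (simp, intro Bochner_Integration.integral_cong refl)
    fix u
    have "complex_of_real (theta_profile (- u)) = exp (of_real u / 2) * of_real (theta_profile u)"
      by (simp add: theta_profile_reflect exp_of_real[symmetric])
    moreover have "exp (of_real u / 2) * exp (- ((1 - s) * of_real u / 2)) = exp (s * of_real u / 2)"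
      by (simp add: field_simps flip: exp_add)
    ultimately show "of_real (theta_profile (- u)) * exp (- ((1 - s) * of_real u / 2)) =
       of_real (theta_profile u) * exp (s * of_real u / 2)"
      by (simp add: mult_ac)
  qed
  finally show ?thesis .
qed

text \<open>
  The sharper upper bound with \<open>a (2 * N)\<close> is what the induction needs.
\<close>

lemma alternating_sum_bounds:
  fixes a :: "nat \<Rightarrow> real"
  assumes "\<And>k. 0 \<le> a k" "\<And>k. a (Suc k) \<le> a k"
  shows "0 \<le> (\<Sum>k<2*N. (-1) ^ k * a k) \<and> (\<Sum>k<2*N. (-1) ^ k * a k) \<le> a 0 - a (2 * N)"
proof (induction N)
  case (Suc N)
  have "a (Suc (2 * N)) \<le> a (2 * N)" "a (Suc (Suc (2 * N))) \<le> a (Suc (2 * N))" by (rule assms)+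
  then show ?case using Suc by simp
qed simp

text \<open>
  The combination \<open>h(u) - 2h(u + log 4)\<close> of theta profiles is the alternating series
  \<open>\<Sum> (-1)\<^bsup>k\<^esup> exp(-\<pi>(k+1)\<^sup>2 e\<^bsup>u\<^esup>)\<close>. Its partial sums lie between 0 and the first term, so it may be
  integrated term by term in the critical strip, which gives \<open>\<Gamma>(s/2) \<pi>\<^bsup>-s/2\<^esup>\<close> times the alternating zeta
  series. Translating the second profile shows that the integral is also \<open>1 - 2\<^bsup>1-s\<^esup>\<close> times the
  transform of \<open>h\<close>. The same factor occurs on the zeta side, and it does not vanish for
  \<open>Re s < 1\<close>.
\<close>

lemma theta_mellin_eq_zeta:
  assumes "0 < Re s" "Re s < 1"
  shows "(s - 1) * theta_mellin s = Gamma (s / 2) * of_real pi powr (- s / 2) * pole_free_zeta s"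
proof -
  define a where "a = (\<lambda>k u. exp (- (pi * (real (Suc k))\<^sup>2 * exp u)))"
  define A where "A = (\<lambda>u. theta_profile u - 2 * theta_profile (ln 4 + 1 * u))"
  let ?e = "\<lambda>u. exp (s / 2 * of_real u) :: complex"
  have s2: "Re (s / 2) > 0" using assms by simp
  \<comment> \<open>The leading terms \<open>e\<^bsup>-u/2\<^esup>/2\<close> of the two profiles cancel in \<open>A\<close>.\<close>
  have A: "(\<lambda>N. \<Sum>k<2*N. (-1) ^ k * a k u) \<longlonglongrightarrow> A u" for u
  proof -
    have exps: "exp (ln 4 + 1 * u) = 4 * exp u" by (simp add: exp_add)
    have "exp (- ((ln 4 + 1 * u) / 2)) = exp (- (u / 2)) / 2"
    proof -
      have "exp (ln 4 / 2 :: real) = 2" using ln_realpow[of 2 2] by simp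
      moreover have "- ((ln 4 + 1 * u) / 2) = - (u / 2) - ln 4 / 2" by (simp add: add_divide_distrib)
      ultimately show ?thesis by (simp only: exp_diff)
    qed
    then have Au: "A u = half_theta (exp u) - 2 * half_theta (4 * exp u)"
      unfolding A_def theta_profile_def exps by simp
    have alt: "(\<Sum>k<2*N. (-1) ^ k * a k u) = (\<Sum>k<2*N. a k u) - 2 * (\<Sum>k<N. exp (- (pi * (real (Suc k))\<^sup>2 * (4 * exp u))))" for N
    proof (induction N)
      case (Suc N)
      have "(real (Suc (Suc (2 * N))))\<^sup>2 = 4 * (real (Suc N))\<^sup>2" by (simp add: power2_eq_square algebra_simps)
      then have "a (Suc (2 * N)) u = exp (- (pi * (real (Suc N))\<^sup>2 * (4 * exp u)))"
        by (simp only: a_def mult_ac)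
      then show ?case using Suc by simp
    qed simp
    have "(\<lambda>N. \<Sum>k<N. a k u) \<longlonglongrightarrow> half_theta (exp u)"
      unfolding a_def half_theta_def by (intro summable_LIMSEQ exp_neg_square_summable) simp
    then have "(\<lambda>N. \<Sum>k<2*N. a k u) \<longlonglongrightarrow> half_theta (exp u)"
      by (rule filterlim_compose) (auto intro!: filterlim_subseq strict_monoI)
    moreover have "(\<lambda>N. \<Sum>k<N. exp (- (pi * (real (Suc k))\<^sup>2 * (4 * exp u)))) \<longlonglongrightarrow> half_theta (4 * exp u)"
      unfolding half_theta_def by (intro summable_LIMSEQ exp_neg_square_summable) simp
    ultimately show ?thesis unfolding alt Au by (intro tendsto_intros)
  qed
  have aint: "integrable lborel (\<lambda>u. of_real (a k u) * ?e u)"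
    "(\<integral>u. of_real (a k u) * ?e u \<partial>lborel) = Gamma (s / 2) * of_real pi powr (- s / 2) * of_nat (Suc k) powr (- s)" for k
  proof -
    have c: "pi * (real (Suc k))\<^sup>2 > 0" by simp
    show "integrable lborel (\<lambda>u. of_real (a k u) * ?e u)"
      unfolding a_def by (rule exp_mellin(1)[OF s2 c])
    have "complex_of_real (pi * (real (Suc k))\<^sup>2) powr (- (s / 2)) = of_real pi powr (- s / 2) * of_nat (Suc k) powr (- s)"
    proof -
      have "ln (pi * (real (Suc k))\<^sup>2) = ln pi + 2 * ln (real (Suc k))"
        by (subst ln_mult) (simp_all add: ln_realpow del: of_nat_Suc)
      then have "complex_of_real (pi * (real (Suc k))\<^sup>2) powr (- (s / 2)) = exp (- (s / 2) * of_real (ln pi + 2 * ln (real (Suc k))))"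
        using c by (simp add: powr_def Ln_of_real del: of_nat_Suc of_real_mult)
      also have "\<dots> = exp (- (s / 2) * of_real (ln pi)) * exp (- s * of_real (ln (real (Suc k))))"
        by (simp add: algebra_simps flip: exp_add)
      also have "exp (- (s / 2) * of_real (ln pi)) = of_real pi powr (- s / 2)" by (simp add: powr_def Ln_of_real)
      also have "exp (- s * of_real (ln (real (Suc k)))) = complex_of_real (real (Suc k)) powr (- s)"
        by (simp add: powr_def Ln_of_real del: of_nat_Suc of_real_of_nat_eq)
      finally show ?thesis by (simp del: of_nat_Suc)
    qed
    then show "(\<integral>u. of_real (a k u) * ?e u \<partial>lborel) = Gamma (s / 2) * of_real pi powr (- s / 2) * of_nat (Suc k) powr (- s)"
      unfolding a_def exp_mellin(2)[OF s2 c] by (simp only: mult.assoc)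
  qed
  have 1: "(\<lambda>N. \<integral>u. of_real (\<Sum>k<2*N. (-1) ^ k * a k u) * ?e u \<partial>lborel) \<longlonglongrightarrow> (\<integral>u. of_real (A u) * ?e u \<partial>lborel)"
  proof (rule integral_dominated_convergence[where w = "\<lambda>u. norm (of_real (a 0 u) * ?e u)"])
    show "integrable lborel (\<lambda>u. norm (of_real (a 0 u) * ?e u))" by (intro integrable_norm aint)
    show "AE u in lborel. (\<lambda>N. of_real (\<Sum>k<2*N. (-1) ^ k * a k u) * ?e u) \<longlonglongrightarrow> of_real (A u) * ?e u"
      by (intro AE_I2 tendsto_mult tendsto_const tendsto_of_real A)
    show "AE u in lborel. norm (of_real (\<Sum>k<2*N. (-1) ^ k * a k u) * ?e u) \<le> norm (of_real (a 0 u) * ?e u)" for N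
    proof (rule AE_I2)
      fix u
      have dec: "a (Suc k) u \<le> a k u" for k
        unfolding a_def by (simp add: mult_left_mono mult_right_mono power_mono)
      have nn: "0 \<le> a k u" for k by (simp add: a_def)
      have "\<bar>\<Sum>k<2*N. (-1) ^ k * a k u\<bar> \<le> \<bar>a 0 u\<bar>"
        using alternating_sum_bounds[of "\<lambda>k. a k u" N, OF nn dec] nn[of 0] nn[of "2 * N"] by linarith
      then show "norm (of_real (\<Sum>k<2*N. (-1) ^ k * a k u) * ?e u) \<le> norm (of_real (a 0 u) * ?e u)"
        unfolding norm_mult norm_of_real by (rule mult_right_mono) simp
    qed
  qed (simp_all add: a_def A_def)
  have 2: "(\<integral>u. of_real (\<Sum>k<2*N. (-1) ^ k * a k u) * ?e u \<partial>lborel) =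
     Gamma (s / 2) * of_real pi powr (- s / 2) * (\<Sum>k<2*N. (-1) ^ k * of_nat (Suc k) powr (- s))" for N
  proof -
    have "(\<integral>u. of_real (\<Sum>k<2*N. (-1) ^ k * a k u) * ?e u \<partial>lborel) =
       (\<integral>u. (\<Sum>k<2*N. (-1) ^ k * (of_real (a k u) * ?e u)) \<partial>lborel)"
      by (simp add: sum_distrib_right mult.assoc)
    also have "\<dots> = (\<Sum>k<2*N. \<integral>u. (-1) ^ k * (of_real (a k u) * ?e u) \<partial>lborel)"
      by (intro Bochner_Integration.integral_sum integrable_mult_right aint)
    also have "\<dots> = (\<Sum>k<2*N. (-1) ^ k * (Gamma (s / 2) * of_real pi powr (- s / 2) * of_nat (Suc k) powr (- s)))"
      by (simp only: integral_mult_right_zero aint)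
    finally show ?thesis by (simp add: sum_distrib_left mult_ac del: of_nat_Suc)
  qed
  have 3: "(\<integral>u. of_real (A u) * ?e u \<partial>lborel) = (1 - 2 powr (1 - s)) * theta_mellin s"
  proof -
    let ?g = "\<lambda>u. of_real (theta_profile u) * ?e u"
    have gi: "integrable lborel ?g" by (rule theta_mellin_integrable[OF assms])
    have gi': "integrable lborel (\<lambda>u. ?g (ln 4 + 1 * u))" by (rule lborel_integrable_real_affine[OF gi]) simp
    have gI: "(\<integral>u. ?g (ln 4 + 1 * u) \<partial>lborel) = theta_mellin s"
      unfolding theta_mellin_def using lborel_integral_real_affine[of 1 ?g "ln 4"] by simp
    have "of_real (A u) * ?e u = ?g u - 2 powr (1 - s) * ?g (ln 4 + 1 * u)" for u
    proof -
      have "complex_of_real (ln 4) = 2 * of_real (ln 2)" using ln_realpow[of 2 2] by simp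
      then have "2 powr (1 - s) * exp (s / 2 * of_real (ln 4 + 1 * u)) = 2 * ?e u"
        by (simp add: powr_def Ln_of_real[of 2, simplified] algebra_simps exp_add exp_diff exp_of_real)
      then have "of_real (theta_profile (ln 4 + 1 * u)) * (2 powr (1 - s) * exp (s / 2 * of_real (ln 4 + 1 * u))) =
          of_real (theta_profile (ln 4 + 1 * u)) * (2 * ?e u)" by (rule arg_cong)
      then have "2 powr (1 - s) * ?g (ln 4 + 1 * u) = of_real (theta_profile (ln 4 + 1 * u)) * (2 * ?e u)"
        by (simp only: mult.left_commute)
      then show ?thesis unfolding A_def by (simp add: algebra_simps)
    qed
    then have "(\<integral>u. of_real (A u) * ?e u \<partial>lborel) = (\<integral>u. ?g u \<partial>lborel) - 2 powr (1 - s) * (\<integral>u. ?g (ln 4 + 1 * u) \<partial>lborel)"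
      using gi gi' by (simp add: Bochner_Integration.integral_diff)
    then show ?thesis unfolding gI by (simp add: theta_mellin_def algebra_simps)
  qed
  have "(\<lambda>N. Gamma (s / 2) * of_real pi powr (- s / 2) * ((s - 1) * (\<Sum>k<2*N. (-1) ^ k * of_nat (Suc k) powr (- s))))
     \<longlonglongrightarrow> Gamma (s / 2) * of_real pi powr (- s / 2) * ((1 - 2 powr (1 - s)) * pole_free_zeta s)"
    by (intro tendsto_mult tendsto_const alternating_zeta_limit assms)
  moreover have "(\<lambda>N. (s - 1) * (Gamma (s / 2) * of_real pi powr (- s / 2) * (\<Sum>k<2*N. (-1) ^ k * of_nat (Suc k) powr (- s))))
     \<longlonglongrightarrow> (s - 1) * ((1 - 2 powr (1 - s)) * theta_mellin s)"
    by (rule tendsto_mult_left[OF 1[unfolded 2 3]])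
  ultimately have "(s - 1) * ((1 - 2 powr (1 - s)) * theta_mellin s) =
      Gamma (s / 2) * of_real pi powr (- s / 2) * ((1 - 2 powr (1 - s)) * pole_free_zeta s)"
    by (intro LIMSEQ_unique) (simp_all add: mult_ac)
  moreover have "2 powr (1 - s) \<noteq> (1 :: complex)"
  proof
    assume "2 powr (1 - s) = (1 :: complex)"
    then have "norm (2 powr (1 - s) :: complex) = 1" by simp
    then have "2 powr (1 - Re s) = 1" using norm_powr_real_powr[of 2 "1 - s"] by simp
    moreover have "2 powr (1 - Re s) > 1" using assms by (intro gr_one_powr) auto
    ultimately show False by simp
  qed
  ultimately show ?thesis by (simp add: mult.left_commute[of _ "1 - 2 powr (1 - s)"])
qed

lemma zeta_functional_equation_strip:
  assumes "0 < Re s" "Re s < 1"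
  shows "s * (Gamma (s / 2) * of_real pi powr (- s / 2) * pole_free_zeta s) =
         (1 - s) * (Gamma ((1 - s) / 2) * of_real pi powr (- (1 - s) / 2) * pole_free_zeta (1 - s))"
proof -
  have 1: "(s - 1) * theta_mellin s = Gamma (s / 2) * of_real pi powr (- s / 2) * pole_free_zeta s"
    by (rule theta_mellin_eq_zeta[OF assms])
  have "((1 - s) - 1) * theta_mellin (1 - s) =
      Gamma ((1 - s) / 2) * of_real pi powr (- (1 - s) / 2) * pole_free_zeta (1 - s)"
    by (rule theta_mellin_eq_zeta) (use assms in auto)
  then have 2: "- s * theta_mellin s =
      Gamma ((1 - s) / 2) * of_real pi powr (- (1 - s) / 2) * pole_free_zeta (1 - s)"
    by (simp add: theta_mellin_symmetric)
  show ?thesis unfolding 1[symmetric] 2[symmetric] by (simp add: algebra_simps)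
qed


section \<open>The zeta function on the whole plane\<close>

text \<open>
  The value of \<open>\<zeta>\<close> that the functional equation prescribes for \<open>Re s < 1\<close>, with \<open>1/\<Gamma>(s/2)\<close> written as
  \<open>(s/2)/\<Gamma>(s/2 + 1)\<close>. The factor \<open>s\<close> then cancels the pole of \<open>\<zeta>(1 - s)\<close> at 0, and the formula is
  holomorphic in the whole half-plane.
\<close>

definition zeta_left :: "complex \<Rightarrow> complex" where
  "zeta_left s = - (1/2) * of_real pi powr (s / 2) * rGamma (s / 2 + 1) *
     (Gamma ((1 - s) / 2) * of_real pi powr (- (1 - s) / 2) * pole_free_zeta (1 - s))"

definition zeta_glued :: "complex \<Rightarrow> complex" where
  "zeta_glued s = (if s = 1 then 0 else if Re s > 0 then pole_free_zeta s / (s - 1) else zeta_left s)"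

lemma zeta_left_eq:
  assumes "0 < Re s" "Re s < 1"
  shows "zeta_left s = pole_free_zeta s / (s - 1)"
proof -
  define X where "X = Gamma ((1 - s) / 2) * of_real pi powr (- (1 - s) / 2) * pole_free_zeta (1 - s)"
  define p where "p = complex_of_real pi powr (s / 2)"
  have p: "p \<noteq> 0" "of_real pi powr (- s / 2) = 1 / p"
    by (simp_all add: p_def powr_minus inverse_eq_divide)
  have s: "s \<noteq> 0" "s \<noteq> 1" "s / 2 \<notin> \<int>\<^sub>\<le>\<^sub>0" using assms by (auto elim!: nonpos_Ints_cases simp: complex_eq_iff)
  have G: "Gamma (s / 2) \<noteq> 0" using s by (simp add: Gamma_eq_zero_iff)
  have "Gamma (s / 2 + 1) = s / 2 * Gamma (s / 2)" by (rule Gamma_plus1[OF s(3)])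
  then have r: "rGamma (s / 2 + 1) = 1 / (s / 2 * Gamma (s / 2))" by (simp only: rGamma_inverse_Gamma inverse_eq_divide)
  have "s * (Gamma (s / 2) * (1 / p) * pole_free_zeta s) = (1 - s) * X"
    using zeta_functional_equation_strip[OF assms] unfolding p(2) X_def .
  then have "X = s * Gamma (s / 2) * pole_free_zeta s / (p * (1 - s))"
    using s p by (simp add: field_simps)
  then have "zeta_left s = - (1/2) * p * (1 / (s / 2 * Gamma (s / 2))) * (s * Gamma (s / 2) * pole_free_zeta s / (p * (1 - s)))"
    unfolding zeta_left_def X_def[symmetric] r p_def[symmetric] by simp
  also have "\<dots> = - pole_free_zeta s / (1 - s)" using s p G by simp
  also have "\<dots> = pole_free_zeta s / (s - 1)" by (metis minus_diff_eq minus_divide_left minus_divide_right)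
  finally show ?thesis .
qed

text \<open>
  Both formulas are holomorphic on their half-planes and agree on the critical strip, where the
  half-planes overlap.
\<close>

lemma zeta_glued_holomorphic: "zeta_glued holomorphic_on (- {1})"
proof -
  have "(\<lambda>s. pole_free_zeta s / (s - 1)) holomorphic_on {s. Re s > 0} - {1}"
    by (intro holomorphic_intros holomorphic_on_subset[OF pole_free_zeta_holomorphic]) auto
  then have 1: "zeta_glued holomorphic_on {s. Re s > 0} - {1}"
    by (rule holomorphic_transform) (auto simp: zeta_glued_def)
  have "(pole_free_zeta \<circ> (\<lambda>s. 1 - s)) holomorphic_on {s. Re s < 1}"
    by (rule holomorphic_on_compose_gen[OF _ pole_free_zeta_holomorphic]) (auto intro!: holomorphic_intros)
  then have "zeta_left holomorphic_on {s. Re s < 1}"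
    unfolding zeta_left_def comp_def
    by (intro holomorphic_intros) (auto elim!: nonpos_Ints_cases simp: complex_eq_iff)
  then have 2: "zeta_glued holomorphic_on {s. Re s < 1}"
    by (rule holomorphic_transform) (auto simp: zeta_glued_def zeta_left_eq)
  have "zeta_glued holomorphic_on (({s. Re s > 0} - {1}) \<union> {s. Re s < 1})"
    by (rule holomorphic_on_Un[OF 1 2]) (auto intro!: open_Diff open_halfspace_Re_gt open_halfspace_Re_lt)
  then show ?thesis by (rule holomorphic_on_subset) (auto simp: complex_eq_iff)
qed

lemma riemann_zeta_eq_glued: "riemann_zeta = zeta_glued"
  unfolding riemann_zeta_def
proof (rule the_equality)
  have "(\<lambda>n. of_nat (Suc n) powr (- s)) sums zeta_glued s" if "Re s > 1" for s
    using dirichlet_series_sums[OF that] that by (auto simp: zeta_glued_def)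
  then show "zeta_glued holomorphic_on (- {1}) \<and>
      (\<forall>s. Re s > 1 \<longrightarrow> (\<lambda>n. of_nat (Suc n) powr (- s)) sums zeta_glued s) \<and> zeta_glued 1 = 0"
    using zeta_glued_holomorphic by (simp add: zeta_glued_def del: of_nat_Suc)
next
  fix f assume f: "f holomorphic_on (- {1}) \<and>
      (\<forall>s. Re s > 1 \<longrightarrow> (\<lambda>n. of_nat (Suc n) powr (- s)) sums f s) \<and> f 1 = 0"
  show "f = zeta_glued"
  proof
    fix s
    show "f s = zeta_glued s"
    proof (cases "s = 1")
      case False
      have eq: "f w = zeta_glued w" if "w \<in> {w. Re w > 1}" for w
      proof -
        have "(\<lambda>n. of_nat (Suc n) powr (- w)) sums f w" using f that by blast
        moreover have "(\<lambda>n. of_nat (Suc n) powr (- w)) sums zeta_glued w"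
          using dirichlet_series_sums[of w] that by (auto simp: zeta_glued_def)
        ultimately show ?thesis by (rule sums_unique2)
      qed
      have ne: "{w. Re w > 1} \<noteq> {}" by (auto intro!: exI[of _ 2])
      have conn: "connected (- {1 :: complex})" by (rule connected_punctured_universe) simp
      show ?thesis
        by (rule analytic_continuation_open[OF open_halfspace_Re_gt _ ne conn _ _ zeta_glued_holomorphic eq])
           (use f False in auto)
    qed (use f in \<open>auto simp: zeta_glued_def\<close>)
  qed
qed

lemma riemann_zeta_eq: "Re s > 0 \<Longrightarrow> s \<noteq> 1 \<Longrightarrow> riemann_zeta s = pole_free_zeta s / (s - 1)"
  by (simp add: riemann_zeta_eq_glued zeta_glued_def)

lemma riemann_zeta_sums: "Re s > 1 \<Longrightarrow> (\<lambda>n. of_nat (Suc n) powr (- s)) sums riemann_zeta s"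
  using dirichlet_series_sums[of s] riemann_zeta_eq[of s] by (cases "s = 1") (simp_all del: of_nat_Suc)

definition completed_zeta :: "complex \<Rightarrow> complex" where
  "completed_zeta s = of_real pi powr (- s / 2) * Gamma (s / 2) * riemann_zeta s"

text \<open>
  The lower bound on \<open>Re s\<close> keeps \<open>s/2\<close> away from the poles of \<open>\<Gamma>\<close> at negative integers, where the
  default value 0 of the Gamma function would falsify the equation.
\<close>

lemma completed_zeta_reflect:
  assumes "-2 < Re s" "Re s < 1" "s \<noteq> 0"
  shows "completed_zeta (1 - s) = completed_zeta s"
proof -
  have s2: "s / 2 \<notin> \<int>\<^sub>\<le>\<^sub>0"
  proof
    assume "s / 2 \<in> \<int>\<^sub>\<le>\<^sub>0"
    then obtain n where n: "s / 2 = of_int n" "n \<le> 0" by (rule nonpos_Ints_cases)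
    then have "s = of_int (2 * n)" by simp
    then have "Re s = real_of_int (2 * n)" by (metis Re_complex_of_real of_real_of_int_eq)
    then have "n = 0" using assms(1) n(2) by linarith
    then show False using n assms(3) by simp
  qed
  have s1: "s \<noteq> 1" "1 - s \<noteq> 1" "Re (1 - s) > 0" using assms by auto
  define X where "X = Gamma ((1 - s) / 2) * of_real pi powr (- (1 - s) / 2) * pole_free_zeta (1 - s)"
  have "riemann_zeta s = zeta_left s"
    using zeta_left_eq[of s] assms s1 by (auto simp: riemann_zeta_eq_glued zeta_glued_def)
  then have "completed_zeta s = - (of_real pi powr (- s / 2) * of_real pi powr (s / 2)) * (1/2 * Gamma (s / 2) * rGamma (s / 2 + 1)) * X"
    unfolding completed_zeta_def zeta_left_def X_def[symmetric] by (simp add: mult_ac)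
  also have "of_real pi powr (- s / 2) * of_real pi powr (s / 2) = (1 :: complex)"
    by (simp flip: powr_add)
  also have "1/2 * Gamma (s / 2) * rGamma (s / 2 + 1) = 1 / s"
    using Gamma_plus1[OF s2] Gamma_eq_zero_iff[of "s / 2"] s2 assms(3)
    by (simp add: rGamma_inverse_Gamma field_simps)
  also have "- 1 * (1 / s) * X = completed_zeta (1 - s)"
    using s1 assms(3) by (simp add: completed_zeta_def riemann_zeta_eq X_def)
  finally show ?thesis ..
qed

section \<open>The confluent hypergeometric function with second parameter one half\<close>

lemma norm_pochhammer_le:
  fixes a :: complex
  assumes "norm a \<le> R"
  shows "norm (pochhammer a n) \<le> pochhammer R n"
proof -
  have "norm (a + of_nat i) \<le> R + of_nat i" for i
    using assms norm_triangle_ineq[of a "of_nat i"] by simp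
  then show ?thesis
    unfolding pochhammer_prod prod_norm[symmetric] by (intro prod_mono) auto
qed

text \<open>
  Each factor \<open>1/2 + k\<close> is at least \<open>(k + 1)/2\<close>.
\<close>

lemma pochhammer_half_ge: "fact n / 2 ^ n \<le> (pochhammer (1/2) n :: real)"
proof (induction n)
  case (Suc n)
  have "fact (Suc n) / 2 ^ Suc n = fact n / 2 ^ n * ((real n + 1) / 2)" by (simp add: field_simps)
  also have "\<dots> \<le> pochhammer (1/2) n * (1/2 + real n)"
    using Suc by (intro mult_mono) (auto intro!: pochhammer_nonneg)
  finally show ?case by (simp add: pochhammer_Suc)
qed simp

lemma pochhammer_half_nonzero: "pochhammer (1/2) n \<noteq> (0 :: complex)"
proof
  assume "pochhammer (1/2) n = (0 :: complex)"
  then have "complex_of_real (pochhammer (1/2) n) = 0" by (simp add: pochhammer_of_real[symmetric])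
  moreover have "pochhammer (1/2) n > (0::real)"  by (rule pochhammer_pos) simp
  ultimately show False by (metis of_real_eq_0_iff less_irrefl)
qed

lemma norm_pochhammer_half: "norm (pochhammer (1/2) n :: complex) = pochhammer (1/2) n"
proof -
  have "(pochhammer (1/2) n :: complex) = of_real (pochhammer (1/2) n)" by (simp add: pochhammer_of_real[symmetric])
  then show ?thesis using pochhammer_pos[of "1/2::real" n] by (simp del: of_real_eq_iff)
qed

text \<open>
  Because \<open>(1/2)\<^sub>n\<close> grows like a factorial, \<open>\<bar>u\<bar>\<^bsup>n\<^esup>/(1/2)\<^sub>n\<close> is at most a constant times \<open>\<delta>\<^bsup>n\<^esup>\<close> for every
  positive \<open>\<delta>\<close>. This leaves a majorant with the coefficients of a binomial series.
\<close>

lemma norm_hyp1F1_term_le: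
  fixes a u :: complex
  assumes "norm a \<le> R" and "0 < \<delta>"
  shows "norm (pochhammer a n * u ^ n / (pochhammer (1/2) n * fact n)) \<le>
           exp (2 * norm u / \<delta>) * (pochhammer R n / fact n * \<delta> ^ n)"
proof -
  have R: "0 \<le> pochhammer R n"
    using norm_ge_zero norm_pochhammer_le[OF assms(1)] by (rule order_trans)
  have "norm u ^ n / pochhammer (1/2) n \<le> norm u ^ n / (fact n / 2 ^ n)"
    by (intro divide_left_mono pochhammer_half_ge mult_pos_pos pochhammer_pos) auto
  also have "\<dots> = (2 * norm u / \<delta>) ^ n / fact n * \<delta> ^ n"
    using assms(2) by (simp add: power_mult_distrib power_divide field_simps)
  also have "\<dots> \<le> exp (2 * norm u / \<delta>) * \<delta> ^ n"
  proof (rule mult_right_mono)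
    have "(2 * norm u / \<delta>) ^ n / fact n = (\<Sum>k\<in>{n}. (2 * norm u / \<delta>) ^ k / fact k)" by simp
    also have "\<dots> \<le> (\<Sum>k. (2 * norm u / \<delta>) ^ k / fact k)"
      using assms(2) summable_exp[of "2 * norm u / \<delta>"] by (intro sum_le_suminf) (auto simp: divide_inverse mult.commute)
    also have "\<dots> = exp (2 * norm u / \<delta>)" by (simp add: exp_def scaleR_conv_of_real divide_inverse mult.commute)
    finally show "(2 * norm u / \<delta>) ^ n / fact n \<le> exp (2 * norm u / \<delta>)" .
  qed (use assms in auto)
  finally have 1: "norm u ^ n / pochhammer (1/2) n \<le> exp (2 * norm u / \<delta>) * \<delta> ^ n" .
  have "norm (pochhammer a n * u ^ n / (pochhammer (1/2) n * fact n)) =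
     norm (pochhammer a n) / fact n * (norm u ^ n / pochhammer (1/2) n)"
    by (simp add: norm_mult norm_divide norm_power norm_pochhammer_half)
  also have "\<dots> \<le> pochhammer R n / fact n * (exp (2 * norm u / \<delta>) * \<delta> ^ n)"
    using 1 norm_pochhammer_le[OF assms(1), of n] R pochhammer_pos[of "1/2::real" n]
    by (intro mult_mono divide_right_mono) auto
  finally show ?thesis by (simp add: mult_ac)
qed

lemma negative_binomial_sums:
  fixes R \<delta> :: real
  assumes "0 < \<delta>" "\<delta> < 1"
  shows "(\<lambda>n. pochhammer R n / fact n * \<delta> ^ n) sums ((1 - \<delta>) powr (- R))"
proof -
  have "(\<lambda>n. ((- R) gchoose n) * (- \<delta>) ^ n) sums (1 + - \<delta>) powr (- R)"
    using assms by (intro gen_binomial_real) auto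
  also have "(\<lambda>n. ((- R) gchoose n) * (- \<delta>) ^ n) = (\<lambda>n. pochhammer R n / fact n * \<delta> ^ n)"
    by (intro ext) (simp add: gbinomial_pochhammer power_minus[of \<delta>])
  finally show ?thesis by simp
qed

lemma hyp1F1_half_summable:
  "summable (\<lambda>n. norm (pochhammer a n * u ^ n / (pochhammer (1/2) n * fact n) :: complex))"
proof (rule summable_comparison_test')
  show "summable (\<lambda>n. exp (2 * norm u / (1/2)) * (pochhammer (norm a) n / fact n * (1/2) ^ n))"
    by (intro summable_mult sums_summable[OF negative_binomial_sums]) auto
qed (use norm_hyp1F1_term_le[OF order_refl, of "1/2" a] in simp)

lemma hyp1F1_half_sums:
  "(\<lambda>n. pochhammer a n * u ^ n / (pochhammer (1/2) n * fact n)) sums hyp1F1 a (1/2) u"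
  unfolding hyp1F1_def by (intro summable_sums summable_norm_cancel[OF hyp1F1_half_summable])

text \<open>
  Summing the majorants gives \<open>(1 - \<delta>)\<^bsup>-\<bar>a\<bar>\<^esup>\<close>, and \<open>\<delta> = 1 - e\<^bsup>-\<epsilon>\<^esup>\<close> turns this into \<open>e\<^bsup>\<epsilon>\<bar>a\<bar>\<^esup>\<close>. An arbitrarily small
  exponential rate is enough to be dominated by the decay of the Gamma function.
\<close>

lemma norm_hyp1F1_half_le:
  fixes a u :: complex
  assumes "\<epsilon> > 0"
  shows "norm (hyp1F1 a (1/2) u) \<le> exp (2 * norm u / (1 - exp (- \<epsilon>))) * exp (\<epsilon> * norm a)"
proof -
  define \<delta> where "\<delta> = 1 - exp (- \<epsilon>)"
  have \<delta>: "0 < \<delta>" "\<delta> < 1" using assms by (auto simp: \<delta>_def)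
  note s = sums_mult[OF negative_binomial_sums[OF \<delta>, of "norm a"], of "exp (2 * norm u / \<delta>)"]
  have "norm (hyp1F1 a (1/2) u) \<le> (\<Sum>n. exp (2 * norm u / \<delta>) * (pochhammer (norm a) n / fact n * \<delta> ^ n))"
    unfolding hyp1F1_def
    by (intro norm_suminf_le norm_hyp1F1_term_le \<delta> order_refl sums_summable[OF s])
  also have "\<dots> = exp (2 * norm u / \<delta>) * (1 - \<delta>) powr (- norm a)"
    using s by (simp add: sums_iff)
  also have "(1 - \<delta>) powr (- norm a) = exp (\<epsilon> * norm a)"
    by (simp add: \<delta>_def powr_def)
  finally show ?thesis by (simp add: \<delta>_def)
qed

lemma hyp1F1_half_holomorphic: "(\<lambda>a. hyp1F1 a (1/2) u) holomorphic_on UNIV"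
proof (rule holomorphic_uniform_sequence[OF open_UNIV])
  have "(\<lambda>a. pochhammer a k * u ^ k / (pochhammer (1/2) k * fact k)) holomorphic_on UNIV" for k
    using pochhammer_half_nonzero[of k] unfolding pochhammer_prod[of "_ :: complex" k]
    by (intro holomorphic_intros) auto
  then show "(\<lambda>a. \<Sum>k<n. pochhammer a k * u ^ k / (pochhammer (1/2) k * fact k)) holomorphic_on UNIV" for n
    by (intro holomorphic_on_sum)
next
  fix x :: complex
  have lim: "uniform_limit (cball x 1) (\<lambda>n a. \<Sum>k<n. pochhammer a k * u ^ k / (pochhammer (1/2) k * fact k))
         (\<lambda>a. \<Sum>k. pochhammer a k * u ^ k / (pochhammer (1/2) k * fact k)) sequentially"
  proof (rule Weierstrass_m_test)
    fix n a assume "a \<in> cball x 1"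
    then have "norm a \<le> norm x + 1"
      using norm_triangle_ineq2[of a x] by (simp add: dist_norm norm_minus_commute)
    then show "norm (pochhammer a n * u ^ n / (pochhammer (1/2) n * fact n)) \<le>
        exp (2 * norm u / (1/2)) * (pochhammer (norm x + 1) n / fact n * (1/2) ^ n)"
      by (rule norm_hyp1F1_term_le) simp
  next
    show "summable (\<lambda>n. exp (2 * norm u / (1/2)) * (pochhammer (norm x + 1) n / fact n * (1/2) ^ n))"
      by (intro summable_mult sums_summable[OF negative_binomial_sums]) auto
  qed
  then show "\<exists>d>0. cball x d \<subseteq> UNIV \<and>
      uniform_limit (cball x d) (\<lambda>n a. \<Sum>k<n. pochhammer a k * u ^ k / (pochhammer (1/2) k * fact k))
         (\<lambda>a. hyp1F1 a (1/2) u) sequentially"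
    unfolding hyp1F1_def by (intro exI[of _ 1]) auto
qed

lemma hyp1F1_half_half: "hyp1F1 (1/2) (1/2) u = exp u"
proof -
  have "pochhammer (1/2) n * u ^ n / (pochhammer (1/2) n * fact n) = u ^ n /\<^sub>R fact n" for n
    using pochhammer_half_nonzero[of n] by (simp add: scaleR_conv_of_real field_simps)
  then have "hyp1F1 (1/2) (1/2) u = (\<Sum>n. u ^ n /\<^sub>R fact n)"
    unfolding hyp1F1_def by simp
  then show ?thesis by (simp add: exp_def)
qed

text \<open>
  In the Cauchy product of the two series on the right, the coefficient of each power of \<open>u\<close> is a
  Chu-Vandermonde sum.
\<close>

lemma kummer_transformation_half:
  "hyp1F1 a (1/2) (- u) = exp (- u) * hyp1F1 (1/2 - a) (1/2) u"
proof -
  let ?A = "\<lambda>k. pochhammer (1/2 - a) k * u ^ k / (pochhammer (1/2) k * fact k)"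
  let ?B = "\<lambda>k. (- u) ^ k /\<^sub>R fact k"
  have B: "?B sums exp (- u)" by (rule exp_converges)
  have "(\<lambda>n. \<Sum>k\<le>n. ?A k * ?B (n - k)) sums ((\<Sum>k. ?A k) * (\<Sum>k. ?B k))"
    by (intro Cauchy_product_sums hyp1F1_half_summable summable_norm_exp)
  also have "(\<lambda>n. \<Sum>k\<le>n. ?A k * ?B (n - k)) = (\<lambda>n. pochhammer a n * (- u) ^ n / (pochhammer (1/2) n * fact n))"
  proof
    fix n
    have "?A k * ?B (n - k) = (- u) ^ n / fact n *
       ((pochhammer (1/2 - a) k * pochhammer (- of_nat n) k) / (of_nat (fact k) * pochhammer (1/2) k))"
      if "k \<le> n" for k
    proof -
      have p: "pochhammer (- of_nat n) k = (-1) ^ k * (fact n / fact (n - k) :: complex)"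
      proof -
        have "of_nat (n choose k) = (-1) ^ k * pochhammer (- of_nat n) k / (fact k :: complex)"
          by (simp add: binomial_gbinomial gbinomial_pochhammer)
        moreover have "of_nat (n choose k) = (fact n / (fact k * fact (n - k)) :: complex)"
          using that by (rule binomial_fact)
        ultimately have "fact n / fact (n - k) = (-1) ^ k * (pochhammer (- of_nat n) k :: complex)"
          by (simp add: field_simps)
        then have "(-1) ^ k * (fact n / fact (n - k)) = ((-1) ^ k * (-1) ^ k) * (pochhammer (- of_nat n) k :: complex)"
          by (simp only: mult.assoc)
        then show ?thesis by (simp flip: power_mult_distrib)
      qed
      have "(- u) ^ n = (- u) ^ k * (- u) ^ (n - k)" using that by (simp flip: power_add)
      moreover have "(- u) ^ k = (-1) ^ k * u ^ k" by (rule power_minus)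
      moreover have "(-1) ^ k * (-1) ^ k = (1 :: complex)" by (simp flip: power_mult_distrib)
      ultimately have "(- u) ^ n * (-1) ^ k = u ^ k * (- u) ^ (n - k)" by (simp add: mult_ac)
      then have "u ^ k * (- u) ^ (n - k) = (- u) ^ n * (-1) ^ k" ..
      then show ?thesis unfolding p
        by (simp add: scaleR_conv_of_real divide_simps mult_ac)
    qed
    then have "(\<Sum>k\<le>n. ?A k * ?B (n - k)) = (- u) ^ n / fact n * (\<Sum>k = 0..n.
       (pochhammer (1/2 - a) k * pochhammer (- of_nat n) k) / (of_nat (fact k) * pochhammer (1/2) k))"
      unfolding sum_distrib_left atMost_atLeast0 by (intro sum.cong) auto
    also have "(\<Sum>k = 0..n. (pochhammer (1/2 - a) k * pochhammer (- of_nat n) k) / (of_nat (fact k) * pochhammer (1/2) k))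
        = pochhammer (1/2 - (1/2 - a)) n / pochhammer (1/2) n"
    proof (rule Vandermonde_pochhammer, intro ballI)
      fix i :: nat
      have "Re (1/2) \<noteq> Re (- of_nat i)" by simp
      then show "1/2 \<noteq> (- of_nat i :: complex)" by metis
    qed
    finally show "(\<Sum>k\<le>n. ?A k * ?B (n - k)) = pochhammer a n * (- u) ^ n / (pochhammer (1/2) n * fact n)"
      by (simp add: mult_ac)
  qed
  finally have "(\<lambda>n. pochhammer a n * (- u) ^ n / (pochhammer (1/2) n * fact n)) sums
      (hyp1F1 (1/2 - a) (1/2) u * exp (- u))"
    using B by (simp add: hyp1F1_def sums_iff)
  from sums_unique2[OF hyp1F1_half_sums this] show ?thesis by (simp add: mult.commute)
qed


section \<open>Exponential decay of the Gamma function\<close>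

lemma norm_Gamma_le:
  fixes s :: complex
  assumes "Re s > 0"
  shows "norm (Gamma s) \<le> Gamma (Re s)"
proof -
  have 1: "((\<lambda>t. of_real t powr (s - 1) / of_real (exp t)) has_integral Gamma s) {0..}"
    by (rule Gamma_integral_complex) fact
  have 2: "((\<lambda>t. t powr (Re s - 1) / exp t) has_integral Gamma (Re s)) {0..}"
    by (rule Gamma_integral_real) fact
  have "norm (integral {0..} (\<lambda>t. of_real t powr (s - 1) / of_real (exp t))) \<le>
     integral {0..} (\<lambda>t. t powr (Re s - 1) / exp t)"
    using 1 2 by (intro integral_norm_bound_integral)
      (auto simp: norm_divide norm_powr_real_powr has_integral_integrable)
  then show ?thesis using 1 2 by (simp add: integral_unique)
qed

text \<open>
  Compare \<open>\<Gamma>(s) = \<Gamma>(s + N)/(s)\<^sub>N\<close> with the same recurrence at \<open>Re s\<close>. As long as \<open>Re s + k\<close> is at most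
  \<open>\<bar>Im s\<bar>\<close>, each factor satisfies \<open>\<bar>s + k\<bar> \<ge> \<surd>2 (Re s + k)\<close>. There are about \<open>\<bar>Im s\<bar>\<close> such factors, so the
  quotient \<open>\<bar>\<Gamma>(s)\<bar>/\<Gamma>(Re s)\<close> is at most of order \<open>2\<^bsup>-\<bar>Im s\<bar>/2\<^esup>\<close>.
\<close>

lemma norm_Gamma_exp_decay:
  fixes a b :: real
  assumes "0 < a"
  obtains C where "C > 0" "\<And>s. a \<le> Re s \<Longrightarrow> Re s \<le> b \<Longrightarrow> norm (Gamma s) \<le> C * exp (- (ln 2 / 2) * \<bar>Im s\<bar>)"
proof -
  have "continuous_on {a..b} (Gamma :: real \<Rightarrow> real)"
    using assms by (intro continuous_on_Gamma continuous_on_id) (auto elim!: nonpos_Ints_cases)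
  then have "bounded ((Gamma :: real \<Rightarrow> real) ` {a..b})"
    by (intro compact_imp_bounded compact_continuous_image) auto
  then obtain M where M: "M > 0" "\<And>x. x \<in> {a..b} \<Longrightarrow> Gamma x \<le> M"
    unfolding bounded_pos by (auto simp del: atLeastAtMost_iff dest!: abs_le_D1)
  have "norm (Gamma s) \<le> (M * exp (ln 2 / 2 * (b + 1))) * exp (- (ln 2 / 2) * \<bar>Im s\<bar>)"
    if s: "a \<le> Re s" "Re s \<le> b" for s
  proof -
    \<comment> \<open>The largest number of factors for which \<open>Re s + k \<le> \<bar>Im s\<bar>\<close> is certain.\<close>
  define N where "N = nat \<lfloor>\<bar>Im s\<bar> - b\<rfloor>"
    have pos: "Re s > 0" using s assms by linarith
    have N: "real N \<ge> \<bar>Im s\<bar> - b - 1" unfolding N_def by linarith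
    have step: "sqrt 2 * (Re s + real k) \<le> norm (s + of_nat k)" if "k < N" for k
    proof -
      have "real k \<le> \<bar>Im s\<bar> - b" using that unfolding N_def by linarith
      then have "(Re s + real k)\<^sup>2 \<le> (Im s)\<^sup>2"
        using s pos by (subst power2_abs[symmetric, of "Im s"], intro power_mono) auto
      then have "sqrt (2 * (Re s + real k)\<^sup>2) \<le> norm (s + of_nat k)"
        unfolding cmod_def by (intro real_sqrt_le_mono) simp
      then show ?thesis using pos by (simp add: real_sqrt_mult)
    qed
    have "sqrt 2 ^ N * pochhammer (Re s) N = (\<Prod>k<N. sqrt 2 * (Re s + real k))"
      by (simp add: pochhammer_prod prod.distrib atLeast0LessThan)
    also have "\<dots> \<le> (\<Prod>k<N. norm (s + of_nat k))"
      using step pos by (intro prod_mono) auto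
    also have "\<dots> = norm (pochhammer s N)" by (simp add: pochhammer_prod prod_norm atLeast0LessThan)
    finally have 1: "sqrt 2 ^ N * pochhammer (Re s) N \<le> norm (pochhammer s N)" .
    have "s \<notin> \<int>\<^sub>\<le>\<^sub>0" "Re s \<notin> \<int>\<^sub>\<le>\<^sub>0" using pos by (auto elim!: nonpos_Ints_cases)
    note g = pochhammer_Gamma[OF this(1), of N] pochhammer_Gamma[OF this(2), of N]
    have p0: "pochhammer (Re s) N > 0" "Gamma (Re s) > 0" using pos by (auto intro: pochhammer_pos)
    have gs: "Gamma s \<noteq> 0" using \<open>s \<notin> \<int>\<^sub>\<le>\<^sub>0\<close> by (simp add: Gamma_eq_zero_iff)
    have "norm (Gamma s) * (sqrt 2 ^ N * pochhammer (Re s) N) \<le> norm (Gamma s) * norm (pochhammer s N)"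
      using 1 by (intro mult_left_mono) auto
    also have "\<dots> = norm (Gamma (s + of_nat N))" using gs by (simp add: g flip: norm_mult)
    also have "\<dots> \<le> Gamma (Re s + N)" using norm_Gamma_le[of "s + of_nat N"] pos by simp
    also have "\<dots> = Gamma (Re s) * pochhammer (Re s) N" using p0 by (simp add: g)
    finally have "norm (Gamma s) * sqrt 2 ^ N \<le> Gamma (Re s)" using p0 by (simp flip: mult.assoc)
    then have "norm (Gamma s) \<le> Gamma (Re s) / sqrt 2 ^ N" by (simp add: pos_le_divide_eq)
    also have "\<dots> = Gamma (Re s) * exp (- (ln 2 / 2) * real N)"
    proof -
      have "sqrt 2 ^ N = exp (ln 2 / 2 * real N)"
      proof -
        have "exp (ln 2 / 2) = exp (ln (sqrt 2))" by (simp add: ln_sqrt)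
        then have "sqrt 2 = exp (ln 2 / 2)" by simp
        then show ?thesis using exp_of_nat_mult[of N "ln 2 / 2 :: real"] by (simp add: mult.commute)
      qed
      then show ?thesis by (simp only: divide_inverse exp_minus[symmetric] mult_minus_left)
    qed
    also have "\<dots> \<le> M * exp (ln 2 / 2 * (b + 1) + - (ln 2 / 2) * \<bar>Im s\<bar>)"
    proof (intro mult_mono)
      have "ln 2 / 2 * (\<bar>Im s\<bar> - b - 1) \<le> ln 2 / 2 * real N" using N by (intro mult_left_mono) auto
      then show "exp (- (ln 2 / 2) * real N) \<le> exp (ln 2 / 2 * (b + 1) + - (ln 2 / 2) * \<bar>Im s\<bar>)"
        by (simp add: algebra_simps)
    qed (use M s in auto)
    finally show ?thesis unfolding exp_add by (simp only: mult.assoc)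
  qed
  then show thesis using M(1) by (intro that[of "M * exp (ln 2 / 2 * (b + 1))"]) auto
qed

section \<open>Dirichlet series of a product of two zeta values\<close>

text \<open>
  The double series over pairs of positive integers converges absolutely. Grouping the pairs by
  their product gives the divisor sums.
\<close>

lemma dirichlet_product_sums:
  fixes f g :: "nat \<Rightarrow> complex"
  assumes f: "summable (\<lambda>n. norm (f (Suc n)))" and g: "summable (\<lambda>n. norm (g (Suc n)))"
  shows "(\<lambda>n. \<Sum>d | d dvd Suc n. f d * g (Suc n div d)) sums ((\<Sum>n. f (Suc n)) * (\<Sum>n. g (Suc n)))"
    and "summable (\<lambda>n. norm (\<Sum>d | d dvd Suc n. f d * g (Suc n div d)))"
proof -
  define F where "F = (\<lambda>n. f (Suc n))"
  define G where "G = (\<lambda>n. g (Suc n))"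
  define h where "h = (\<lambda>(m, n). F m * G n)"
  have Fs: "(F has_sum suminf F) UNIV" and Gs: "(G has_sum suminf G) UNIV"
    using f g unfolding F_def G_def
    by (auto intro!: norm_summable_imp_has_sum summable_sums summable_norm_cancel)
  have Fa: "(\<lambda>n. norm (F n)) summable_on UNIV" and Ga: "(\<lambda>n. norm (G n)) summable_on UNIV"
    using f g unfolding F_def G_def by (auto intro!: norm_summable_imp_summable_on)
  have "(\<lambda>x. norm (h x)) summable_on Sigma UNIV (\<lambda>_. UNIV)"
    unfolding Infinite_Sum.abs_summable_on_Sigma_iff h_def
    using Fa Ga by (auto simp: norm_mult abs_mult infsum_cmult_right' intro!: summable_on_cmult_right summable_on_cmult_left)
  then have "h summable_on (Sigma UNIV (\<lambda>_. UNIV))" by (rule abs_summable_summable)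
  then obtain S where S: "(h has_sum S) (Sigma UNIV (\<lambda>_. UNIV))" by (auto simp: summable_on_def)
  have "((\<lambda>m. F m * suminf G) has_sum S) UNIV"
    by (rule has_sum_SigmaD[OF S]) (use Gs in \<open>auto simp: h_def intro!: has_sum_cmult_right\<close>)
  moreover have "((\<lambda>m. F m * suminf G) has_sum (suminf F * suminf G)) UNIV"
    by (intro has_sum_cmult_left Fs)
  ultimately have S_eq: "S = suminf F * suminf G" by (rule has_sum_unique)
  \<comment> \<open>A pair of a number and a divisor corresponds to a factorisation. All indices are shifted by one to run over the positive integers.\<close>
  have bij: "bij_betw (\<lambda>(n, d). (d - 1, Suc n div d - 1)) (Sigma UNIV (\<lambda>n. {d. d dvd Suc n})) (Sigma UNIV (\<lambda>_. UNIV))"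
  proof (rule bij_betwI[where g = "\<lambda>(m, k). (Suc m * Suc k - 1, Suc m)"])
    have pred: "Suc (Suc m * Suc k - 1) = Suc m * Suc k" for m k by simp
    show "(\<lambda>(m, k). (Suc m * Suc k - 1, Suc m)) \<in> Sigma UNIV (\<lambda>_. UNIV) \<rightarrow> Sigma UNIV (\<lambda>n. {d. d dvd Suc n})"
      by (rule funcsetI) (auto simp only: pred split: prod.split intro!: SigmaI UNIV_I CollectI dvd_triv_left)
    show "(case case x of (n, d) \<Rightarrow> (d - 1, Suc n div d - 1) of (m, k) \<Rightarrow> (Suc m * Suc k - 1, Suc m)) = x"
      if "x \<in> Sigma UNIV (\<lambda>n. {d. d dvd Suc n})" for x
    proof -
      obtain n d where x: "x = (n, d)" by (cases x)
      then have "d dvd Suc n" using that by simp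
      then obtain k where k: "Suc n = d * k" by (elim dvdE)
      then have "d > 0" "k > 0" by (auto intro!: Nat.gr0I)
      then have "Suc n div d = k" "Suc (d - 1) = d" "Suc (k - 1) = k" using k by simp_all
      then show ?thesis unfolding x(1) by (simp only: prod.case k[symmetric] diff_Suc_1)
    qed
    show "(case case y of (m, k) \<Rightarrow> (Suc m * Suc k - 1, Suc m) of (n, d) \<Rightarrow> (d - 1, Suc n div d - 1)) = y" for y :: "nat \<times> nat"
    proof -
      obtain m k where y: "y = (m, k)" by (cases y)
      have "Suc m * Suc k div Suc m = Suc k" by (rule nonzero_mult_div_cancel_left) simp
      then show ?thesis unfolding y by (simp only: prod.case pred diff_Suc_1)
    qed
  qed auto
  have "((\<lambda>x. h (case x of (n, d) \<Rightarrow> (d - 1, Suc n div d - 1))) has_sum S) (Sigma UNIV (\<lambda>n. {d. d dvd Suc n}))"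
    using S by (subst has_sum_reindex_bij_betw[OF bij])
  then have "((\<lambda>n. \<Sum>d | d dvd Suc n. h (d - 1, Suc n div d - 1)) has_sum S) UNIV"
    by (rule has_sum_SigmaD) (auto intro!: has_sum_finiteI)
  also have "(\<lambda>n. \<Sum>d | d dvd Suc n. h (d - 1, Suc n div d - 1)) = (\<lambda>n. \<Sum>d | d dvd Suc n. f d * g (Suc n div d))"
  proof (intro ext sum.cong refl)
    fix n d assume "d \<in> {d. d dvd Suc n}"
    then obtain k where k: "Suc n = d * k" by (auto elim: dvdE)
    then have "d > 0" "k > 0" by (auto intro!: Nat.gr0I)
    then show "h (d - 1, Suc n div d - 1) = f d * g (Suc n div d)" unfolding k by (simp add: h_def F_def G_def)
  qed
  finally have hs: "((\<lambda>n. \<Sum>d | d dvd Suc n. f d * g (Suc n div d)) has_sum S) UNIV" .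
  show "(\<lambda>n. \<Sum>d | d dvd Suc n. f d * g (Suc n div d)) sums ((\<Sum>n. f (Suc n)) * (\<Sum>n. g (Suc n)))"
    using has_sum_imp_sums[OF hs] unfolding S_eq F_def G_def .
  have "(\<lambda>n. norm (\<Sum>d | d dvd Suc n. f d * g (Suc n div d))) summable_on UNIV"
    using hs by (intro summable_on_iff_abs_summable_on_complex[THEN iffD1]) (auto simp: summable_on_def)
  then show "summable (\<lambda>n. norm (\<Sum>d | d dvd Suc n. f d * g (Suc n div d)))"
    by (auto simp: summable_on_def dest: has_sum_imp_sums intro: sums_summable)
qed

text \<open>
  Stated with \<open>y = z/2\<close>, so that the coefficients are \<open>\<sigma>\<^bsub>-z\<^esub>(n) n\<^bsup>z/2\<^esup>\<close>.
\<close>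

lemma divisor_sigma_series:
  assumes "Re (s - y) > 1" "Re (s + y) > 1"
  defines "a \<equiv> \<lambda>n. divisor_sigma (- (2 * y)) (Suc n) * of_nat (Suc n) powr y * of_nat (Suc n) powr (- s)"
  shows "a sums (riemann_zeta (s - y) * riemann_zeta (s + y))" and "summable (\<lambda>n. norm (a n))"
proof -
  define f where "f = (\<lambda>n. of_nat n powr (- (s + y)) :: complex)"
  define g where "g = (\<lambda>n. of_nat n powr (- (s - y)) :: complex)"
  have sm: "summable (\<lambda>n. norm (of_nat (Suc n) powr (- p) :: complex))" if "Re p > 1" for p
  proof -
    have "summable (\<lambda>n. real n powr (- Re p))" using that by (simp add: summable_real_powr_iff)
    then have "summable (\<lambda>n. real (Suc n) powr (- Re p))" by (subst summable_Suc_iff)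
    moreover have "norm (of_nat (Suc n) powr (- p) :: complex) = real (Suc n) powr (- Re p)" for n
      using norm_powr_real_powr[of "of_nat (Suc n)" "- p"] by simp
    ultimately show ?thesis by simp
  qed
  have eq: "(\<Sum>d | d dvd Suc n. f d * g (Suc n div d)) = a n" for n
  proof -
    have "f d * g (Suc n div d) = of_nat d powr (- (2 * y)) * of_nat (Suc n) powr y * of_nat (Suc n) powr (- s)"
      if "d dvd Suc n" for d
    proof -
      from that obtain k where k: "Suc n = d * k" by (auto elim: dvdE)
      then have pos: "d > 0" "k > 0" by (auto intro!: Nat.gr0I)
      have split: "of_nat (Suc n) powr p = of_nat d powr p * (of_nat k powr p :: complex)" for p
        unfolding k of_nat_mult using powr_times_real[of "of_nat d" "of_nat k" p] by simp
      have "Suc n div d = k" using k pos by simp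
      moreover have "of_nat d powr (- (s + y)) = of_nat d powr (- (2 * y)) * of_nat d powr y * (of_nat d powr (- s) :: complex)"
        by (simp add: algebra_simps flip: powr_add)
      moreover have "of_nat k powr (- (s - y)) = of_nat k powr y * (of_nat k powr (- s) :: complex)"
        by (simp flip: powr_add)
      ultimately show ?thesis unfolding split f_def g_def by (simp add: mult_ac)
    qed
    then have "(\<Sum>d | d dvd Suc n. f d * g (Suc n div d)) =
       (\<Sum>d | d dvd Suc n. of_nat d powr (- (2 * y)) * of_nat (Suc n) powr y * of_nat (Suc n) powr (- s))"
      by (intro sum.cong refl) auto
    then show ?thesis by (simp add: a_def divisor_sigma_def sum_distrib_right)
  qed
  have fz: "(\<Sum>n. f (Suc n)) = riemann_zeta (s + y)" and gz: "(\<Sum>n. g (Suc n)) = riemann_zeta (s - y)"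
    using riemann_zeta_sums[OF assms(1)] riemann_zeta_sums[OF assms(2)] by (simp_all add: f_def g_def sums_iff)
  have fs: "summable (\<lambda>n. norm (f (Suc n)))" and gs: "summable (\<lambda>n. norm (g (Suc n)))"
    unfolding f_def g_def by (rule sm, fact)+
  show "a sums (riemann_zeta (s - y) * riemann_zeta (s + y))"
    using dirichlet_product_sums(1)[OF fs gs] unfolding eq fz gz by (simp add: mult.commute)
  show "summable (\<lambda>n. norm (a n))"
    using dirichlet_product_sums(2)[OF fs gs] unfolding eq .
qed


section \<open>The integrands and their decay\<close>

text \<open>
  One of the two factors in the integrand of the generalised Bessel function: that integrand is a
  product of values of this function at \<open>s - z\<close> and \<open>s + z\<close>, times a power.
\<close>

definition dressed_Gamma :: "complex \<Rightarrow> complex \<Rightarrow> complex" where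
  "dressed_Gamma v s = Gamma (s / 2) * hyp1F1 (s / 2) (1/2) v"

definition dressed_zeta :: "complex \<Rightarrow> complex \<Rightarrow> complex" where
  "dressed_zeta v s = completed_zeta s * hyp1F1 (s / 2) (1/2) v"

lemma dressed_zeta_eq: "dressed_zeta v s = of_real pi powr (- s / 2) * dressed_Gamma v s * riemann_zeta s"
  by (simp add: dressed_zeta_def dressed_Gamma_def completed_zeta_def)

lemma dressed_Gamma_holomorphic: "dressed_Gamma v holomorphic_on {s. Re s > 0}"
proof -
  have 1: "(\<lambda>s. Gamma (s / 2)) holomorphic_on {s. Re s > 0}"
    by (intro holomorphic_intros) (auto elim!: nonpos_Ints_cases simp: complex_eq_iff)
  have "((\<lambda>a. hyp1F1 a (1/2) v) \<circ> (\<lambda>s. s / 2)) holomorphic_on {s. Re s > 0}"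
    by (rule holomorphic_on_compose_gen[OF _ hyp1F1_half_holomorphic]) (auto intro!: holomorphic_intros)
  then show ?thesis using 1 unfolding dressed_Gamma_def comp_def by (intro holomorphic_on_mult)
qed

lemma dressed_zeta_holomorphic: "dressed_zeta v holomorphic_on {s. Re s > 0} - {1}"
proof -
  have "(\<lambda>s. of_real pi powr (- s / 2) * dressed_Gamma v s * (pole_free_zeta s / (s - 1))) holomorphic_on {s. Re s > 0} - {1}"
    by (intro holomorphic_intros holomorphic_on_subset[OF pole_free_zeta_holomorphic]
        holomorphic_on_subset[OF dressed_Gamma_holomorphic]) auto
  then show ?thesis by (rule holomorphic_transform) (auto simp: dressed_zeta_eq riemann_zeta_eq)
qed

text \<open>
  The residue of \<open>\<Lambda>\<close> at 1 is 1, which leaves the value \<open>\<^sub>1F\<^sub>1(1/2; 1/2; v) = e\<^bsup>v\<^esup>\<close>.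
\<close>

lemma dressed_zeta_residue:
  "((\<lambda>s. dressed_zeta v s * (s - 1)) \<longlongrightarrow> exp v) (at 1)"
proof -
  have op: "open {s. Re s > 0}" "1 \<in> {s. Re s > 0}" by (simp_all add: open_halfspace_Re_gt)
  let ?f = "\<lambda>s. of_real pi powr (- s / 2) * dressed_Gamma v s * pole_free_zeta s"
  have "?f holomorphic_on {s. Re s > 0}"
    by (intro holomorphic_intros pole_free_zeta_holomorphic dressed_Gamma_holomorphic) auto
  then have "isCont ?f 1" using op holomorphic_on_imp_continuous_on continuous_on_eq_continuous_at by blast
  then have "?f \<midarrow>1\<rightarrow> ?f 1" by (simp add: isCont_def)
  also have "?f 1 = exp v"
  proof -
    have "complex_of_real pi powr (- 1 / 2) * complex_of_real (sqrt pi) = 1"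
    proof -
      have "complex_of_real pi powr (- 1 / 2) = of_real (pi powr (- 1 / 2))" using powr_of_real[of pi "- 1 / 2"] by simp
      also have "pi powr (- 1 / 2) = 1 / sqrt pi" by (simp add: powr_minus_divide powr_half_sqrt)
      finally show ?thesis by (simp flip: of_real_mult)
    qed
    then show ?thesis by (simp add: dressed_Gamma_def Gamma_one_half_complex hyp1F1_half_half mult_ac)
  qed
  finally show ?thesis
  proof (rule Lim_transform_within_open[OF _ op])
    fix s assume "s \<in> {s. Re s > 0}" "s \<noteq> 1"
    then show "?f s = dressed_zeta v s * (s - 1)" by (simp add: dressed_zeta_eq riemann_zeta_eq)
  qed
qed

text \<open>
  Half of the exponential rate of \<open>\<Gamma>(s/2)\<close> is given away to absorb the growth of the
  hypergeometric factor.
\<close>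

lemma dressed_Gamma_decay:
  assumes "0 < a"
  shows "\<exists>C>0. \<forall>s. a \<le> Re s \<longrightarrow> Re s \<le> b \<longrightarrow> norm (dressed_Gamma v s) \<le> C * exp (- (ln 2 / 8) * \<bar>Im s\<bar>)"
proof -
  obtain C where C: "C > 0" "\<And>s. a / 2 \<le> Re s \<Longrightarrow> Re s \<le> b / 2 \<Longrightarrow> norm (Gamma s) \<le> C * exp (- (ln 2 / 2) * \<bar>Im s\<bar>)"
    using norm_Gamma_exp_decay[of "a / 2" "b / 2"] assms by auto
  \<comment> \<open>Of the rate \<open>ln 2 / 4\<close> of \<open>\<Gamma>(s/2)\<close>, the hypergeometric factor at \<open>s/2\<close> uses \<open>\<epsilon>/2\<close>.\<close>
  define \<epsilon> :: real where "\<epsilon> = ln 2 / 4"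
  have \<epsilon>: "\<epsilon> > 0" by (simp add: \<epsilon>_def)
  define E where "E = exp (2 * norm v / (1 - exp (- \<epsilon>)))"
  have "norm (dressed_Gamma v s) \<le> (C * E * exp (\<epsilon> * \<bar>b\<bar> / 2)) * exp (- (ln 2 / 8) * \<bar>Im s\<bar>)"
    if s: "a \<le> Re s" "Re s \<le> b" for s
  proof -
    have 1: "norm (Gamma (s / 2)) \<le> C * exp (- (ln 2 / 2) * (\<bar>Im s\<bar> / 2))" using C(2)[of "s / 2"] s by simp
    have "norm (s / 2) \<le> \<bar>b\<bar> / 2 + \<bar>Im s\<bar> / 2" using cmod_le[of s] s assms by (simp add: norm_divide)
    then have "exp (\<epsilon> * norm (s / 2)) \<le> exp (\<epsilon> * (\<bar>b\<bar> / 2 + \<bar>Im s\<bar> / 2))" using \<epsilon> by (simp add: mult_left_mono)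
    then have 2: "norm (hyp1F1 (s / 2) (1/2) v) \<le> E * exp (\<epsilon> * (\<bar>b\<bar> / 2 + \<bar>Im s\<bar> / 2))"
      using norm_hyp1F1_half_le[OF \<epsilon>, of "s / 2" v] unfolding E_def
      by (elim order_trans) (intro mult_left_mono, auto)
    have "norm (dressed_Gamma v s) \<le> (C * exp (- (ln 2 / 2) * (\<bar>Im s\<bar> / 2))) * (E * exp (\<epsilon> * (\<bar>b\<bar> / 2 + \<bar>Im s\<bar> / 2)))"
      unfolding dressed_Gamma_def norm_mult using C(1) by (intro mult_mono 1 2) auto
    also have "\<dots> = C * E * (exp (- (ln 2 / 2) * (\<bar>Im s\<bar> / 2)) * exp (\<epsilon> * (\<bar>b\<bar> / 2 + \<bar>Im s\<bar> / 2)))" by (simp only: mult_ac)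
    also have "exp (- (ln 2 / 2) * (\<bar>Im s\<bar> / 2)) * exp (\<epsilon> * (\<bar>b\<bar> / 2 + \<bar>Im s\<bar> / 2)) = exp (\<epsilon> * \<bar>b\<bar> / 2) * exp (- (ln 2 / 8) * \<bar>Im s\<bar>)"
    proof -
      have "- (ln 2 / 2) * (\<bar>Im s\<bar> / 2) + \<epsilon> * (\<bar>b\<bar> / 2 + \<bar>Im s\<bar> / 2) = \<epsilon> * \<bar>b\<bar> / 2 + - (ln 2 / 8) * \<bar>Im s\<bar>"
        by (simp add: \<epsilon>_def field_simps)
      then show ?thesis by (simp only: exp_add[symmetric])
    qed
    finally show ?thesis by (simp only: mult.assoc)
  qed
  then show ?thesis using C(1) by (intro exI[of _ "C * E * exp (\<epsilon> * \<bar>b\<bar> / 2)"]) (auto simp: E_def)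
qed

text \<open>
  Away from its pole, \<open>\<zeta>\<close> grows at most linearly, which costs another half of the rate. The
  constant is uniform in the strip outside the disc of radius \<open>r\<close> around the pole. This uniformity is
  what the limit \<open>z \<rightarrow> 0\<close> requires.
\<close>

lemma dressed_zeta_decay:
  assumes "0 < a" "0 < r"
  shows "\<exists>C>0. \<forall>s. a \<le> Re s \<longrightarrow> Re s \<le> b \<longrightarrow> r \<le> norm (s - 1) \<longrightarrow>
     norm (dressed_zeta v s) \<le> C * exp (- (ln 2 / 16) * \<bar>Im s\<bar>)"
proof -
  obtain C where C: "C > 0" "\<And>s. a \<le> Re s \<Longrightarrow> Re s \<le> b \<Longrightarrow> norm (dressed_Gamma v s) \<le> C * exp (- (ln 2 / 8) * \<bar>Im s\<bar>)"
    using dressed_Gamma_decay[OF assms(1)] by blast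
  obtain K where K: "K > 0" "\<And>s. a \<le> Re s \<Longrightarrow> norm (pole_free_zeta s - 1) \<le> K * norm (s - 1) * norm s"
    by (rule pole_free_zeta_bound[OF assms(1)]) blast
  define \<eta> :: real where "\<eta> = ln 2 / 16"
  have \<eta>: "\<eta> > 0" by (simp add: \<eta>_def)
  define D where "D = 1 / r + K * (\<bar>b\<bar> + 1 / \<eta>)"
  have D: "D > 0" using assms K \<eta> by (simp add: D_def add_pos_nonneg)
  have "norm (dressed_zeta v s) \<le> (C * D) * exp (- (ln 2 / 16) * \<bar>Im s\<bar>)"
    if s: "a \<le> Re s" "Re s \<le> b" "r \<le> norm (s - 1)" for s
  proof -
    have s1: "s \<noteq> 1" "Re s > 0" using s assms by auto
    then have s2: "0 < norm (s - 1)" by simp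
    have "norm (pole_free_zeta s) \<le> norm (1 :: complex) + norm (pole_free_zeta s - 1)"
      by (rule norm_triangle_sub)
    then have "norm (pole_free_zeta s) \<le> 1 + K * norm (s - 1) * norm s" using K(2)[OF s(1)] by simp
    then have "norm (riemann_zeta s) \<le> (1 + K * norm (s - 1) * norm s) / norm (s - 1)"
      using s1 by (simp add: riemann_zeta_eq norm_divide divide_right_mono)
    also have "\<dots> = 1 / norm (s - 1) + K * norm s" using s1 by (simp add: field_simps)
    also have "\<dots> \<le> 1 / r + K * norm s" using s assms s2 by (intro add_right_mono divide_left_mono mult_pos_pos) auto
    also have "\<dots> \<le> 1 / r + K * (\<bar>b\<bar> + \<bar>Im s\<bar>)" using cmod_le[of s] s s1 K(1) by (intro add_left_mono mult_left_mono) auto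
    also have "\<dots> \<le> D * exp (\<eta> * \<bar>Im s\<bar>)"
    proof -
      have e1: "1 \<le> exp (\<eta> * \<bar>Im s\<bar>)" using \<eta> by simp
      have "\<eta> * \<bar>Im s\<bar> \<le> exp (\<eta> * \<bar>Im s\<bar>)" using exp_ge_add_one_self[of "\<eta> * \<bar>Im s\<bar>"] by linarith
      then have "\<bar>Im s\<bar> \<le> 1 / \<eta> * exp (\<eta> * \<bar>Im s\<bar>)" using \<eta> by (simp add: field_simps)
      moreover have "\<bar>b\<bar> * 1 \<le> \<bar>b\<bar> * exp (\<eta> * \<bar>Im s\<bar>)" using e1 by (intro mult_left_mono) auto
      ultimately have "\<bar>b\<bar> + \<bar>Im s\<bar> \<le> (\<bar>b\<bar> + 1 / \<eta>) * exp (\<eta> * \<bar>Im s\<bar>)" by (simp add: distrib_right)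
      then have "K * (\<bar>b\<bar> + \<bar>Im s\<bar>) \<le> K * ((\<bar>b\<bar> + 1 / \<eta>) * exp (\<eta> * \<bar>Im s\<bar>))" using K(1) by (intro mult_left_mono) auto
      moreover have "1 / r * 1 \<le> 1 / r * exp (\<eta> * \<bar>Im s\<bar>)" using e1 assms by (intro mult_left_mono) auto
      ultimately show ?thesis by (simp add: D_def distrib_right mult.assoc)
    qed
    finally have 1: "norm (riemann_zeta s) \<le> D * exp (\<eta> * \<bar>Im s\<bar>)" .
    have "norm (of_real pi powr (- s / 2) :: complex) = pi powr (- Re s / 2)"
      using norm_powr_real_powr[of "of_real pi" "- s / 2"] by simp
    also have "\<dots> \<le> pi powr 0" using s1 pi_ge_two by (intro powr_mono) auto
    finally have 2: "norm (of_real pi powr (- s / 2) :: complex) \<le> 1" by simp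
    have "norm (dressed_zeta v s) \<le> 1 * (C * exp (- (ln 2 / 8) * \<bar>Im s\<bar>)) * (D * exp (\<eta> * \<bar>Im s\<bar>))"
      unfolding dressed_zeta_eq norm_mult using C D s by (intro mult_mono 1 2) auto
    also have "\<dots> = C * D * (exp (- (ln 2 / 8) * \<bar>Im s\<bar>) * exp (\<eta> * \<bar>Im s\<bar>))" by (simp only: mult_ac mult_1)
    also have "exp (- (ln 2 / 8) * \<bar>Im s\<bar>) * exp (\<eta> * \<bar>Im s\<bar>) = exp (- (ln 2 / 16) * \<bar>Im s\<bar>)"
    proof -
      have "- (ln 2 / 8) * \<bar>Im s\<bar> + \<eta> * \<bar>Im s\<bar> = - (ln 2 / 16) * \<bar>Im s\<bar>" by (simp add: \<eta>_def field_simps)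
      then show ?thesis by (simp only: exp_add[symmetric])
    qed
    finally show ?thesis .
  qed
  then show ?thesis using C(1) D by (intro exI[of _ "C * D"]) auto
qed

lemma norm_real_powr_strip_le:
  fixes x :: real
  assumes "x > 0" "a \<le> Re s" "Re s \<le> b"
  shows "norm (of_real x powr (- s) :: complex) \<le> x powr (- a) + x powr (- b)"
proof -
  have "norm (of_real x powr (- s) :: complex) = x powr (- Re s)"
    using norm_powr_real_powr[of "of_real x" "- s"] assms(1) by simp
  also have "\<dots> \<le> x powr (- a) + x powr (- b)"
  proof (cases "x \<ge> 1")
    case True
    then have "x powr (- Re s) \<le> x powr (- a)" using assms by (intro powr_mono) auto
    then show ?thesis by (simp add: add_increasing2)
  next
    case False
    then have "x powr (- Re s) \<le> x powr (- b)" using assms by (intro powr_mono') auto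
    then show ?thesis by (simp add: add_increasing)
  qed
  finally show ?thesis .
qed

text \<open>
  The common shape of all integrands: with \<open>h = dressed_Gamma v\<close> it is the kernel of the Bessel
  function, with \<open>h = dressed_zeta v\<close> that of the integral over the critical line.
\<close>

definition paired_mellin :: "(complex \<Rightarrow> complex) \<Rightarrow> complex \<Rightarrow> real \<Rightarrow> complex \<Rightarrow> complex" where
  "paired_mellin h y x s = h (s - y) * h (s + y) * of_real x powr (- s)"

text \<open>
  With \<open>r = 0\<close> this serves functions without a pole. The bound depends on \<open>y\<close> only through \<open>R\<close>.
\<close>

lemma paired_mellin_decay:
  assumes h: "\<And>s. A \<le> Re s \<Longrightarrow> Re s \<le> B \<Longrightarrow> r \<le> norm (s - 1) \<Longrightarrow> norm (h s) \<le> C * exp (- \<theta> * \<bar>Im s\<bar>)"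
    and "0 \<le> \<theta>" "0 < C" "0 < x" "norm y \<le> R"
    and s: "a \<le> Re s" "Re s \<le> b"
    and strip: "A \<le> Re (s - y)" "Re (s - y) \<le> B" "A \<le> Re (s + y)" "Re (s + y) \<le> B"
    and "r \<le> norm (s - y - 1)" "r \<le> norm (s + y - 1)"
  shows "norm (paired_mellin h y x s) \<le>
           (C * exp (\<theta> * R))\<^sup>2 * (x powr (- a) + x powr (- b)) * exp (- (2 * \<theta>) * \<bar>Im s\<bar>)"
proof -
  have R: "\<bar>Im y\<bar> \<le> R" using abs_Im_le_cmod[of y] assms(5) by linarith
  have e: "exp (- \<theta> * \<bar>Im p\<bar>) \<le> exp (\<theta> * R) * exp (- \<theta> * \<bar>Im s\<bar>)" if "\<bar>Im p\<bar> \<ge> \<bar>Im s\<bar> - \<bar>Im y\<bar>" for p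
  proof -
    have "\<theta> * (\<bar>Im s\<bar> - R) \<le> \<theta> * \<bar>Im p\<bar>" using that R assms(2) by (intro mult_left_mono) auto
    then show ?thesis by (simp add: algebra_simps flip: exp_add)
  qed
  have 1: "norm (h p) \<le> C * exp (\<theta> * R) * exp (- \<theta> * \<bar>Im s\<bar>)"
    if "A \<le> Re p" "Re p \<le> B" "r \<le> norm (p - 1)" "\<bar>Im p\<bar> \<ge> \<bar>Im s\<bar> - \<bar>Im y\<bar>" for p
    using order_trans[OF h[OF that(1-3)] mult_left_mono[OF e[OF that(4)], of C]] assms(3) by (simp add: mult.assoc)
  have "norm (paired_mellin h y x s) \<le> (C * exp (\<theta> * R) * exp (- \<theta> * \<bar>Im s\<bar>)) * (C * exp (\<theta> * R) * exp (- \<theta> * \<bar>Im s\<bar>)) *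
     (x powr (- a) + x powr (- b))"
    unfolding paired_mellin_def norm_mult
    using assms by (intro mult_mono 1 norm_real_powr_strip_le s) auto
  also have "\<dots> = (C * exp (\<theta> * R))\<^sup>2 * (x powr (- a) + x powr (- b)) * (exp (- \<theta> * \<bar>Im s\<bar>) * exp (- \<theta> * \<bar>Im s\<bar>))"
    by (simp only: power2_eq_square mult_ac)
  also have "exp (- \<theta> * \<bar>Im s\<bar>) * exp (- \<theta> * \<bar>Im s\<bar>) = exp (- (2 * \<theta>) * \<bar>Im s\<bar>)"
    by (simp flip: exp_add)
  finally show ?thesis .
qed

lemma paired_mellin_holomorphic:
  assumes h: "h holomorphic_on {s. Re s > 0} - P" and "x > 0"
  shows "paired_mellin h y x holomorphic_on {s. Re s > \<bar>Re y\<bar>} - ((\<lambda>p. p + y) ` P \<union> (\<lambda>p. p - y) ` P)"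
proof -
  have 1: "(h \<circ> (\<lambda>s. s - y)) holomorphic_on {s. Re s > \<bar>Re y\<bar>} - ((\<lambda>p. p + y) ` P \<union> (\<lambda>p. p - y) ` P)"
    by (rule holomorphic_on_compose_gen[OF _ h]) (auto intro!: holomorphic_intros
        dest: imageI[of _ P "\<lambda>p. p + y"] imageI[of _ P "\<lambda>p. p - y"])
  have 2: "(h \<circ> (\<lambda>s. s + y)) holomorphic_on {s. Re s > \<bar>Re y\<bar>} - ((\<lambda>p. p + y) ` P \<union> (\<lambda>p. p - y) ` P)"
    by (rule holomorphic_on_compose_gen[OF _ h]) (auto intro!: holomorphic_intros
        dest: imageI[of _ P "\<lambda>p. p + y"] imageI[of _ P "\<lambda>p. p - y"])
  from 1 2 show ?thesis
    unfolding paired_mellin_def comp_def using assms(2) by (intro holomorphic_intros) auto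
qed

section \<open>The two sides of the transformation\<close>

lemma paired_dressed_Gamma_line:
  assumes "x > 0" "\<bar>Re y\<bar> < a" "a < b"
  shows "integrable lborel (\<lambda>t. paired_mellin (dressed_Gamma v) y x (Complex a t))" (is ?A)
    and "integrable lborel (\<lambda>t. paired_mellin (dressed_Gamma v) y x (Complex b t))" (is ?B)
    and "(\<integral>t. paired_mellin (dressed_Gamma v) y x (Complex b t) \<partial>lborel) =
         (\<integral>t. paired_mellin (dressed_Gamma v) y x (Complex a t) \<partial>lborel)" (is ?C)
proof -
  let ?f = "paired_mellin (dressed_Gamma v) y x"
  obtain C where C: "C > 0" "\<And>s. a - \<bar>Re y\<bar> \<le> Re s \<Longrightarrow> Re s \<le> b + \<bar>Re y\<bar> \<Longrightarrow>
      norm (dressed_Gamma v s) \<le> C * exp (- (ln 2 / 8) * \<bar>Im s\<bar>)"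
    using dressed_Gamma_decay[of "a - \<bar>Re y\<bar>" "b + \<bar>Re y\<bar>" v] assms by auto
  have bnd: "norm (?f s) \<le> (C * exp (ln 2 / 8 * norm y))\<^sup>2 * (x powr (- a) + x powr (- b)) * exp (- (2 * (ln 2 / 8)) * \<bar>Im s\<bar>)"
    if "a \<le> Re s" "Re s \<le> b" "0 \<le> \<bar>Im s\<bar>" for s
    by (rule paired_mellin_decay[where A = "a - \<bar>Re y\<bar>" and B = "b + \<bar>Re y\<bar>" and r = 0])
       (use that assms C in \<open>auto simp: abs_if\<close>)
  have "dressed_Gamma v holomorphic_on {s. Re s > 0} - {}" using dressed_Gamma_holomorphic by simp
  from paired_mellin_holomorphic[OF this assms(1), of y]
  have holo: "?f holomorphic_on {s. Re s > \<bar>Re y\<bar>} - {}" by simp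
  note shift = vertical_line_shift[OF open_halfspace_Re_gt convex_halfspace_Re_gt finite.emptyI holo assms(3) _ _ _ bnd]
  show ?A by (rule shift(1)) (use assms in auto)
  show ?B by (rule shift(2)) (use assms in auto)
  have "(\<integral>t. ?f (Complex b t) \<partial>lborel) = (\<integral>t. ?f (Complex a t) \<partial>lborel) + 2 * of_real pi * (\<Sum>p\<in>{}. residue ?f p)"
    by (rule shift(3)) (use assms in auto)
  then show ?C by simp
qed

lemma gen_bessel_K_integrand_eq:
  assumes "x > 0"
  shows "gen_bessel_K_integrand z w x s = paired_mellin (dressed_Gamma (- w\<^sup>2 / 4)) z (x / 2) s / 4"
proof -
  have 1: "2 powr (s - 2) = 2 powr s / (4 :: complex)" by (simp add: powr_diff)
  have 2: "2 powr s * of_real x powr (- s) = of_real (x / 2) powr (- s)"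
    using assms by (simp add: powr_def Ln_of_real[of 2, simplified] Ln_of_real ln_div algebra_simps flip: exp_add of_real_divide)
  have "2 powr (s - 2) * of_real x powr (- s) = of_real (x / 2) powr (- s) / (4 :: complex)"
    unfolding 1 by (simp only: times_divide_eq_left 2)
  then show ?thesis
    unfolding gen_bessel_K_integrand_def paired_mellin_def dressed_Gamma_def by (simp add: mult_ac)
qed

text \<open>
  The integrand is holomorphic to the right of \<open>\<bar>Re z\<bar>\<close>, so all admissible lines give the same value
  and the definite description is met.
\<close>

lemma gen_bessel_K_eq:
  assumes "x > 0" "\<bar>Re z\<bar> < c"
  shows "gen_bessel_K z w x = (\<integral>t. paired_mellin (dressed_Gamma (- w\<^sup>2 / 4)) z (x / 2) (Complex c t) \<partial>lborel) / (8 * of_real pi)"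
proof -
  let ?f = "paired_mellin (dressed_Gamma (- w\<^sup>2 / 4)) z (x / 2)"
  define K where "K = (\<integral>t. ?f (Complex c t) \<partial>lborel) / (8 * of_real pi)"
  have x2: "x / 2 > 0" using assms by simp
  have hv: "has_vertical_integral (gen_bessel_K_integrand z w x) (2 * of_real pi * \<i> * K) d" if d: "d > \<bar>Re z\<bar>" for d
  proof -
    have int: "integrable lborel (\<lambda>t. ?f (Complex d t))"
      using paired_dressed_Gamma_line(1)[OF x2 d, of "d + 1"] by simp
    have eq: "(\<integral>t. ?f (Complex d t) \<partial>lborel) = (\<integral>t. ?f (Complex c t) \<partial>lborel)"
    proof (cases c d rule: linorder_cases)
      case less
      then show ?thesis by (rule paired_dressed_Gamma_line(3)[OF x2 assms(2)])
    next
      case greater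
      then show ?thesis by (rule paired_dressed_Gamma_line(3)[OF x2 d, symmetric])
    qed simp
    have "((\<lambda>t. ?f (Complex d t) * (\<i> / 4)) has_integral ((\<integral>t. ?f (Complex d t) \<partial>lborel) * (\<i> / 4))) UNIV"
      by (rule has_integral_mult_left[OF has_integral_integral_lborel[OF int]])
    moreover have "(\<integral>t. ?f (Complex d t) \<partial>lborel) * (\<i> / 4) = 2 * of_real pi * \<i> * K"
      unfolding eq K_def by simp
    moreover have "(\<lambda>t. gen_bessel_K_integrand z w x (Complex d t) * \<i>) = (\<lambda>t. ?f (Complex d t) * (\<i> / 4))"
      by (simp add: gen_bessel_K_integrand_eq[OF assms(1)])
    ultimately show ?thesis by (simp only: has_vertical_integral_def)
  qed
  show ?thesis unfolding gen_bessel_K_def K_def[symmetric]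
  proof (rule the_equality)
    show "\<forall>c>\<bar>Re z\<bar>. has_vertical_integral (gen_bessel_K_integrand z w x) (2 * of_real pi * \<i> * K) c"
      using hv by blast
    fix K' assume "\<forall>c>\<bar>Re z\<bar>. has_vertical_integral (gen_bessel_K_integrand z w x) (2 * of_real pi * \<i> * K') c"
    then have "has_vertical_integral (gen_bessel_K_integrand z w x) (2 * of_real pi * \<i> * K') c"
      using assms(2) by blast
    with hv[OF assms(2)] have "2 * of_real pi * \<i> * K' = 2 * of_real pi * \<i> * K"
      unfolding has_vertical_integral_def by (blast intro: has_integral_unique)
    then show "K' = K" by simp
  qed
qed

text \<open>
  On a vertical line the absolute values of the coefficients \<open>\<sigma>\<^bsub>-z\<^esub>(n) n\<^bsup>z/2\<^esup> n\<^bsup>-s\<^esup>\<close> are constant and summable.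
  So the series may be integrated term by term against the kernel with the scale \<open>\<pi>\<alpha>\<close>.
\<close>

lemma bessel_series:
  assumes "\<alpha> > 0" "\<bar>Re z\<bar> < 2"
  shows "(\<lambda>n. bessel_term \<alpha> z w (Suc n)) sums
     (exp (- w\<^sup>2 / 4) / (8 * of_real pi) * (\<integral>t. paired_mellin (dressed_zeta (w\<^sup>2 / 4)) (z / 2) \<alpha> (Complex 2 t) \<partial>lborel))"
proof -
  define v y where "v = w\<^sup>2 / 4" and "y = z / 2"
  have y: "\<bar>Re y\<bar> < 1" "\<bar>Re y\<bar> < 2" using assms by (auto simp: y_def)
  define A where "A = (\<lambda>n. divisor_sigma (- (2 * y)) (Suc n) * of_nat (Suc n) powr y)"
  let ?G = "paired_mellin (dressed_Gamma v) y"
  let ?f = "\<lambda>n t. A n * ?G (real (Suc n) * pi * \<alpha>) (Complex 2 t)"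
  have pa: "pi * \<alpha> > 0" using assms by simp
  have scale: "?f n t = A n * of_nat (Suc n) powr (- Complex 2 t) * ?G (pi * \<alpha>) (Complex 2 t)" for n t
  proof -
    have "complex_of_real (real (Suc n) * (pi * \<alpha>)) powr p = of_nat (Suc n) powr p * of_real (pi * \<alpha>) powr p" for p
      unfolding of_real_mult[of "real (Suc n)"] of_real_of_nat_eq
      by (rule powr_times_real) (use pa in \<open>auto simp del: of_nat_Suc of_real_mult\<close>)
    then show ?thesis unfolding paired_mellin_def by (simp add: mult_ac del: of_real_mult of_nat_Suc)
  qed
  have series: "(\<lambda>n. A n * of_nat (Suc n) powr (- s)) sums (riemann_zeta (s - y) * riemann_zeta (s + y))"
    "summable (\<lambda>n. norm (A n * of_nat (Suc n) powr (- s)))" if "Re s = 2" for s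
    using divisor_sigma_series[of s y] that y unfolding A_def by (auto simp: abs_if split: if_splits)
  have bessel: "bessel_term \<alpha> z w (Suc n) = exp (- v) / (8 * of_real pi) * (\<integral>t. ?f n t \<partial>lborel)" for n
  proof -
    have "gen_bessel_K (z / 2) (\<i> * w) (2 * of_nat (Suc n) * pi * \<alpha>) =
      (\<integral>t. paired_mellin (dressed_Gamma (- (\<i> * w)\<^sup>2 / 4)) (z / 2) (2 * of_nat (Suc n) * pi * \<alpha> / 2) (Complex 2 t) \<partial>lborel) / (8 * of_real pi)"
      by (rule gen_bessel_K_eq) (use assms in auto)
    also have "- (\<i> * w)\<^sup>2 / 4 = v" by (simp add: v_def power_mult_distrib)
    also have "2 * of_nat (Suc n) * pi * \<alpha> / 2 = real (Suc n) * pi * \<alpha>" by simp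
    finally have K: "gen_bessel_K (z / 2) (\<i> * w) (2 * of_nat (Suc n) * pi * \<alpha>) =
      (\<integral>t. ?G (real (Suc n) * pi * \<alpha>) (Complex 2 t) \<partial>lborel) / (8 * of_real pi)" unfolding y_def .
    show ?thesis unfolding bessel_term_def K by (simp add: A_def y_def v_def del: of_nat_Suc)
  qed
  have Gint: "integrable lborel (\<lambda>t. ?G (pi * \<alpha>) (Complex 2 t))"
    using paired_dressed_Gamma_line(1)[OF pa y(2), of 3] by simp
  have fint: "integrable lborel (?f n)" for n
    using paired_dressed_Gamma_line(1)[of "real (Suc n) * pi * \<alpha>" y 2 3 v] y assms by simp
  define B where "B = (\<lambda>n. norm (A n * of_nat (Suc n) powr (- 2)))"
  have Bs: "summable B" unfolding B_def by (rule series(2)) simp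
  have nrm: "norm (?f n t) = B n * norm (?G (pi * \<alpha>) (Complex 2 t))" for n t
    using norm_powr_real_powr[of "of_nat (Suc n)" "- Complex 2 t"] norm_powr_real_powr[of "of_nat (Suc n)" "- 2"]
    unfolding scale B_def norm_mult by (simp del: of_nat_Suc)
  have "(\<lambda>n. \<integral>t. ?f n t \<partial>lborel) sums (\<integral>t. (\<Sum>n. ?f n t) \<partial>lborel)"
  proof (rule sums_integral[OF fint])
    show "AE t in lborel. summable (\<lambda>n. norm (?f n t))"
      unfolding nrm by (intro AE_I2 summable_mult2 Bs)
    show "summable (\<lambda>n. \<integral>t. norm (?f n t) \<partial>lborel)"
      unfolding nrm by (simp add: summable_mult2 Bs)
  qed
  also have "(\<lambda>t. \<Sum>n. ?f n t) = (\<lambda>t. paired_mellin (dressed_zeta v) y \<alpha> (Complex 2 t))"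
  proof
    fix t
    let ?s = "Complex 2 t"
    have "(\<lambda>n. ?f n t) sums (riemann_zeta (?s - y) * riemann_zeta (?s + y) * ?G (pi * \<alpha>) ?s)"
      unfolding scale by (intro sums_mult2 series) simp
    then have "(\<Sum>n. ?f n t) = riemann_zeta (?s - y) * riemann_zeta (?s + y) * ?G (pi * \<alpha>) ?s"
      by (rule sums_unique[symmetric])
    also have "\<dots> = paired_mellin (dressed_zeta v) y \<alpha> ?s"
    proof -
      have "of_real (pi * \<alpha>) powr (- ?s) = of_real pi powr (- ?s) * of_real \<alpha> powr (- ?s)"
        using assms powr_times_real[of "of_real pi" "of_real \<alpha>" "- ?s"] by simp
      moreover have "of_real pi powr (- ?s) = of_real pi powr (- (?s - y) / 2) * (of_real pi powr (- (?s + y) / 2) :: complex)"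
        by (simp add: field_simps flip: powr_add)
      ultimately show ?thesis unfolding paired_mellin_def dressed_zeta_eq by (simp add: mult_ac)
    qed
    finally show "(\<Sum>n. ?f n t) = paired_mellin (dressed_zeta v) y \<alpha> ?s" .
  qed
  finally have "(\<lambda>n. exp (- v) / (8 * of_real pi) * (\<integral>t. ?f n t \<partial>lborel)) sums
      (exp (- v) / (8 * of_real pi) * (\<integral>t. paired_mellin (dressed_zeta v) y \<alpha> (Complex 2 t) \<partial>lborel))"
    by (rule sums_mult)
  then show ?thesis unfolding bessel[symmetric] by (simp add: v_def y_def)
qed

text \<open>
  Inside the critical strip the defining product is already analytic, so that removing
  singularities changes nothing.
\<close>

lemma riemann_xi_eq:
  assumes "0 < Re p" "Re p < 1"
  shows "riemann_xi p = 1/2 * p * (p - 1) * completed_zeta p"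
proof -
  let ?f = "\<lambda>s. 1/2 * s * (s - 1) * of_real pi powr (- s / 2) * Gamma (s / 2) * riemann_zeta s"
  let ?S = "{s. Re s > 0} \<inter> {s. Re s < 1}"
  have "riemann_zeta holomorphic_on ?S"
    unfolding riemann_zeta_eq_glued by (rule holomorphic_on_subset[OF zeta_glued_holomorphic]) auto
  then have "?f holomorphic_on ?S"
    by (intro holomorphic_intros) (auto elim!: nonpos_Ints_cases simp: complex_eq_iff)
  moreover have "open ?S" by (intro open_Int open_halfspace_Re_gt open_halfspace_Re_lt)
  ultimately have "?f analytic_on {p}"
    using assms by (auto simp: analytic_at)
  then show ?thesis unfolding riemann_xi_def completed_zeta_def by (simp add: mult_ac)
qed

text \<open>
  In terms of \<open>s = (1 + it)/2\<close> and \<open>y = z/2\<close>, the polynomial factors of the two values of \<open>\<xi>\<close> and the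
  denominator are both multiples of \<open>(s - y)(s + y)(1 - s - y)(1 - s + y)\<close>. Kummer's transformation
  handles \<open>\<rho>(s)\<close>, and the functional equation reduces the summand with \<open>\<rho>(1 - s)\<close> to the same
  computation at \<open>1 - s\<close>.
\<close>

lemma Xi_integrand_eq:
  fixes t :: real and w :: complex
  assumes z: "-1 < Re z" "Re z < 1" and "\<alpha> > 0"
  defines "J \<equiv> paired_mellin (dressed_zeta (w\<^sup>2 / 4)) (z / 2) \<alpha>"
  shows "Xi_integrand \<alpha> z w t = exp (- w\<^sup>2 / 2) * of_real (sqrt \<alpha>) / 64 *
           (J (Complex (1/2) (t / 2)) + J (Complex (1/2) (- (t / 2))))"
proof -
  define y v where "y = z / 2" and "v = w\<^sup>2 / 4"
  define s where "s = Complex (1/2) (t / 2)"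
  have s: "s = (1 + \<i> * of_real t) / 2" "1 - s = Complex (1/2) (- (t / 2))" by (simp_all add: s_def complex_eq_iff)
  have it: "\<i> * of_real t = 2 * s - 1" by (simp add: s_def complex_eq_iff)
  have t2: "(of_real t)\<^sup>2 = - ((2 * s - 1)\<^sup>2)"
    unfolding it[symmetric] by (simp add: power_mult_distrib)
  have strip: "0 < Re (s - y)" "Re (s - y) < 1" "0 < Re (s + y)" "Re (s + y) < 1"
    using z by (auto simp: y_def s_def)
  have nz: "s - y \<noteq> 0" "s + y \<noteq> 0" "1 - s - y \<noteq> 0" "1 - s + y \<noteq> 0"
    using strip by (auto simp: complex_eq_iff)
  define L where "L = completed_zeta (s - y) * completed_zeta (s + y)"
  have xi1: "riemann_Xi ((of_real t + \<i> * z) / 2) = riemann_xi (s - y)"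
  proof -
    have "1/2 + \<i> * ((of_real t + \<i> * z) / 2) = s - y" by (simp add: s y_def algebra_simps add_divide_distrib)
    then show ?thesis by (simp only: riemann_Xi_def)
  qed
  have xi2: "riemann_Xi ((of_real t - \<i> * z) / 2) = riemann_xi (s + y)"
  proof -
    have "1/2 + \<i> * ((of_real t - \<i> * z) / 2) = s + y" by (simp add: s y_def algebra_simps add_divide_distrib)
    then show ?thesis by (simp only: riemann_Xi_def)
  qed
  define D where "D = (s - y) * (s + y) * (1 - s - y) * (1 - s + y)"
  have D: "D \<noteq> 0" using nz by (simp add: D_def)
  have poly: "(1/2 * p * (p - 1) * A) * (1/2 * q * (q - 1) * B) = p * q * (1 - q) * (1 - p) * (A * B) / 4" for p q A B :: complex
    by (simp add: field_simps)
  have sy: "1 - s - y = 1 - (s + y)" "1 - s + y = 1 - (s - y)" by simp_all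
  have xi: "riemann_Xi ((of_real t + \<i> * z) / 2) * riemann_Xi ((of_real t - \<i> * z) / 2) =
      D * L / 4"
    unfolding xi1 xi2 riemann_xi_eq[OF strip(1,2)] riemann_xi_eq[OF strip(3,4)] L_def D_def sy by (rule poly)
  have den: "((of_real t)\<^sup>2 + (z + 1)\<^sup>2) * ((of_real t)\<^sup>2 + (z - 1)\<^sup>2) = 16 * D"
  proof -
    have "z = 2 * y" by (simp add: y_def)
    then show ?thesis unfolding t2 D_def by algebra
  qed
  \<comment> \<open>By the functional equation \<open>L\<close> is invariant under \<open>s \<mapsto> 1 - s\<close>.\<close>
  have L1: "L = completed_zeta (1 - s - y) * completed_zeta (1 - s + y)"
  proof -
    have "completed_zeta (1 - (s - y)) = completed_zeta (s - y)" "completed_zeta (1 - (s + y)) = completed_zeta (s + y)"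
      using strip nz by (intro completed_zeta_reflect; simp)+
    then show ?thesis by (simp add: L_def algebra_simps)
  qed
  have rho: "completed_zeta (p - y) * completed_zeta (p + y) * rho \<alpha> (z / 2) w p = exp (- w\<^sup>2 / 2) * of_real (sqrt \<alpha>) * J p" for p
  proof -
    have k: "hyp1F1 a (1/2) (- w\<^sup>2 / 4) = exp (- v) * hyp1F1 (1/2 - a) (1/2) v" for a
      using kummer_transformation_half[of a v] by (simp add: v_def)
    have e1: "exp (- w\<^sup>2 / 2) = exp (- v) * exp (- v)" by (simp add: v_def flip: exp_add)
    have e2: "of_real \<alpha> powr (1/2 - p) = of_real (sqrt \<alpha>) * (of_real \<alpha> powr (- p) :: complex)"
    proof -
      have "of_real \<alpha> powr (1/2 :: complex) = of_real (sqrt \<alpha>)"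
        using powr_of_real[of \<alpha> "1/2"] assms(3) by (simp add: powr_half_sqrt)
      then show ?thesis using powr_add[of "of_real \<alpha> :: complex" "1/2" "- p"] by simp
    qed
    have e3: "1/2 - (1 - p - y) / 2 = (p + y) / 2" "1/2 - (1 - p + y) / 2 = (p - y) / 2"
      by (simp_all add: field_simps)
    show ?thesis
      unfolding rho_def J_def paired_mellin_def dressed_zeta_def y_def[symmetric] v_def[symmetric]
      unfolding k e1 e2 e3 by (simp only: mult_ac)
  qed
  have "L * nabla2 \<alpha> (z / 2) w ((1 + \<i> * of_real t) / 2) = L * rho \<alpha> (z / 2) w s + L * rho \<alpha> (z / 2) w (1 - s)"
    unfolding nabla2_def s(1)[symmetric] by (simp add: distrib_left)
  also have "L * rho \<alpha> (z / 2) w s = exp (- w\<^sup>2 / 2) * of_real (sqrt \<alpha>) * J s" unfolding L_def by (rule rho)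
  also have "L * rho \<alpha> (z / 2) w (1 - s) = exp (- w\<^sup>2 / 2) * of_real (sqrt \<alpha>) * J (1 - s)" unfolding L1 by (rule rho)
  finally have nab: "L * nabla2 \<alpha> (z / 2) w ((1 + \<i> * of_real t) / 2) = exp (- w\<^sup>2 / 2) * of_real (sqrt \<alpha>) * (J s + J (1 - s))"
    by (simp add: distrib_left)
  have "Xi_integrand \<alpha> z w t = L * nabla2 \<alpha> (z / 2) w ((1 + \<i> * of_real t) / 2) / 64"
    unfolding Xi_integrand_def xi den using D by (simp add: field_simps)
  then show ?thesis unfolding nab s_def[symmetric] s(2) by simp
qed

lemma has_integral_fold_half_line:
  fixes P :: "real \<Rightarrow> complex"
  assumes P: "integrable lborel P"
  shows "((\<lambda>t. P t + P (- t)) has_integral (\<integral>t. P t \<partial>lborel)) {0..}"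
proof -
  have [measurable]: "P \<in> borel_measurable borel" using P by (simp add: borel_measurable_integrable)
  have P': "integrable lborel (\<lambda>t. P (- t))" using lborel_integrable_real_affine[OF P, of "-1" 0] by simp
  have i1: "integrable lborel (\<lambda>t. indicat_real {0..} t *\<^sub>R P t)" "integrable lborel (\<lambda>t. indicat_real {..0} t *\<^sub>R P t)"
    "integrable lborel (\<lambda>t. indicat_real {0..} t *\<^sub>R P (- t))"
    using P P' by (auto intro!: integrable_mult_indicator)
  have si: "set_integrable lborel {0..} (\<lambda>t. P t + P (- t))"
    unfolding set_integrable_def scaleR_add_right using i1 by auto
  have "(\<integral>t. indicat_real {..0} t *\<^sub>R P t \<partial>lborel) = \<bar>-1\<bar> *\<^sub>R (\<integral>t. indicat_real {..0} (0 + (-1) * t) *\<^sub>R P (0 + (-1) * t) \<partial>lborel)"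
    by (rule lborel_integral_real_affine) simp
  also have "\<dots> = (\<integral>t. indicat_real {0..} t *\<^sub>R P (- t) \<partial>lborel)"
    by (simp add: indicator_def)
  finally have refl: "(\<integral>t. indicat_real {0..} t *\<^sub>R P (- t) \<partial>lborel) = (\<integral>t. indicat_real {..0} t *\<^sub>R P t \<partial>lborel)" ..
  have "(LBINT t:{0..}. P t + P (- t)) = (\<integral>t. indicat_real {0..} t *\<^sub>R P t \<partial>lborel) + (\<integral>t. indicat_real {..0} t *\<^sub>R P t \<partial>lborel)"
    unfolding set_lebesgue_integral_def scaleR_add_right refl[symmetric] using i1 by simp
  also have "\<dots> = (\<integral>t. indicat_real {0..} t *\<^sub>R P t + indicat_real {..0} t *\<^sub>R P t \<partial>lborel)"
    using i1 by simp
  also have "\<dots> = (\<integral>t. P t \<partial>lborel)"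
  proof (rule integral_cong_AE)
    have "AE t in lborel. t \<noteq> (0 :: real)" by (rule AE_lborel_singleton)
    then show "AE t in lborel. indicat_real {0..} t *\<^sub>R P t + indicat_real {..0} t *\<^sub>R P t = P t"
      by eventually_elim (auto simp: indicator_def)
  qed auto
  finally show ?thesis using set_borel_integral_eq_integral[OF si] by (simp add: has_integral_integral)
qed

text \<open>
  The sum runs over a set, so that at \<open>z = 0\<close> the double pole at 1 is counted once.
\<close>

lemma paired_dressed_zeta_shift:
  fixes v :: complex
  assumes z: "-1 < Re z" "Re z < 1" and "\<alpha> > 0"
  defines "J \<equiv> paired_mellin (dressed_zeta v) (z / 2) \<alpha>"
  shows "integrable lborel (\<lambda>t. J (Complex (1/2) t))"
    and "(\<integral>t. J (Complex 2 t) \<partial>lborel) =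
         (\<integral>t. J (Complex (1/2) t) \<partial>lborel) + 2 * of_real pi * (\<Sum>p\<in>{1 + z / 2, 1 - z / 2}. residue J p)"
proof -
  define y where "y = z / 2"
  have y: "\<bar>Re y\<bar> < 1/2" using z by (auto simp: y_def)
  obtain C where C: "C > 0" "\<And>s. 1/2 - \<bar>Re y\<bar> \<le> Re s \<Longrightarrow> Re s \<le> 2 + \<bar>Re y\<bar> \<Longrightarrow> 1 \<le> norm (s - 1) \<Longrightarrow>
      norm (dressed_zeta v s) \<le> C * exp (- (ln 2 / 16) * \<bar>Im s\<bar>)"
    using dressed_zeta_decay[of "1/2 - \<bar>Re y\<bar>" 1 "2 + \<bar>Re y\<bar>" v] y by auto
  have bnd: "norm (J s) \<le> (C * exp (ln 2 / 16 * norm y))\<^sup>2 * (\<alpha> powr (- (1/2)) + \<alpha> powr (- 2)) * exp (- (2 * (ln 2 / 16)) * \<bar>Im s\<bar>)"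
    if s: "1/2 \<le> Re s" "Re s \<le> 2" "norm y + 1 \<le> \<bar>Im s\<bar>" for s
    unfolding J_def y_def[symmetric]
  proof (rule paired_mellin_decay[where A = "1/2 - \<bar>Re y\<bar>" and B = "2 + \<bar>Re y\<bar>" and r = 1])
    have "\<bar>Im y\<bar> \<le> norm y" by (rule abs_Im_le_cmod)
    then have "1 \<le> \<bar>Im (s - y - 1)\<bar>" "1 \<le> \<bar>Im (s + y - 1)\<bar>" using s(3) by auto
    then show "1 \<le> norm (s - y - 1)" "1 \<le> norm (s + y - 1)"
      using abs_Im_le_cmod[of "s - y - 1"] abs_Im_le_cmod[of "s + y - 1"] by linarith+
  qed (use s C assms in \<open>auto simp: abs_if\<close>)
  have "J holomorphic_on {s. Re s > \<bar>Re y\<bar>} - ((\<lambda>p. p + y) ` {1} \<union> (\<lambda>p. p - y) ` {1})"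
    unfolding J_def y_def[symmetric] by (rule paired_mellin_holomorphic[OF dressed_zeta_holomorphic assms(3)])
  then have holo: "J holomorphic_on {s. Re s > \<bar>Re y\<bar>} - {1 + y, 1 - y}" by (simp add: insert_commute)
  have fin: "finite {1 + y, 1 - y}" by simp
  have "(1/2 :: real) < 2" by simp
  note shift = vertical_line_shift[OF open_halfspace_Re_gt convex_halfspace_Re_gt fin holo this _ _ _ bnd]
  show "integrable lborel (\<lambda>t. J (Complex (1/2) t))" by (rule shift(1)) (use y in auto)
  show "(\<integral>t. J (Complex 2 t) \<partial>lborel) =
         (\<integral>t. J (Complex (1/2) t) \<partial>lborel) + 2 * of_real pi * (\<Sum>p\<in>{1 + z / 2, 1 - z / 2}. residue J p)"
    unfolding y_def[symmetric] by (rule shift(3)) (use y in auto)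
qed

text \<open>
  Only the factor at \<open>s - z/2\<close> has a pole at \<open>1 + z/2\<close>. The other one takes the value
  \<open>\<Lambda>(1 + z) = \<Lambda>(-z)\<close>. The residue at \<open>1 - z/2\<close> follows on replacing \<open>z\<close> by \<open>-z\<close>.
\<close>

lemma residue_paired_dressed_zeta:
  assumes z: "-1 < Re z" "Re z < 1" "z \<noteq> 0" and "\<alpha> > 0"
  shows "residue (paired_mellin (dressed_zeta v) (z / 2) \<alpha>) (1 + z / 2) =
         exp v * (of_real pi powr (z / 2) * Gamma (- z / 2) * riemann_zeta (- z) * hyp1F1 ((1 + z) / 2) (1/2) v) *
         of_real \<alpha> powr (- z / 2 - 1)"
proof -
  define y where "y = z / 2"
  have y: "\<bar>Re y\<bar> < 1/2" "y \<noteq> 0" using z by (auto simp: y_def)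
  let ?J = "paired_mellin (dressed_zeta v) y \<alpha>"
  let ?S = "{s. Re s > \<bar>Re y\<bar>} - {1 - y}"
  have "1 + y \<noteq> 1 - y" using y by (simp add: complex_eq_iff)
  have "?J holomorphic_on {s. Re s > \<bar>Re y\<bar>} - ((\<lambda>p. p + y) ` {1} \<union> (\<lambda>p. p - y) ` {1})"
    by (rule paired_mellin_holomorphic[OF dressed_zeta_holomorphic assms(4)])
  then have holo: "?J holomorphic_on ?S - {1 + y}" by (rule holomorphic_on_subset) auto
  have r: "residue ?J (1 + y) = exp v * dressed_zeta v (1 + z) * of_real \<alpha> powr (- (1 + y))"
  proof (rule residue_simple'[OF _ _ holo])
    show "open ?S" by (intro open_Diff open_halfspace_Re_gt) auto
    show "1 + y \<in> ?S" using y \<open>1 + y \<noteq> 1 - y\<close> by auto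
    have "\<forall>\<^sub>F w in at (1 + y). w - y \<noteq> 1"
      unfolding eventually_at_filter by (rule always_eventually) (auto simp: algebra_simps)
    moreover have "((\<lambda>w. w - y) \<longlongrightarrow> 1) (at (1 + y))" by (auto intro!: tendsto_eq_intros)
    ultimately have "filterlim (\<lambda>w. w - y) (at 1) (at (1 + y))" by (simp add: filterlim_at)
    from filterlim_compose[OF dressed_zeta_residue this]
    have 1: "((\<lambda>w. dressed_zeta v (w - y) * (w - y - 1)) \<longlongrightarrow> exp v) (at (1 + y))" .
    have "isCont (dressed_zeta v) (1 + z)"
    proof -
      have "open ({s. Re s > 0} - {1 :: complex})" by (intro open_Diff open_halfspace_Re_gt) auto
      moreover have "1 + z \<in> {s. Re s > 0} - {1}" using z by auto
      ultimately show ?thesis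
        using holomorphic_on_imp_continuous_on[OF dressed_zeta_holomorphic] continuous_on_eq_continuous_at by blast
    qed
    moreover have "((\<lambda>w. w + y) \<longlongrightarrow> 1 + z) (at (1 + y))" by (auto simp: y_def intro!: tendsto_eq_intros)
    ultimately have 2: "((\<lambda>w. dressed_zeta v (w + y)) \<longlongrightarrow> dressed_zeta v (1 + z)) (at (1 + y))"
      by (rule isCont_tendsto_compose)
    have 3: "((\<lambda>w. of_real \<alpha> powr (- w)) \<longlongrightarrow> of_real \<alpha> powr (- (1 + y))) (at (1 + y))"
      using assms(4) by (intro tendsto_intros) auto
    have "((\<lambda>w. (dressed_zeta v (w - y) * (w - y - 1)) * dressed_zeta v (w + y) * of_real \<alpha> powr (- w)) \<longlongrightarrow>
        exp v * dressed_zeta v (1 + z) * of_real \<alpha> powr (- (1 + y))) (at (1 + y))"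
      by (intro tendsto_mult 1 2 3)
    then show "((\<lambda>w. ?J w * (w - (1 + y))) \<longlongrightarrow> exp v * dressed_zeta v (1 + z) * of_real \<alpha> powr (- (1 + y))) (at (1 + y))"
      by (simp add: paired_mellin_def algebra_simps)
  qed
  have d: "dressed_zeta v (1 + z) = of_real pi powr (z / 2) * Gamma (- z / 2) * riemann_zeta (- z) * hyp1F1 ((1 + z) / 2) (1/2) v"
  proof -
    have "completed_zeta (1 - (- z)) = completed_zeta (- z)" by (rule completed_zeta_reflect) (use z in auto)
    then show ?thesis by (simp add: dressed_zeta_def completed_zeta_def)
  qed
  have e: "- (1 + y) = - z / 2 - 1" by (simp add: y_def)
  show ?thesis using r[unfolded d e] unfolding y_def .
qed

lemma paired_mellin_minus: "paired_mellin h (- y) x = paired_mellin h y x"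
  by (simp add: paired_mellin_def fun_eq_iff mult_ac)

text \<open>
  The integrand is a sum of the values of one function at \<open>t\<close> and \<open>-t\<close>, so the half-line unfolds to the
  critical line.
\<close>

lemma Xi_integrand_has_integral:
  assumes z: "-1 < Re z" "Re z < 1" and "\<alpha> > 0"
  shows "(Xi_integrand \<alpha> z w has_integral
     (exp (- w\<^sup>2 / 2) * of_real (sqrt \<alpha>) / 32 * (\<integral>t. paired_mellin (dressed_zeta (w\<^sup>2 / 4)) (z / 2) \<alpha> (Complex (1/2) t) \<partial>lborel))) {0..}"
proof -
  define J where "J = paired_mellin (dressed_zeta (w\<^sup>2 / 4)) (z / 2) \<alpha>"
  have J: "integrable lborel (\<lambda>t. J (Complex (1/2) t))"
    unfolding J_def by (rule paired_dressed_zeta_shift(1)[OF assms])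
  \<comment> \<open>The variable of the theorem is twice the imaginary part of \<open>s\<close>.\<close>
  define P where "P = (\<lambda>t. J (Complex (1/2) (0 + 1/2 * t)))"
  have "integrable lborel P" unfolding P_def by (rule lborel_integrable_real_affine[OF J]) simp
  from has_integral_mult_right[OF has_integral_fold_half_line[OF this], of "exp (- w\<^sup>2 / 2) * of_real (sqrt \<alpha>) / 64"]
  have "((\<lambda>t. exp (- w\<^sup>2 / 2) * of_real (sqrt \<alpha>) / 64 * (P t + P (- t))) has_integral
      (exp (- w\<^sup>2 / 2) * of_real (sqrt \<alpha>) / 64 * (\<integral>t. P t \<partial>lborel))) {0..}" .
  moreover have "(\<lambda>t. exp (- w\<^sup>2 / 2) * of_real (sqrt \<alpha>) / 64 * (P t + P (- t))) = Xi_integrand \<alpha> z w"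
    unfolding P_def J_def by (intro ext) (simp add: Xi_integrand_eq[OF assms])
  moreover have "(\<integral>t. J (Complex (1/2) t) \<partial>lborel) = \<bar>1/2\<bar> *\<^sub>R (\<integral>t. P t \<partial>lborel)"
    unfolding P_def by (rule lborel_integral_real_affine) simp
  then have "(\<integral>t. P t \<partial>lborel) = 2 * (\<integral>t. J (Complex (1/2) t) \<partial>lborel)"
    by (simp only: scaleR_conv_of_real) simp
  ultimately show ?thesis by (simp add: J_def mult_ac)
qed

text \<open>
  Dominated convergence: for \<open>\<bar>z\<bar> \<le> 1/2\<close> the points \<open>s - z/2\<close> and \<open>s + z/2\<close> stay in the strip
  \<open>1/4 \<le> Re s \<le> 3/4\<close>, where the decay of the integrand is uniform in \<open>z\<close>.
\<close>

lemma critical_line_integral_continuous: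
  assumes "\<alpha> > 0"
  shows "((\<lambda>z. \<integral>t. paired_mellin (dressed_zeta v) (z / 2) \<alpha> (Complex (1/2) t) \<partial>lborel) \<longlongrightarrow>
     (\<integral>t. paired_mellin (dressed_zeta v) 0 \<alpha> (Complex (1/2) t) \<partial>lborel)) (at 0)"
  unfolding tendsto_at_iff_sequentially
proof (intro allI impI, unfold comp_def)
  fix X :: "nat \<Rightarrow> complex" assume X0: "X \<longlonglongrightarrow> 0"
  let ?J = "\<lambda>z t. paired_mellin (dressed_zeta v) (z / 2) \<alpha> (Complex (1/2) t)"
  obtain C where C: "C > 0" "\<And>s. 1/4 \<le> Re s \<Longrightarrow> Re s \<le> 3/4 \<Longrightarrow> 1/4 \<le> norm (s - 1) \<Longrightarrow>
      norm (dressed_zeta v s) \<le> C * exp (- (ln 2 / 16) * \<bar>Im s\<bar>)"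
    using dressed_zeta_decay[of "1/4" "1/4" "3/4" v] by auto
  define D where "D = (C * exp (ln 2 / 16 * (1/4)))\<^sup>2 * (\<alpha> powr (- (1/2)) + \<alpha> powr (- (1/2)))"
  have bnd: "norm (?J z t) \<le> D * exp (- (2 * (ln 2 / 16)) * \<bar>t\<bar>)" if "norm z \<le> 1/2" for z t
  proof -
    have z4: "norm (z / 2) \<le> 1/4" using that by (simp add: norm_divide)
    then have "\<bar>Re (z / 2)\<bar> \<le> 1/4" using abs_Re_le_cmod[of "z / 2"] by linarith
    then have re: "- (1/4) \<le> Re (z / 2)" "Re (z / 2) \<le> 1/4" by linarith+
    let ?s = "Complex (1/2) t"
    have "1/4 \<le> \<bar>Re (?s - z / 2 - 1)\<bar>" "1/4 \<le> \<bar>Re (?s + z / 2 - 1)\<bar>" using re by auto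
    then have far: "1/4 \<le> norm (?s - z / 2 - 1)" "1/4 \<le> norm (?s + z / 2 - 1)"
      using abs_Re_le_cmod[of "?s - z / 2 - 1"] abs_Re_le_cmod[of "?s + z / 2 - 1"] by linarith+
    have "norm (?J z t) \<le> D * exp (- (2 * (ln 2 / 16)) * \<bar>Im ?s\<bar>)"
      unfolding D_def
      by (rule paired_mellin_decay[where A = "1/4" and B = "3/4" and r = "1/4"])
         (use C assms z4 re far in \<open>auto simp: field_simps\<close>)
    then show ?thesis by simp
  qed
  have meas: "(\<lambda>t. ?J z t) \<in> borel_measurable borel" if "norm z \<le> 1/2" for z
  proof -
    have "- 1 < Re z" "Re z < 1" using that abs_Re_le_cmod[of z] by linarith+
    from paired_dressed_zeta_shift(1)[OF this assms, of v] show ?thesis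
      by (simp add: borel_measurable_integrable)
  qed
  have meas0: "(\<lambda>t. paired_mellin (dressed_zeta v) 0 \<alpha> (Complex (1/2) t)) \<in> borel_measurable borel"
    using meas[of 0] by simp
  have "\<forall>\<^sub>F n in sequentially. norm (X n) < 1/2"
    using tendstoD[OF X0, of "1/2"] by simp
  then obtain N where N: "\<And>n. n \<ge> N \<Longrightarrow> norm (X n) \<le> 1/2"
    unfolding eventually_sequentially by (meson less_imp_le)
  have "(\<lambda>n. \<integral>t. ?J (X (n + N)) t \<partial>lborel) \<longlonglongrightarrow> (\<integral>t. paired_mellin (dressed_zeta v) 0 \<alpha> (Complex (1/2) t) \<partial>lborel)"
  proof (rule integral_dominated_convergence[where w = "\<lambda>t. D * exp (- (2 * (ln 2 / 16)) * \<bar>t\<bar>)"])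
    show "integrable lborel (\<lambda>t. D * exp (- (2 * (ln 2 / 16)) * \<bar>t\<bar>))"
      by (intro integrable_mult_right integrable_exp_neg_abs) auto
    show "AE t in lborel. norm (?J (X (n + N)) t) \<le> D * exp (- (2 * (ln 2 / 16)) * \<bar>t\<bar>)" for n
      by (intro AE_I2 bnd N) simp
    show "AE t in lborel. (\<lambda>n. ?J (X (n + N)) t) \<longlonglongrightarrow> paired_mellin (dressed_zeta v) 0 \<alpha> (Complex (1/2) t)"
    proof (rule AE_I2)
      fix t
      let ?s = "Complex (1/2) t"
      have op: "open ({s. Re s > 0} - {1 :: complex})" by (intro open_Diff open_halfspace_Re_gt) auto
      have "?s \<in> {s. Re s > 0} - {1}" by (auto simp: complex_eq_iff)
      then have cont: "isCont (dressed_zeta v) ?s"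
        using holomorphic_on_imp_continuous_on[OF dressed_zeta_holomorphic] op continuous_on_eq_continuous_at by blast
      have X: "(\<lambda>n. X (n + N)) \<longlonglongrightarrow> 0" using X0 by (rule LIMSEQ_ignore_initial_segment)
      have "(\<lambda>n. ?s - X (n + N) / 2) \<longlonglongrightarrow> ?s" "(\<lambda>n. ?s + X (n + N) / 2) \<longlonglongrightarrow> ?s"
        using X by (auto intro!: tendsto_eq_intros)
      then show "(\<lambda>n. ?J (X (n + N)) t) \<longlonglongrightarrow> paired_mellin (dressed_zeta v) 0 \<alpha> ?s"
        unfolding paired_mellin_def
        using isCont_tendsto_compose[OF cont] by (intro tendsto_mult tendsto_const) simp_all
    qed
  qed (use meas meas0 N in auto)
  then show "(\<lambda>n. \<integral>t. ?J (X n) t \<partial>lborel) \<longlonglongrightarrow> (\<integral>t. paired_mellin (dressed_zeta v) 0 \<alpha> (Complex (1/2) t) \<partial>lborel)"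
    by (rule LIMSEQ_offset)
qed

text \<open>
  Moving the line from \<open>Re s = 2\<close> to \<open>Re s = 1/2\<close> turns the Bessel series into the integral over the
  critical line plus the two residues, which the explicit terms subtract.
\<close>

lemma bessel_side_eq:
  assumes z: "-1 < Re z" "Re z < 1" "z \<noteq> 0" and "\<alpha> > 0"
  shows "bessel_side \<alpha> z w = exp (- w\<^sup>2 / 2) * of_real (sqrt \<alpha>) / (2 * of_real pi) *
     (\<integral>t. paired_mellin (dressed_zeta (w\<^sup>2 / 4)) (z / 2) \<alpha> (Complex (1/2) t) \<partial>lborel)"
proof -
  define v where "v = w\<^sup>2 / 4"
  define J where "J = paired_mellin (dressed_zeta v) (z / 2) \<alpha>"
  define r1 where "r1 = of_real pi powr (z / 2) * Gamma (- z / 2) * riemann_zeta (- z) * hyp1F1 ((1 + z) / 2) (1/2) v * of_real \<alpha> powr (- z / 2 - 1)"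
  define r2 where "r2 = of_real pi powr (- z / 2) * Gamma (z / 2) * riemann_zeta z * hyp1F1 ((1 - z) / 2) (1/2) v * of_real \<alpha> powr (z / 2 - 1)"
  define I2 where "I2 = (\<integral>t. J (Complex 2 t) \<partial>lborel)"
  have "residue J (1 + z / 2) = exp v * r1"
    unfolding J_def r1_def using residue_paired_dressed_zeta[OF z assms(4)] by (simp add: mult_ac)
  moreover have "residue J (1 - z / 2) = exp v * r2"
    unfolding J_def r2_def using residue_paired_dressed_zeta[of "- z" \<alpha> v] z assms(4)
    by (simp add: mult_ac paired_mellin_minus)
  moreover have "1 + z / 2 \<noteq> 1 - z / 2" using z(3) by (simp add: field_simps)
  ultimately have I: "(\<integral>t. J (Complex (1/2) t) \<partial>lborel) = I2 - 2 * of_real pi * exp v * (r1 + r2)"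
    using paired_dressed_zeta_shift(2)[OF z(1,2) assms(4), of v] unfolding I2_def J_def[symmetric]
    by (simp add: algebra_simps)
  have "(\<lambda>n. bessel_term \<alpha> z w (Suc n)) sums (exp (- v) / (8 * of_real pi) * I2)"
    using bessel_series[of \<alpha> z w] z assms(4) by (simp add: I2_def J_def v_def)
  then have series: "(\<Sum>n. bessel_term \<alpha> z w (Suc n)) = exp (- v) / (8 * of_real pi) * I2" by (rule sums_unique[symmetric])
  have e: "exp (- w\<^sup>2 / 4) = exp (- v)" "exp (- w\<^sup>2 / 2) = exp (- v) * exp (- v)"
    by (simp_all add: v_def flip: exp_add)
  have ee: "exp (- v) * exp v = 1" by (simp flip: exp_add)
  have "bessel_side \<alpha> z w = exp (- v) * of_real (sqrt \<alpha>) * (4 * (exp (- v) / (8 * of_real pi) * I2) - r2 - r1)"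
    unfolding bessel_side_def series e r1_def r2_def v_def[symmetric] by (simp add: mult_ac)
  also have "\<dots> = exp (- v) * of_real (sqrt \<alpha>) * (exp (- v) / (2 * of_real pi) * I2 - (exp (- v) * exp v) * (r1 + r2))"
    unfolding ee by (simp add: algebra_simps)
  also have "\<dots> = exp (- v) * exp (- v) * of_real (sqrt \<alpha>) / (2 * of_real pi) * (I2 - 2 * of_real pi * exp v * (r1 + r2))"
    by (simp add: field_simps)
  also have "I2 - 2 * of_real pi * exp v * (r1 + r2) = (\<integral>t. J (Complex (1/2) t) \<partial>lborel)" by (rule I[symmetric])
  finally show ?thesis unfolding e J_def v_def .
qed

theorem theorem1p3:
  fixes w z :: complex and \<alpha> \<beta> :: real
  assumes "-1 < Re z" and "Re z < 1"
    and "\<alpha> > 0" and "\<beta> > 0" and "\<alpha> * \<beta> = 1"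
  shows "Xi_integrand \<alpha> z w integrable_on {0..} \<and>
    summable (\<lambda>n. bessel_term \<alpha> z w (Suc n)) \<and>
    (z \<noteq> 0 \<longrightarrow>
      16 / of_real pi * integral {0..} (Xi_integrand \<alpha> z w) = bessel_side \<alpha> z w) \<and>
    (z = 0 \<longrightarrow>
      ((\<lambda>z'. bessel_side \<alpha> z' w) \<longlongrightarrow> 16 / of_real pi * integral {0..} (Xi_integrand \<alpha> z w)) (at 0))"
proof -
  let ?I = "\<lambda>z. \<integral>t. paired_mellin (dressed_zeta (w\<^sup>2 / 4)) (z / 2) \<alpha> (Complex (1/2) t) \<partial>lborel"
  let ?c = "exp (- w\<^sup>2 / 2) * of_real (sqrt \<alpha>) / (2 * of_real pi)"
  note hi = Xi_integrand_has_integral[OF assms(1-3), of w]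
  have val: "16 / of_real pi * integral {0..} (Xi_integrand \<alpha> z w) = ?c * ?I z"
    unfolding integral_unique[OF hi] by (simp add: field_simps)
  have lim: "((\<lambda>z'. bessel_side \<alpha> z' w) \<longlongrightarrow> 16 / of_real pi * integral {0..} (Xi_integrand \<alpha> z w)) (at 0)" if "z = 0"
  proof -
    have "((\<lambda>z'. ?c * ?I z') \<longlongrightarrow> ?c * ?I 0) (at 0)"
      unfolding div_0 by (rule tendsto_mult_left[OF critical_line_integral_continuous[OF assms(3)]])
    moreover have "\<forall>\<^sub>F z' in at 0. ?c * ?I z' = bessel_side \<alpha> z' w"
      unfolding eventually_at
    proof (intro exI[of _ 1] conjI ballI impI)
      fix z' :: complex assume "z' \<noteq> 0 \<and> dist z' 0 < 1"
      then have "z' \<noteq> 0" "\<bar>Re z'\<bar> < 1" using abs_Re_le_cmod[of z'] by auto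
      then show "?c * ?I z' = bessel_side \<alpha> z' w" using assms(3) by (subst bessel_side_eq) auto
    qed simp
    ultimately have "((\<lambda>z'. bessel_side \<alpha> z' w) \<longlongrightarrow> ?c * ?I 0) (at 0)" by (rule Lim_transform_eventually)
    then show ?thesis unfolding val by (simp only: that)
  qed
  show ?thesis
    using hi bessel_series[of \<alpha> z w] assms lim val bessel_side_eq[of z \<alpha> w]
    by (auto simp: has_integral_integrable sums_iff)
qed

end
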